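(* Let $G$ be a finite group generated by unitary reflections in a complex Hermitian space $V=\mathbb{C}^\ell$ and let $G'$ be any reflection subgroup of $G$. Let $\mathcal{H}=\mathcal{H}(G)$ and $\mathcal{H}'=\mathcal{H}(G')$ be the spaces of $G$-harmonic and $G'$-harmonic polynomials on $V$ respectively, and let $\mathcal{H}^{G'}$ be the subspace of $G'$-fixed elements of $\mathcal{H}$. Then there is a degree preserving isomorphism $$\xi:\mathcal{H}'\otimes_{\mathbb{C}}\mathcal{H}^{G'}\overset{\sim}{\longrightarrow}\mathcal{H}$$ of graded $\mathcal{N}$-modules, where $\mathcal{N}:=N_{\mathrm{GL}(V)}(G)\cap N_{\mathrm{GL}(V)}(G')$.
   Context: A reflection in $V$ is a finite-order linear transformation $\neq 1$ fixing a hyperplane pointwise (a pseudoreflection). A reflection subgroup of $G$ is a subgroup generated by some of the reflections in $G$. Let $S=S(V^* )$ be the coordinate ring of $V$ and $S(V)$ the symmetric algebra on $V$, both graded by polynomial degree and both acted upon by $\mathrm{GL}(V)$ (contragrediently on $V^*$). For $v\in V$ let $D_v$ be the derivation of $S$ given by $D_v(A)(x)=\lim_{t\to0}\frac{A(x+tv)-A(x)}{t}$; the map $v\mapsto D_v$ extends to an algebra homomorphism $a\mapsto D_a$ from $S(V)$ to the algebra of differential operators on $S$. Define the bilinear pairing $[a,P]:=D_a(P)(0)\in\mathbb{C}$ for $a\in S(V)$, $P\in S$. For a finite reflection group $G$ on $V$, let $\mathbf{f}\subset S(V)$ be the ideal generated by the elements of $S(V)^G$ with no constant term. The space of $G$-harmonic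 polynomials is $\mathcal{H}(G):=\{P\in S\mid [a,P]=0\text{ for all }a\in\mathbf{f}\}$, graded by polynomial degree; $\mathcal{H}(G')$ is defined in the same way with $G'$ in place of $G$. The group $\mathcal{N}$ acts on $\mathcal{H}(G')$, $\mathcal{H}(G)$ and $\mathcal{H}(G)^{G'}$ through its action on $S$, and acts diagonally on the tensor product, which carries the total grading. *)

theory Defs
  imports
    "HOL-Analysis.Analysis"
    "HOL-Algebra.Generated_Groups"
    "HOL-Algebra.Group_Action"
    "HOL-Library.Poly_Mapping"
begin

section \<open>The general linear group, reflections and reflection groups\<close>

definition GL :: "(complex ^ 'n ^ 'n) monoid" where
  "GL = \<lparr>carrier = {A. invertible A}, monoid.mult = (**), one = mat 1\<rparr>"

text \<open>The standard Hermitian form. The library's real inner product on \<^typ>\<open>complex ^ 'n\<close> is its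
  real part only.\<close>

definition hermitian_form :: "complex ^ 'n \<Rightarrow> complex ^ 'n \<Rightarrow> complex" where
  "hermitian_form x y = (\<Sum>i\<in>UNIV. x $ i * cnj (y $ i))"

definition is_unitary :: "complex ^ 'n ^ 'n \<Rightarrow> bool" where
  "is_unitary A \<longleftrightarrow> (\<forall>x y. hermitian_form (A *v x) (A *v y) = hermitian_form x y)"

definition is_hyperplane :: "(complex ^ 'n) set \<Rightarrow> bool" where
  "is_hyperplane H \<longleftrightarrow> vec.subspace H \<and> vec.dim H + 1 = CARD('n)"

text \<open>Powers of matrices are iterates of \<^term>\<open>(**) A\<close>, since \<open>(*)\<close> is the
  componentwise product on \<^typ>\<open>complex ^ 'n ^ 'n\<close>.\<close>

definition is_reflection :: "complex ^ 'n ^ 'n \<Rightarrow> bool" where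
  "is_reflection A \<longleftrightarrow>
     A \<noteq> mat 1 \<and> (\<exists>k>0. ((**) A ^^ k) (mat 1) = mat 1) \<and>
     (\<exists>H. is_hyperplane H \<and> (\<forall>x\<in>H. A *v x = x))"

definition finite_unitary_reflection_group :: "(complex ^ 'n ^ 'n) set \<Rightarrow> bool" where
  "finite_unitary_reflection_group G \<longleftrightarrow>
     finite G \<and> (\<exists>R. R \<subseteq> {A. is_reflection A \<and> is_unitary A} \<and> G = generate GL R)"

definition reflection_subgroup :: "(complex ^ 'n ^ 'n) set \<Rightarrow> (complex ^ 'n ^ 'n) set \<Rightarrow> bool" where
  "reflection_subgroup G' G \<longleftrightarrow> (\<exists>R. R \<subseteq> {A \<in> G. is_reflection A} \<and> G' = generate GL R)"


section \<open>The coordinate ring \<open>S = S(V\<^sup>*)\<close> and the symmetric algebra \<open>S(V)\<close>\<close>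

text \<open>Polynomials in commuting indeterminates indexed by \<^typ>\<open>'n\<close>: a finitely supported family of
  coefficients indexed by exponent vectors.\<close>

type_synonym 'n mpoly = "('n \<Rightarrow>\<^sub>0 nat) \<Rightarrow>\<^sub>0 complex"

definition mdeg :: "('n::finite \<Rightarrow>\<^sub>0 nat) \<Rightarrow> nat" where
  "mdeg m = (\<Sum>i\<in>UNIV. Poly_Mapping.lookup m i)"

definition peval :: "('n::finite) mpoly \<Rightarrow> complex ^ 'n \<Rightarrow> complex" where
  "peval p x = (\<Sum>m\<in>Poly_Mapping.keys p.
     Poly_Mapping.lookup p m * (\<Prod>i\<in>UNIV. (x $ i) ^ Poly_Mapping.lookup m i))"

text \<open>\<open>S\<close> consists of the polynomial functions on \<open>V\<close>, and \<open>polyfun_deg d\<close> is its homogeneous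
  component of degree \<open>d\<close> (including zero).\<close>

definition polyfuns :: "(complex ^ 'n \<Rightarrow> complex) set" where
  "polyfuns = range peval"

definition polyfun_deg :: "nat \<Rightarrow> (complex ^ 'n \<Rightarrow> complex) set" where
  "polyfun_deg d = peval ` {p. \<forall>m\<in>Poly_Mapping.keys p. mdeg m = d}"

definition fun_act :: "complex ^ 'n ^ 'n \<Rightarrow> (complex ^ 'n \<Rightarrow> complex) \<Rightarrow> complex ^ 'n \<Rightarrow> complex" where
  "fun_act g P = (\<lambda>x. P (matrix_inv g *v x))"

text \<open>The symmetric algebra \<open>S(V)\<close> is the polynomial ring \<^typ>\<open>'n mpoly\<close> whose indeterminates are the
  standard basis vectors of \<open>V\<close>; \<open>sym_of\<close> is the embedding of \<open>V\<close> in degree one, and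
  \<open>sym_act g\<close> is the algebra endomorphism extending \<open>v \<mapsto> g v\<close>.\<close>

definition sym_of :: "complex ^ 'n \<Rightarrow> ('n::finite) mpoly" where
  "sym_of v = (\<Sum>i\<in>UNIV. Poly_Mapping.single (Poly_Mapping.single i 1) (v $ i))"

definition sym_act :: "complex ^ 'n ^ 'n \<Rightarrow> ('n::finite) mpoly \<Rightarrow> 'n mpoly" where
  "sym_act g a = (\<Sum>m\<in>Poly_Mapping.keys a.
     Poly_Mapping.single 0 (Poly_Mapping.lookup a m) *
     (\<Prod>i\<in>UNIV. sym_of (g *v axis i 1) ^ Poly_Mapping.lookup m i))"

definition sym_invariants :: "(complex ^ 'n ^ 'n) set \<Rightarrow> ('n::finite) mpoly set" where
  "sym_invariants G = {a. \<forall>g\<in>G. sym_act g a = a}"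


section \<open>Differential operators and harmonic polynomials\<close>

definition dir_deriv :: "complex ^ 'n \<Rightarrow> (complex ^ 'n \<Rightarrow> complex) \<Rightarrow> complex ^ 'n \<Rightarrow> complex" where
  "dir_deriv v A = (\<lambda>x. Lim (at (0::complex)) (\<lambda>t. (A (x + t *s v) - A x) / t))"

text \<open>The operator \<open>D\<^sub>a\<close>. A monomial \<open>\<Prod>\<^sub>i e\<^sub>i\<^bsup>m\<^sub>i\<^esup>\<close> of \<open>S(V)\<close> acts as the composition of the
  \<open>m\<^sub>i\<close>-fold iterates of the derivations along the \<open>e\<^sub>i\<close>. These commute on \<^term>\<open>polyfuns\<close>, so
  there the choice of the order of composition (made by \<open>index_list\<close>) is irrelevant.
  The lemmas \<open>diff_op_sym_of\<close>, \<open>diff_op_add\<close>, \<open>diff_op_scalar\<close>, \<open>diff_op_one\<close> and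
  \<open>diff_op_times\<close> below show that \<open>a \<mapsto> D\<^sub>a\<close> is the algebra homomorphism extending
  \<open>v \<mapsto> D\<^sub>v\<close>.\<close>

definition index_list :: "('n::finite) list" where
  "index_list = (SOME xs. distinct xs \<and> set xs = UNIV)"

definition diff_monom ::
  "('n::finite \<Rightarrow>\<^sub>0 nat) \<Rightarrow> (complex ^ 'n \<Rightarrow> complex) \<Rightarrow> complex ^ 'n \<Rightarrow> complex" where
  "diff_monom m = foldr (\<lambda>i F. (dir_deriv (axis i 1) ^^ Poly_Mapping.lookup m i) \<circ> F) index_list id"

definition diff_op ::
  "('n::finite) mpoly \<Rightarrow> (complex ^ 'n \<Rightarrow> complex) \<Rightarrow> complex ^ 'n \<Rightarrow> complex" where
  "diff_op a P = (\<lambda>x. \<Sum>m\<in>Poly_Mapping.keys a. Poly_Mapping.lookup a m * diff_monom m P x)"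

definition pairing :: "('n::finite) mpoly \<Rightarrow> (complex ^ 'n \<Rightarrow> complex) \<Rightarrow> complex" where
  "pairing a P = diff_op a P 0"

text \<open>\<^term>\<open>module.span (*) X\<close> is the submodule of the regular module generated by \<open>X\<close>, that is,
  the ideal generated by \<open>X\<close>.\<close>

definition harmonic_ideal :: "(complex ^ 'n ^ 'n) set \<Rightarrow> ('n::finite) mpoly set" where
  "harmonic_ideal G = module.span (*) {a \<in> sym_invariants G. Poly_Mapping.lookup a 0 = 0}"

definition harmonics :: "(complex ^ 'n ^ 'n) set \<Rightarrow> (complex ^ 'n \<Rightarrow> complex) set" where
  "harmonics G = {P \<in> polyfuns. \<forall>a\<in>harmonic_ideal G. pairing a P = 0}"

definition harmonics_fixed ::
  "(complex ^ 'n ^ 'n) set \<Rightarrow> (complex ^ 'n ^ 'n) set \<Rightarrow> (complex ^ 'n \<Rightarrow> complex) set" where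
  "harmonics_fixed G G' = {P \<in> harmonics G. \<forall>g\<in>G'. fun_act g P = P}"


section \<open>Tensor products of spaces of functions\<close>

text \<open>The tensor product over the complex numbers of two vector spaces \<open>A\<close>, \<open>B\<close> of complex-valued
  functions, constructed as the free vector space on \<open>A \<times> B\<close> modulo the bilinearity relations.
  Its elements are equivalence classes; the operations are induced from representatives.\<close>

type_synonym ('a, 'b) tensor_rep = "(('a \<Rightarrow> complex) \<times> ('b \<Rightarrow> complex)) \<Rightarrow>\<^sub>0 complex"

definition rep_scale :: "complex \<Rightarrow> ('k \<Rightarrow>\<^sub>0 complex) \<Rightarrow> ('k \<Rightarrow>\<^sub>0 complex)" where
  "rep_scale c u = Poly_Mapping.map (\<lambda>z. c * z) u"

definition tensor_reps ::
  "('a \<Rightarrow> complex) set \<Rightarrow> ('b \<Rightarrow> complex) set \<Rightarrow> ('a, 'b) tensor_rep set" where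
  "tensor_reps A B = {u. Poly_Mapping.keys u \<subseteq> A \<times> B}"

abbreviation pure_tensor :: "('a \<Rightarrow> complex) \<Rightarrow> ('b \<Rightarrow> complex) \<Rightarrow> ('a, 'b) tensor_rep" where
  "pure_tensor P Q \<equiv> Poly_Mapping.single (P, Q) 1"

definition bilinearity_relations ::
  "('a \<Rightarrow> complex) set \<Rightarrow> ('b \<Rightarrow> complex) set \<Rightarrow> ('a, 'b) tensor_rep set" where
  "bilinearity_relations A B =
     {pure_tensor (\<lambda>x. P x + P' x) Q - pure_tensor P Q - pure_tensor P' Q | P P' Q. P \<in> A \<and> P' \<in> A \<and> Q \<in> B} \<union>
     {pure_tensor P (\<lambda>x. Q x + Q' x) - pure_tensor P Q - pure_tensor P Q' | P Q Q'. P \<in> A \<and> Q \<in> B \<and> Q' \<in> B} \<union>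
     {pure_tensor (\<lambda>x. c * P x) Q - rep_scale c (pure_tensor P Q) | c P Q. P \<in> A \<and> Q \<in> B} \<union>
     {pure_tensor P (\<lambda>x. c * Q x) - rep_scale c (pure_tensor P Q) | c P Q. P \<in> A \<and> Q \<in> B}"

definition tensor_equiv ::
  "('a \<Rightarrow> complex) set \<Rightarrow> ('b \<Rightarrow> complex) set \<Rightarrow>
   (('a, 'b) tensor_rep \<times> ('a, 'b) tensor_rep) set" where
  "tensor_equiv A B = {(u, w). u \<in> tensor_reps A B \<and> w \<in> tensor_reps A B \<and>
     u - w \<in> module.span rep_scale (bilinearity_relations A B)}"

definition tensor_prod ::
  "('a \<Rightarrow> complex) set \<Rightarrow> ('b \<Rightarrow> complex) set \<Rightarrow> ('a, 'b) tensor_rep set set" where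
  "tensor_prod A B = tensor_reps A B // tensor_equiv A B"

definition tensor_add ::
  "('a \<Rightarrow> complex) set \<Rightarrow> ('b \<Rightarrow> complex) set \<Rightarrow>
   ('a, 'b) tensor_rep set \<Rightarrow> ('a, 'b) tensor_rep set \<Rightarrow> ('a, 'b) tensor_rep set" where
  "tensor_add A B X Y = (\<Union>u\<in>X. \<Union>w\<in>Y. tensor_equiv A B `` {u + w})"

definition tensor_scale ::
  "('a \<Rightarrow> complex) set \<Rightarrow> ('b \<Rightarrow> complex) set \<Rightarrow>
   complex \<Rightarrow> ('a, 'b) tensor_rep set \<Rightarrow> ('a, 'b) tensor_rep set" where
  "tensor_scale A B c X = (\<Union>u\<in>X. tensor_equiv A B `` {rep_scale c u})"

text \<open>The diagonal action \<open>P \<otimes> Q \<mapsto> g P \<otimes> g Q\<close>, extended linearly to representatives.\<close>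

definition rep_act ::
  "complex ^ 'n ^ 'n \<Rightarrow> (complex ^ 'n, complex ^ 'n) tensor_rep \<Rightarrow>
   (complex ^ 'n, complex ^ 'n) tensor_rep" where
  "rep_act g u = (\<Sum>(P, Q)\<in>Poly_Mapping.keys u.
     rep_scale (Poly_Mapping.lookup u (P, Q)) (pure_tensor (fun_act g P) (fun_act g Q)))"

definition tensor_act ::
  "(complex ^ 'n \<Rightarrow> complex) set \<Rightarrow> (complex ^ 'n \<Rightarrow> complex) set \<Rightarrow> complex ^ 'n ^ 'n \<Rightarrow>
   (complex ^ 'n, complex ^ 'n) tensor_rep set \<Rightarrow> (complex ^ 'n, complex ^ 'n) tensor_rep set" where
  "tensor_act A B g X = (\<Union>u\<in>X. tensor_equiv A B `` {rep_act g u})"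

text \<open>The component of total degree \<open>d\<close>: classes of linear combinations of \<open>P \<otimes> Q\<close> with
  \<open>P\<close>, \<open>Q\<close> homogeneous of degrees \<open>i\<close>, \<open>j\<close> such that \<open>i + j = d\<close>.\<close>

definition tensor_deg ::
  "(complex ^ 'n \<Rightarrow> complex) set \<Rightarrow> (complex ^ 'n \<Rightarrow> complex) set \<Rightarrow> nat \<Rightarrow>
   (complex ^ 'n, complex ^ 'n) tensor_rep set set" where
  "tensor_deg A B d = {tensor_equiv A B `` {u} | u.
     Poly_Mapping.keys u \<subseteq>
       (\<Union>i\<le>d. (A \<inter> polyfun_deg i) \<times> (B \<inter> polyfun_deg (d - i)))}"

text \<open>\<open>\<xi>\<close> is an isomorphism of graded \<open>N\<close>-modules from \<open>A \<otimes> B\<close>, with diagonal action and total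
  grading, onto the space \<open>C\<close> of polynomial functions graded by degree. The condition
  \<open>tensor_act A B n X \<in> tensor_prod A B\<close> records that \<open>A \<otimes> B\<close> is stable under \<open>N\<close>; the
  stability of \<open>C\<close> then follows from the equivariance and surjectivity of \<open>\<xi>\<close>.\<close>

definition graded_module_iso ::
  "(complex ^ 'n ^ 'n) set \<Rightarrow> (complex ^ 'n \<Rightarrow> complex) set \<Rightarrow> (complex ^ 'n \<Rightarrow> complex) set \<Rightarrow>
   (complex ^ 'n \<Rightarrow> complex) set \<Rightarrow>
   ((complex ^ 'n, complex ^ 'n) tensor_rep set \<Rightarrow> (complex ^ 'n \<Rightarrow> complex)) \<Rightarrow> bool" where
  "graded_module_iso N A B C \<xi> \<longleftrightarrow>
     bij_betw \<xi> (tensor_prod A B) C \<and>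
     (\<forall>X\<in>tensor_prod A B. \<forall>Y\<in>tensor_prod A B. \<xi> (tensor_add A B X Y) = (\<lambda>x. \<xi> X x + \<xi> Y x)) \<and>
     (\<forall>c. \<forall>X\<in>tensor_prod A B. \<xi> (tensor_scale A B c X) = (\<lambda>x. c * \<xi> X x)) \<and>
     (\<forall>n\<in>N. \<forall>X\<in>tensor_prod A B.
        tensor_act A B n X \<in> tensor_prod A B \<and> \<xi> (tensor_act A B n X) = fun_act n (\<xi> X)) \<and>
     (\<forall>d. \<xi> ` tensor_deg A B d = C \<inter> polyfun_deg d)"


section \<open>Well-definedness\<close>

text \<open>\<open>pderiv_mpoly\<close> and \<open>pderiv_monom\<close> are the formal counterparts of \<^const>\<open>dir_deriv\<close>
  and \<^const>\<open>diff_monom\<close>; they only serve to prove that \<open>a \<mapsto> D\<^sub>a\<close> is an algebra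
  homomorphism.\<close>

lemma lookup_rep_scale [simp]: "Poly_Mapping.lookup (rep_scale c u) k = c * Poly_Mapping.lookup u k"
  by (simp add: rep_scale_def Poly_Mapping.map.rep_eq when_def)

lemma rep_scale_vs: "vector_space (rep_scale :: complex \<Rightarrow> ('k \<Rightarrow>\<^sub>0 complex) \<Rightarrow> _)"
  by unfold_locales
    (auto simp: lookup_add algebra_simps intro!: poly_mapping_eqI)

lemma group_GL: "group (GL :: (complex ^ 'n ^ 'n) monoid)"
proof (rule groupI)
  have "invertible (mat 1 :: complex ^ 'n ^ 'n)"
    unfolding invertible_def by (metis matrix_mul_lid)
  then show "\<one>\<^bsub>GL\<^esub> \<in> carrier (GL :: (complex ^ 'n ^ 'n) monoid)" by (simp add: GL_def)
next
  fix x :: "complex ^ 'n ^ 'n" assume "x \<in> carrier GL"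
  then have "invertible x" by (simp add: GL_def)
  then obtain y where "x ** y = mat 1" "y ** x = mat 1" by (auto simp: invertible_def)
  then show "\<exists>y\<in>carrier GL. y \<otimes>\<^bsub>GL\<^esub> x = \<one>\<^bsub>GL\<^esub>"
    by (auto simp: GL_def invertible_def)
qed (auto simp: GL_def invertible_mult matrix_mul_assoc)

lemma equiv_tensor_equiv: "equiv (tensor_reps A B) (tensor_equiv A B)"
proof -
  interpret V: vector_space "rep_scale :: complex \<Rightarrow> ('a, 'b) tensor_rep \<Rightarrow> _" by (rule rep_scale_vs)
  show ?thesis
  proof (rule equivI)
    show "refl_on (tensor_reps A B) (tensor_equiv A B)"
      by (auto simp: refl_on_def tensor_equiv_def V.span_zero)
    show "sym (tensor_equiv A B)"
    proof (rule symI)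
      fix u w assume "(u, w) \<in> tensor_equiv A B"
      then show "(w, u) \<in> tensor_equiv A B"
        using V.span_neg[of "u - w"] by (simp add: tensor_equiv_def)
    qed
    show "trans (tensor_equiv A B)"
    proof (rule transI)
      fix u w z assume "(u, w) \<in> tensor_equiv A B" "(w, z) \<in> tensor_equiv A B"
      then show "(u, z) \<in> tensor_equiv A B"
        using V.span_add[of "u - w" _ "w - z"] by (simp add: tensor_equiv_def)
    qed
  qed (auto simp: tensor_equiv_def)
qed

lemma keys_sum_superset:
  fixes p :: "'k \<Rightarrow>\<^sub>0 complex" and h :: "'k \<Rightarrow> complex \<Rightarrow> 'b::comm_monoid_add"
  assumes "finite K" "Poly_Mapping.keys p \<subseteq> K" "\<And>m. h m 0 = 0"
  shows "(\<Sum>m\<in>Poly_Mapping.keys p. h m (Poly_Mapping.lookup p m)) = (\<Sum>m\<in>K. h m (Poly_Mapping.lookup p m))"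
  by (rule sum.mono_neutral_left) (use assms in \<open>auto simp: in_keys_iff\<close>)

lemma keys_sum_add:
  fixes p q :: "'k \<Rightarrow>\<^sub>0 complex" and h :: "'k \<Rightarrow> complex \<Rightarrow> 'b::comm_monoid_add"
  assumes "\<And>m. h m 0 = 0" "\<And>m c d. h m (c + d) = h m c + h m d"
  shows "(\<Sum>m\<in>Poly_Mapping.keys (p + q). h m (Poly_Mapping.lookup (p + q) m)) =
    (\<Sum>m\<in>Poly_Mapping.keys p. h m (Poly_Mapping.lookup p m)) +
    (\<Sum>m\<in>Poly_Mapping.keys q. h m (Poly_Mapping.lookup q m))"
proof -
  let ?K = "Poly_Mapping.keys p \<union> Poly_Mapping.keys q"
  have "Poly_Mapping.keys (p + q) \<subseteq> ?K" by (rule Poly_Mapping.keys_add)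
  then show ?thesis
    by (subst (1 2 3) keys_sum_superset[where K = ?K])
       (use assms in \<open>auto simp: lookup_add sum.distrib\<close>)
qed

lemma poly_mapping_add_induct [case_names single add]:
  fixes p :: "'k \<Rightarrow>\<^sub>0 complex"
  assumes single: "\<And>m c. Q (Poly_Mapping.single m c)"
    and add: "\<And>p q. Q p \<Longrightarrow> Q q \<Longrightarrow> Q (p + q)"
  shows "Q p"
proof (induction p rule: update_induct)
  case const
  then show ?case using single[of _ 0] by simp
next
  case (update f a b)
  have "Poly_Mapping.update a b f = f + Poly_Mapping.single a b"
    using update.hyps by (intro poly_mapping_eqI)
      (auto simp: lookup_add lookup_update lookup_single when_def in_keys_iff)
  then show ?case using update.IH single add by simp
qed

lemma peval_add: "peval (p + q) = (\<lambda>x. peval p x + peval q x)"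
  unfolding peval_def by (subst keys_sum_add) (auto simp: algebra_simps)

lemma peval_single:
  "peval (Poly_Mapping.single m c) = (\<lambda>x. c * (\<Prod>i\<in>UNIV. (x $ i) ^ Poly_Mapping.lookup m i))"
  by (auto simp: peval_def)

lemma rep_scale_single: "rep_scale c (Poly_Mapping.single m d) = Poly_Mapping.single m (c * d)"
  by (intro poly_mapping_eqI) (auto simp: lookup_single when_def)

lemma rep_scale_add: "rep_scale c (p + q) = rep_scale c p + rep_scale c q"
  by (intro poly_mapping_eqI) (auto simp: lookup_add algebra_simps)

lemma peval_scale: "peval (rep_scale c p) = (\<lambda>x. c * peval p x)"
  by (induction p rule: poly_mapping_add_induct)
     (auto simp: rep_scale_single rep_scale_add peval_add peval_single algebra_simps)

definition pderiv_mpoly :: "'n::finite \<Rightarrow> 'n mpoly \<Rightarrow> 'n mpoly" where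
  "pderiv_mpoly i p = (\<Sum>m\<in>Poly_Mapping.keys p.
     Poly_Mapping.single (m - Poly_Mapping.single i 1)
       (Poly_Mapping.lookup p m * of_nat (Poly_Mapping.lookup m i)))"

lemma pderiv_mpoly_add: "pderiv_mpoly i (p + q) = pderiv_mpoly i p + pderiv_mpoly i q"
  unfolding pderiv_mpoly_def by (subst keys_sum_add) (auto simp: algebra_simps single_add)

lemma pderiv_mpoly_single: "pderiv_mpoly i (Poly_Mapping.single m c) =
   Poly_Mapping.single (m - Poly_Mapping.single i 1) (c * of_nat (Poly_Mapping.lookup m i))"
  by (auto simp: pderiv_mpoly_def)

lemma pderiv_mpoly_scale: "pderiv_mpoly i (rep_scale c p) = rep_scale c (pderiv_mpoly i p)"
  by (induction p rule: poly_mapping_add_induct)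
     (auto simp: pderiv_mpoly_single pderiv_mpoly_add rep_scale_single rep_scale_add mult.assoc)

lemma pderiv_mpoly_commute: "pderiv_mpoly i (pderiv_mpoly j p) = pderiv_mpoly j (pderiv_mpoly i p)"
proof (induction p rule: poly_mapping_add_induct)
  case (single m c)
  have "m - Poly_Mapping.single j 1 - Poly_Mapping.single i 1 = m - Poly_Mapping.single i 1 - Poly_Mapping.single j (1::nat)"
    by (intro poly_mapping_eqI) (auto simp: lookup_minus)
  then show ?case
    by (cases "i = j") (auto simp: pderiv_mpoly_single lookup_minus lookup_single when_def mult_ac)
qed (auto simp: pderiv_mpoly_add)

lemma has_field_derivative_peval:
  "((\<lambda>t. peval p (x + t *s v)) has_field_derivative (\<Sum>i\<in>UNIV. v $ i * peval (pderiv_mpoly i p) x)) (at 0)"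
proof (induction p rule: poly_mapping_add_induct)
  case (single m c)
  let ?l = "Poly_Mapping.lookup m"
  have eq: "(\<Prod>k\<in>UNIV. (x $ k) ^ Poly_Mapping.lookup (m - Poly_Mapping.single i 1) k) =
     (x $ i) ^ (?l i - 1) * (\<Prod>k\<in>UNIV - {i}. (x $ k) ^ ?l k)" for i
    by (subst prod.remove[of _ i])
       (auto simp: lookup_minus lookup_single when_def intro!: arg_cong2[where f = "(*)"] prod.cong)
  have "((\<lambda>t. c * (\<Prod>i\<in>UNIV. (x $ i + t * v $ i) ^ ?l i)) has_field_derivative
      c * (\<Sum>i\<in>UNIV. (of_nat (?l i) * (x $ i + 0 * v $ i) ^ (?l i - 1) * v $ i) *
         (\<Prod>k\<in>UNIV - {i}. (x $ k + 0 * v $ k) ^ ?l k))) (at 0)"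
    by (intro DERIV_cmult has_field_derivative_prod) (auto intro!: derivative_eq_intros)
  then show ?case
    by (simp add: pderiv_mpoly_single peval_single eq[simplified] sum_distrib_left algebra_simps)
next
  case (add p q)
  from DERIV_add[OF this] show ?case
    by (simp add: pderiv_mpoly_add peval_add algebra_simps sum.distrib)
qed

lemma dir_deriv_peval: "dir_deriv v (peval p) = (\<lambda>x. \<Sum>i\<in>UNIV. v $ i * peval (pderiv_mpoly i p) x)"
proof
  fix x
  have "((\<lambda>t. (peval p (x + t *s v) - peval p x) / t) \<longlongrightarrow>
     (\<Sum>i\<in>UNIV. v $ i * peval (pderiv_mpoly i p) x)) (at 0)"
    using has_field_derivative_peval[of p x v] by (simp add: has_field_derivative_iff)
  then show "dir_deriv v (peval p) x = (\<Sum>i\<in>UNIV. v $ i * peval (pderiv_mpoly i p) x)"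
    unfolding dir_deriv_def by (intro tendsto_Lim) auto
qed

lemma dir_deriv_axis_peval: "dir_deriv (axis i 1) (peval p) = peval (pderiv_mpoly i p)"
  by (simp add: dir_deriv_peval axis_def if_distrib[of "\<lambda>c. c * _"] cong: if_cong)

lemma index_list: "distinct (index_list :: 'n::finite list)" "set (index_list :: 'n list) = UNIV"
proof -
  have "\<exists>xs :: 'n list. distinct xs \<and> set xs = UNIV"
    using finite_distinct_list[OF finite[of "UNIV :: 'n set"]] by blast
  from someI_ex[OF this] show "distinct (index_list :: 'n list)" "set (index_list :: 'n list) = UNIV"
    by (auto simp: index_list_def)
qed

definition pderiv_monom :: "('n::finite \<Rightarrow>\<^sub>0 nat) \<Rightarrow> 'n mpoly \<Rightarrow> 'n mpoly" where
  "pderiv_monom m = foldr (\<lambda>i F. (pderiv_mpoly i ^^ Poly_Mapping.lookup m i) \<circ> F) index_list id"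

lemma pderiv_mpoly_pow_commute:
  "(pderiv_mpoly i ^^ k) ((pderiv_mpoly j ^^ l) p) = (pderiv_mpoly j ^^ l) ((pderiv_mpoly i ^^ k) p)"
proof -
  have 1: "pderiv_mpoly i ((pderiv_mpoly j ^^ l) p) = (pderiv_mpoly j ^^ l) (pderiv_mpoly i p)" for p
    by (induction l) (auto simp: pderiv_mpoly_commute[of i j])
  show ?thesis by (induction k) (auto simp: 1)
qed

lemma diff_monom_peval:
  fixes p :: "('n::finite) mpoly"
  shows "diff_monom m (peval p) = peval (pderiv_monom m p)"
proof -
  have pow: "(dir_deriv (axis i 1) ^^ k) (peval p) = peval ((pderiv_mpoly i ^^ k) p)"
    for i :: 'n and k and p :: "'n mpoly"
    by (induction k) (auto simp: dir_deriv_axis_peval)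
  have "foldr (\<lambda>i F. (dir_deriv (axis i 1) ^^ Poly_Mapping.lookup m i) \<circ> F) xs id (peval p) =
    peval (foldr (\<lambda>i F. (pderiv_mpoly i ^^ Poly_Mapping.lookup m i) \<circ> F) xs id p)" for xs
    by (induction xs) (auto simp: pow)
  then show ?thesis by (simp add: diff_monom_def pderiv_monom_def)
qed

lemma pderiv_monom_add:
  fixes p :: "('n::finite) mpoly"
  shows "pderiv_monom m (p + q) = pderiv_monom m p + pderiv_monom m q"
proof -
  have pow: "(pderiv_mpoly i ^^ k) (p + q) = (pderiv_mpoly i ^^ k) p + (pderiv_mpoly i ^^ k) q"
    for i :: 'n and k and p q :: "'n mpoly"
    by (induction k) (auto simp: pderiv_mpoly_add)
  have "foldr (\<lambda>i F. (pderiv_mpoly i ^^ Poly_Mapping.lookup m i) \<circ> F) xs id (p + q) =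
    foldr (\<lambda>i F. (pderiv_mpoly i ^^ Poly_Mapping.lookup m i) \<circ> F) xs id p +
    foldr (\<lambda>i F. (pderiv_mpoly i ^^ Poly_Mapping.lookup m i) \<circ> F) xs id q" for xs
    by (induction xs) (auto simp: pow)
  then show ?thesis by (simp add: pderiv_monom_def)
qed

lemma pderiv_monom_scale:
  fixes p :: "('n::finite) mpoly"
  shows "pderiv_monom m (rep_scale c p) = rep_scale c (pderiv_monom m p)"
proof -
  have pow: "(pderiv_mpoly i ^^ k) (rep_scale c p) = rep_scale c ((pderiv_mpoly i ^^ k) p)"
    for i :: 'n and k and p :: "'n mpoly"
    by (induction k) (auto simp: pderiv_mpoly_scale)
  have "foldr (\<lambda>i F. (pderiv_mpoly i ^^ Poly_Mapping.lookup m i) \<circ> F) xs id (rep_scale c p) =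
    rep_scale c (foldr (\<lambda>i F. (pderiv_mpoly i ^^ Poly_Mapping.lookup m i) \<circ> F) xs id p)" for xs
    by (induction xs) (auto simp: pow)
  then show ?thesis by (simp add: pderiv_monom_def)
qed

lemma pderiv_monom_plus:
  fixes p :: "('n::finite) mpoly"
  shows "pderiv_monom (m + n) p = pderiv_monom m (pderiv_monom n p)"
proof -
  let ?f = "\<lambda>(m :: 'n \<Rightarrow>\<^sub>0 nat) xs. foldr (\<lambda>i F. (pderiv_mpoly i ^^ Poly_Mapping.lookup m i) \<circ> F) xs id"
  have cons: "foldr (\<lambda>i F. g i \<circ> F) (i # xs) id q = g i (foldr (\<lambda>i F. g i \<circ> F) xs id q)"
    for g :: "'n \<Rightarrow> 'n mpoly \<Rightarrow> 'n mpoly" and i xs q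
    by simp
  have comm: "(pderiv_mpoly i ^^ k) (?f m xs p) = ?f m xs ((pderiv_mpoly i ^^ k) p)"
    for i k m xs and p :: "'n mpoly"
    by (induction xs) (auto simp: pderiv_mpoly_pow_commute[where i = i and k = k])
  have "?f (m + n) xs p = ?f m xs (?f n xs p)" for xs
  proof (induction xs)
    case (Cons i xs)
    have "?f (m + n) (i # xs) p = (pderiv_mpoly i ^^ Poly_Mapping.lookup m i)
        ((pderiv_mpoly i ^^ Poly_Mapping.lookup n i) (?f (m + n) xs p))"
      unfolding cons by (simp add: lookup_add funpow_add)
    also have "\<dots> = (pderiv_mpoly i ^^ Poly_Mapping.lookup m i)
        (?f m xs ((pderiv_mpoly i ^^ Poly_Mapping.lookup n i) (?f n xs p)))"
      unfolding Cons.IH comm ..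
    finally show ?case unfolding cons .
  qed simp
  then show ?thesis by (simp add: pderiv_monom_def)
qed

lemma diff_op_single: "diff_op (Poly_Mapping.single m c) P = (\<lambda>x. c * diff_monom m P x)"
  by (auto simp: diff_op_def)

lemma diff_op_add: "diff_op (a + b) P = (\<lambda>x. diff_op a P x + diff_op b P x)"
  unfolding diff_op_def by (subst keys_sum_add) (auto simp: algebra_simps)

lemma diff_op_scalar: "diff_op (Poly_Mapping.single 0 c * a) P = (\<lambda>x. c * diff_op a P x)"
  by (induction a rule: poly_mapping_add_induct)
     (auto simp: diff_op_single diff_op_add mult_single algebra_simps)

lemma diff_op_one:
  fixes P :: "complex ^ 'n \<Rightarrow> complex"
  shows "diff_op 1 P = P"
proof -
  have "foldr (\<lambda>i F. (dir_deriv (axis i 1) ^^ Poly_Mapping.lookup (0 :: 'n \<Rightarrow>\<^sub>0 nat) i) \<circ> F) xs id P = P" for xs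
    by (induction xs) auto
  then show ?thesis
    by (simp add: diff_op_single diff_monom_def flip: single_one)
qed

lemma diff_op_sym_of:
  fixes P :: "complex ^ 'n \<Rightarrow> complex"
  assumes "P \<in> polyfuns"
  shows "diff_op (sym_of v) P = dir_deriv v P"
proof -
  obtain p where P: "P = peval p" using assms by (auto simp: polyfuns_def)
  have "foldr (\<lambda>i F. (dir_deriv (axis i 1) ^^ Poly_Mapping.lookup (Poly_Mapping.single j 1) i) \<circ> F) xs id P =
     (if j \<in> set xs then dir_deriv (axis j 1) P else P)" if "distinct xs" for xs and j :: 'n
    using that by (induction xs) (auto simp: lookup_single when_def)
  then have mon: "diff_monom (Poly_Mapping.single j 1) P = peval (pderiv_mpoly j p)" for j
    using index_list[where 'n = 'n] by (simp add: diff_monom_def P dir_deriv_axis_peval)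
  have "diff_op (\<Sum>i\<in>I. Poly_Mapping.single (Poly_Mapping.single i 1) (v $ i)) P =
     (\<lambda>x. \<Sum>i\<in>I. v $ i * peval (pderiv_mpoly i p) x)" if "finite I" for I
    using that
  proof induction
    case empty show ?case by (simp add: diff_op_def)
  qed (simp add: diff_op_add diff_op_single mon flip: One_nat_def)
  then show ?thesis by (simp add: sym_of_def dir_deriv_peval P)
qed

lemma diff_op_times:
  fixes P :: "complex ^ 'n \<Rightarrow> complex"
  assumes "P \<in> polyfuns"
  shows "diff_op (a * b) P = diff_op a (diff_op b P)"
proof -
  obtain p where P: "P = peval p" using assms by (auto simp: polyfuns_def)
  have lin: "diff_op a (\<lambda>x. peval q x + peval r x) = (\<lambda>x. diff_op a (peval q) x + diff_op a (peval r) x)"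
    for a and q r :: "'n mpoly"
  proof -
    have "diff_monom m (\<lambda>x. peval q x + peval r x) =
        (\<lambda>x. diff_monom m (peval q) x + diff_monom m (peval r) x)" for m
      unfolding peval_add[symmetric] diff_monom_peval pderiv_monom_add ..
    then show ?thesis by (simp add: diff_op_def algebra_simps sum.distrib)
  qed
  have ex: "\<exists>q. diff_op b (peval p) = peval q" for b
  proof (induction b rule: poly_mapping_add_induct)
    case (single m c)
    show ?case by (auto simp: diff_op_single diff_monom_peval simp flip: peval_scale)
  next
    case (add a b)
    then show ?case by (auto simp: diff_op_add simp flip: peval_add)
  qed
  show ?thesis unfolding P
  proof (induction b rule: poly_mapping_add_induct)
    case (add b b')
    obtain q q' where "diff_op b (peval p) = peval q" "diff_op b' (peval p) = peval q'"
      using ex by metis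
    with add show ?case by (simp add: distrib_left diff_op_add lin)
  next
    case (single n d)
    show ?case
    proof (induction a rule: poly_mapping_add_induct)
      case (single m c)
      have "diff_monom m (\<lambda>x. d * diff_monom n (peval p) x) = (\<lambda>x. d * diff_monom (m + n) (peval p) x)"
        by (simp add: diff_monom_peval pderiv_monom_scale pderiv_monom_plus flip: peval_scale)
      then show ?case by (simp add: mult_single diff_op_single mult.assoc)
    next
      case (add a a')
      then show ?case by (simp add: distrib_right diff_op_add)
    qed
  qed
qed

end

theory Submission
  imports Defs "HOL-Library.Function_Algebras" "HOL-Computational_Algebra.Polynomial"
begin

text \<open>Write \<open>R\<close> and \<open>R'\<close> for the invariants of \<open>G\<close> and \<open>G'\<close> in \<open>S\<close>, and \<open>I\<close> for the Hilbert ideal of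
  \<open>G\<close>, generated by the elements of \<open>R\<close> without constant term.
  The positive definite form \<open>\<langle>P, Q\<rangle> = [conj Q, P]\<close> turns \<open>H(G)\<close> into the orthogonal complement
  of \<open>I\<close>, because \<open>G\<close> is unitary; hence \<open>S = H(G) \<oplus> I\<close> degree by degree, and likewise for
  \<open>G'\<close>. The isomorphism sends \<open>P \<otimes> Q\<close> to the harmonic component of \<open>P Q\<close>. It commutes
  with the action because \<open>H(G)\<close> and \<open>I\<close> are both stable under the normalizer.

  It is onto because \<open>S = H(G') R'\<close> by induction on the degree and \<open>R' = H(G)\<^sup>G\<^sup>' + (R' \<inter> I)\<close>.
  It is injective because linearly independent elements of \<open>H(G')\<close> are independent over \<open>R'\<close>
  and \<open>I\<close> is contained in \<open>H(G') (R' \<inter> I)\<close>, so that a relation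
  \<open>\<Sum> P\<^sub>i Q\<^sub>i \<in> I\<close> forces \<open>Q\<^sub>i \<in> H(G) \<inter> I = 0\<close>. The freeness is the only place where
  reflections enter: a polynomial \<open>P\<close> such that \<open>(D P)(0) = 0\<close> for every \<open>R'\<close>-linear operator
  \<open>D\<close> on \<open>S\<close> lies in the Hilbert ideal of \<open>G'\<close>, by induction on the degree with the divided
  differences \<open>(s P - P) / L\<^sub>s\<close>.\<close>

section \<open>Polynomial functions\<close>

text \<open>The product of a \<open>G'\<close>-harmonic and a \<open>G\<close>-harmonic polynomial
  need not be harmonic; multiplication becomes an isomorphism only modulo the Hilbert ideal. Two
  structures compete here. Orthogonality belongs to the Hermitian form, which the unitary groups
  preserve but the normalizer need not; the bilinear pairing is invariant under all of GL(V) but has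
  no positivity. The form supplies the decomposition, the pairing its equivariance. Freeness cannot
  be had by dividing by a coefficient, since the invariants are not a field. Elimination looks
  instead for a pivot that is nonzero at the origin, and the operators linear over \<open>R'\<close>
  produce the pivots: each of them, evaluated at the origin, is a functional that kills the Hilbert
  ideal of \<open>G'\<close>, and Chevalley's argument gives the converse. A formal sum is
  recognised as a combination of bilinearity relations by contracting its first factor with
  arbitrary linear functionals, which turns injectivity into equations between polynomials.\<close>

definition fun_scale :: "complex \<Rightarrow> ('a \<Rightarrow> complex) \<Rightarrow> 'a \<Rightarrow> complex" where
  "fun_scale c P = (\<lambda>x. c * P x)"

lemma fun_scale_apply [simp]: "fun_scale c P x = c * P x"
  by (simp add: fun_scale_def)

interpretation fun_vs: vector_space "fun_scale :: complex \<Rightarrow> ('a \<Rightarrow> complex) \<Rightarrow> _"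
  by unfold_locales (auto simp: algebra_simps fun_scale_def)

interpretation rep_vs: vector_space "rep_scale :: complex \<Rightarrow> ('k \<Rightarrow>\<^sub>0 complex) \<Rightarrow> _"
  by (rule rep_scale_vs)

lemma sum_fun_apply: "(\<Sum>i\<in>A. f i) x = (\<Sum>i\<in>A. f i x)"
  for f :: "'i \<Rightarrow> 'a \<Rightarrow> 'b::comm_monoid_add"
  by (induction A rule: infinite_finite_induct) auto

lemma sum_closed:
  fixes f :: "'i \<Rightarrow> 'b::comm_monoid_add"
  assumes "Q 0" "\<And>a b. Q a \<Longrightarrow> Q b \<Longrightarrow> Q (a + b)" "\<And>i. i \<in> A \<Longrightarrow> Q (f i)"
  shows "Q (sum f A)"
  using assms(3) by (induction A rule: infinite_finite_induct) (auto intro: assms(1,2))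

lemma fun_scale_mult [simp]:
  "fun_scale c P * Q = fun_scale c (P * Q)" "P * fun_scale c Q = fun_scale c (P * Q)"
  by (auto simp: fun_eq_iff)

lemma peval_plus: "peval (p + q) = peval p + peval q"
  by (simp add: peval_add plus_fun_def)

lemma peval_fun_scale: "peval (rep_scale c p) = fun_scale c (peval p)"
  by (simp add: peval_scale fun_scale_def)

lemma peval_zero [simp]: "peval 0 = 0"
  by (simp add: peval_def fun_eq_iff)

lemma peval_sum: "peval (\<Sum>i\<in>A. f i) = (\<Sum>i\<in>A. peval (f i))"
  by (induction A rule: infinite_finite_induct) (auto simp: peval_plus)

lemma peval_mult: "peval (p * q) = peval p * peval q"
proof (induction p rule: poly_mapping_add_induct)
  case (single m c)
  show ?case
    by (induction q rule: poly_mapping_add_induct)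
       (auto simp: mult_single peval_single lookup_add power_add prod.distrib distrib_left
          peval_plus fun_eq_iff)
qed (auto simp: peval_plus distrib_right)

lemma peval_one [simp]: "peval 1 = 1"
  by (simp add: fun_eq_iff peval_single flip: single_one)

lemma peval_at_0: "peval p 0 = Poly_Mapping.lookup p 0"
proof (induction p rule: poly_mapping_add_induct)
  case (single m c)
  show ?case
  proof (cases "m = 0")
    case False
    then obtain i where "Poly_Mapping.lookup m i \<noteq> 0"
      by (metis poly_mapping_eqI lookup_zero)
    then show ?thesis using False
      by (auto simp: peval_single lookup_single intro!: prod_zero bexI[of _ i])
  qed (simp add: peval_single)
qed (auto simp: peval_plus lookup_add)

section \<open>Derivatives at the origin and injectivity of evaluation\<close>

definition mfact :: "('n::finite \<Rightarrow>\<^sub>0 nat) \<Rightarrow> complex" where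
  "mfact m = (\<Prod>i\<in>UNIV. fact (Poly_Mapping.lookup m i))"

lemma lookup_pderiv_mpoly:
  "Poly_Mapping.lookup (pderiv_mpoly i p) n =
     of_nat (Suc (Poly_Mapping.lookup n i)) * Poly_Mapping.lookup p (n + Poly_Mapping.single i 1)"
proof (induction p rule: poly_mapping_add_induct)
  case (single m c)
  show ?case
  proof (cases "Poly_Mapping.lookup m i = 0")
    case True
    then have "m \<noteq> n + Poly_Mapping.single i 1" by (auto simp: lookup_add)
    then show ?thesis using True by (auto simp: pderiv_mpoly_single lookup_single when_def)
  next
    case False
    have "m - Poly_Mapping.single i 1 = n \<longleftrightarrow> m = n + Poly_Mapping.single i 1"
    proof
      assume "m - Poly_Mapping.single i 1 = n"
      then show "m = n + Poly_Mapping.single i 1" using False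
        by (auto intro!: poly_mapping_eqI simp: lookup_add lookup_minus lookup_single when_def)
    qed simp
    then show ?thesis
      by (auto simp: pderiv_mpoly_single lookup_single when_def lookup_add)
  qed
qed (auto simp: pderiv_mpoly_add lookup_add algebra_simps)

text \<open>Each differentiation contributes one exponent as a factor; the product of
  \<open>k\<close> consecutive integers starting at the \<open>i\<close>-th exponent of
  \<open>n\<close> plus one is the Pochhammer symbol.\<close>

lemma lookup_pderiv_mpoly_pow:
  "Poly_Mapping.lookup ((pderiv_mpoly i ^^ k) p) n =
     pochhammer (of_nat (Poly_Mapping.lookup n i) + 1) k *
     Poly_Mapping.lookup p (n + Poly_Mapping.single i k)"
proof (induction k arbitrary: n)
  case (Suc k)
  have "n + Poly_Mapping.single i 1 + Poly_Mapping.single i k = n + Poly_Mapping.single i (Suc k)"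
    by (simp add: add.assoc flip: single_add)
  then show ?case
    by (simp add: lookup_pderiv_mpoly Suc pochhammer_rec lookup_add algebra_simps)
qed simp

text \<open>Only the monomial \<open>m\<close> survives both the derivative and the evaluation at
  the origin. Distinct monomials are thus orthogonal for the pairing, and \<open>mfact m\<close> is
  the value on equal ones.\<close>

lemma peval_pderiv_monom_0: "peval (pderiv_monom m p) 0 = mfact m * Poly_Mapping.lookup p m"
proof -
  let ?l = "Poly_Mapping.lookup"
  \<comment> \<open>The exponent \<open>n\<close> stays general: peeling off the derivatives along
    \<open>i\<close> moves the inspected exponent to \<open>n + single i (m i)\<close>, and
    distinctness leaves the factors of the other coordinates unchanged.\<close>
  have *: "?l (foldr (\<lambda>i F. (pderiv_mpoly i ^^ ?l m i) \<circ> F) xs id p) n =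
     (\<Prod>i\<in>set xs. pochhammer (of_nat (?l n i) + 1) (?l m i)) *
     ?l p (n + (\<Sum>i\<in>set xs. Poly_Mapping.single i (?l m i)))" if "distinct xs" for xs n
    using that
  proof (induction xs arbitrary: n)
    case (Cons i xs)
    have "(\<Prod>j\<in>set xs. pochhammer (complex_of_nat (?l (n + Poly_Mapping.single i (?l m i)) j) + 1) (?l m j)) =
       (\<Prod>j\<in>set xs. pochhammer (of_nat (?l n j) + 1) (?l m j))"
      using Cons.prems by (intro prod.cong) (auto simp: lookup_add lookup_single when_def)
    then show ?case using Cons
      by (simp add: lookup_pderiv_mpoly_pow add_ac)
  qed simp
  have "(\<Sum>i\<in>UNIV. Poly_Mapping.single i (?l m i)) = m"
    by (intro poly_mapping_eqI) (auto simp: lookup_sum lookup_single when_def)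
  then show ?thesis
    using *[OF index_list(1), of 0] index_list(2)[where 'n = 'a]
    by (simp add: peval_at_0 pderiv_monom_def mfact_def pochhammer_fact)
qed

lemma pairing_peval:
  "pairing a (peval p) = (\<Sum>m\<in>Poly_Mapping.keys a. Poly_Mapping.lookup a m * (mfact m * Poly_Mapping.lookup p m))"
  by (simp add: pairing_def diff_op_def diff_monom_peval peval_pderiv_monom_0)

text \<open>Pairing with the monomial \<open>m\<close> recovers the coefficient at \<open>m\<close>
  times the nonzero number \<open>mfact m\<close>, so a polynomial function determines its
  coefficients.\<close>

lemma inj_peval: "inj peval"
proof (rule injI)
  fix p q :: "'a mpoly" assume eq: "peval p = peval q"
  show "p = q"
  proof (rule poly_mapping_eqI)
    fix m
    have "pairing (Poly_Mapping.single m 1) (peval p) = pairing (Poly_Mapping.single m 1) (peval q)"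
      using eq by simp
    then show "Poly_Mapping.lookup p m = Poly_Mapping.lookup q m"
      by (simp add: pairing_peval mfact_def)
  qed
qed

lemmas peval_eq_iff = inj_eq[OF inj_peval]

definition mpoly_of :: "(complex ^ 'n \<Rightarrow> complex) \<Rightarrow> ('n::finite) mpoly" where
  "mpoly_of = inv_into UNIV peval"

lemma mpoly_of_peval [simp]: "mpoly_of (peval p) = p"
  by (simp add: mpoly_of_def inj_peval)

lemma peval_mpoly_of [simp]: "P \<in> polyfuns \<Longrightarrow> peval (mpoly_of P) = P"
  by (auto simp: polyfuns_def)

lemma peval_in_polyfuns [simp]: "peval p \<in> polyfuns"
  by (simp add: polyfuns_def)

lemma subspace_polyfuns: "fun_vs.subspace polyfuns"
  unfolding fun_vs.subspace_def polyfuns_def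
  by (auto simp flip: peval_plus peval_fun_scale peval_zero)

lemmas polyfuns_zero [simp] = fun_vs.subspace_0[OF subspace_polyfuns]
lemmas polyfuns_add = fun_vs.subspace_add[OF subspace_polyfuns]
lemmas polyfuns_diff = fun_vs.subspace_diff[OF subspace_polyfuns]
lemmas polyfuns_scale = fun_vs.subspace_scale[OF subspace_polyfuns]
lemmas polyfuns_sum = fun_vs.subspace_sum[OF subspace_polyfuns]

lemma polyfuns_mult: "P \<in> polyfuns \<Longrightarrow> Q \<in> polyfuns \<Longrightarrow> P * Q \<in> polyfuns"
  by (auto simp: polyfuns_def simp flip: peval_mult)

lemma keys_rep_scale: "Poly_Mapping.keys (rep_scale c p) \<subseteq> Poly_Mapping.keys p"
  by (auto simp: in_keys_iff)

lemma subspace_polyfun_deg: "fun_vs.subspace (polyfun_deg d)"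
  unfolding fun_vs.subspace_def
proof (intro conjI ballI allI)
  show "0 \<in> polyfun_deg d" by (auto simp: polyfun_deg_def intro!: image_eqI[of _ _ 0])
next
  fix P Q :: "complex ^ 'a \<Rightarrow> complex" assume "P \<in> polyfun_deg d" "Q \<in> polyfun_deg d"
  then obtain p q where *: "P = peval p" "Q = peval q"
    "\<forall>m\<in>Poly_Mapping.keys p. mdeg m = d" "\<forall>m\<in>Poly_Mapping.keys q. mdeg m = d"
    by (auto simp: polyfun_deg_def)
  have "P + Q = peval (p + q)" "\<forall>m\<in>Poly_Mapping.keys (p + q). mdeg m = d"
    using * Poly_Mapping.keys_add[of p q] by (auto simp: peval_plus)
  then show "P + Q \<in> polyfun_deg d" by (auto simp: polyfun_deg_def)
next
  fix c and P :: "complex ^ 'a \<Rightarrow> complex" assume "P \<in> polyfun_deg d"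
  then obtain p where *: "P = peval p" "\<forall>m\<in>Poly_Mapping.keys p. mdeg m = d"
    by (auto simp: polyfun_deg_def)
  have "fun_scale c P = peval (rep_scale c p)" "\<forall>m\<in>Poly_Mapping.keys (rep_scale c p). mdeg m = d"
    using * keys_rep_scale[of c p] by (auto simp: peval_fun_scale)
  then show "fun_scale c P \<in> polyfun_deg d" by (auto simp: polyfun_deg_def)
qed

lemmas polyfun_deg_zero [simp] = fun_vs.subspace_0[OF subspace_polyfun_deg]
lemmas polyfun_deg_add = fun_vs.subspace_add[OF subspace_polyfun_deg]
lemmas polyfun_deg_diff = fun_vs.subspace_diff[OF subspace_polyfun_deg]
lemmas polyfun_deg_scale = fun_vs.subspace_scale[OF subspace_polyfun_deg]
lemmas polyfun_deg_sum = fun_vs.subspace_sum[OF subspace_polyfun_deg]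

lemma polyfun_deg_polyfuns: "P \<in> polyfun_deg d \<Longrightarrow> P \<in> polyfuns"
  by (auto simp: polyfun_deg_def)

lemma mdeg_add: "mdeg (m + n) = mdeg m + mdeg n"
  by (simp add: mdeg_def lookup_add sum.distrib)

lemma polyfun_deg_mult:
  assumes "P \<in> polyfun_deg d" "Q \<in> polyfun_deg e"
  shows "P * Q \<in> polyfun_deg (d + e)"
proof -
  from assms obtain p q where *: "P = peval p" "Q = peval q"
    "\<forall>m\<in>Poly_Mapping.keys p. mdeg m = d" "\<forall>m\<in>Poly_Mapping.keys q. mdeg m = e"
    by (auto simp: polyfun_deg_def)
  have "P * Q = peval (p * q)" "\<forall>m\<in>Poly_Mapping.keys (p * q). mdeg m = d + e"
    using * Poly_Mapping.keys_mult[of p q] by (auto simp: peval_mult mdeg_add)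
  then show ?thesis by (auto simp: polyfun_deg_def)
qed

lemma one_polyfun_deg [simp]: "1 \<in> polyfun_deg 0"
  by (auto simp: polyfun_deg_def mdeg_def intro!: image_eqI[of _ _ 1])

lemma polyfun_deg_0: "polyfun_deg 0 = range (\<lambda>c (x::complex^'n). c)"
proof -
  have "m = 0" if "mdeg m = 0" for m :: "'n \<Rightarrow>\<^sub>0 nat"
    using that by (intro poly_mapping_eqI) (simp add: mdeg_def)
  then have *: "m = 0" if "p \<in> {p. \<forall>m\<in>Poly_Mapping.keys p. mdeg m = 0}" "m \<in> Poly_Mapping.keys p"
    for p :: "'n mpoly" and m using that by blast
  have "\<exists>c. peval p = (\<lambda>x. c)" if "\<forall>m\<in>Poly_Mapping.keys p. mdeg m = 0" for p :: "'n mpoly"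
  proof -
    have "p = Poly_Mapping.single 0 (Poly_Mapping.lookup p 0)"
      using *[of p] that
      by (intro poly_mapping_eqI) (auto simp: lookup_single when_def in_keys_iff)
    then have "peval p = peval (Poly_Mapping.single 0 (Poly_Mapping.lookup p 0))" by simp
    then show ?thesis by (auto simp: peval_single)
  qed
  moreover have "(\<lambda>x::complex^'n. c) \<in> polyfun_deg 0" for c
    using polyfun_deg_scale[OF one_polyfun_deg, of c]
    by (simp add: fun_scale_def)
  ultimately show ?thesis unfolding polyfun_deg_def by blast
qed

lemma coord_polyfun_deg: "(\<lambda>x::complex^'n. x $ i) \<in> polyfun_deg 1"
proof -
  have "(\<lambda>x::complex^'n. x $ i) = peval (Poly_Mapping.single (Poly_Mapping.single i 1) 1)"
    by (auto simp: peval_single fun_eq_iff lookup_single when_def if_distrib cong: if_cong)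
  moreover have "mdeg (Poly_Mapping.single i 1) = 1"
    by (simp add: mdeg_def lookup_single when_def)
  ultimately show ?thesis by (auto simp: polyfun_deg_def)
qed

lemma linear_polyfun_deg: "(\<lambda>x::complex^'n. \<Sum>i\<in>UNIV. c i * x $ i) \<in> polyfun_deg 1"
proof -
  have "(\<lambda>x::complex^'n. \<Sum>i\<in>UNIV. c i * x $ i) = (\<Sum>i\<in>UNIV. fun_scale (c i) (\<lambda>x. x $ i))"
    by (auto simp: fun_eq_iff sum_fun_apply)
  also have "\<dots> \<in> polyfun_deg 1"
    by (intro polyfun_deg_sum polyfun_deg_scale coord_polyfun_deg)
  finally show ?thesis .
qed

text \<open>Coordinate functions generate everything by products and by linear combinations inside
  one degree. The predicate carries the degree because divided differences are controlled degree by
  degree.\<close>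

lemma polyfun_deg_induct [consumes 1, case_names one coord mult zero add scale]:
  fixes P :: "complex ^ 'n \<Rightarrow> complex"
  assumes "P \<in> polyfun_deg d"
    and one: "Pr 0 1" and coord: "\<And>i. Pr 1 (\<lambda>x. x $ i)"
    and mult: "\<And>d e P Q. P \<in> polyfun_deg d \<Longrightarrow> Q \<in> polyfun_deg e \<Longrightarrow> Pr d P \<Longrightarrow> Pr e Q \<Longrightarrow> Pr (d + e) (P * Q)"
    and zero: "\<And>d. Pr d 0"
    and add: "\<And>d P Q. P \<in> polyfun_deg d \<Longrightarrow> Q \<in> polyfun_deg d \<Longrightarrow> Pr d P \<Longrightarrow> Pr d Q \<Longrightarrow> Pr d (P + Q)"
    and scale: "\<And>d c P. P \<in> polyfun_deg d \<Longrightarrow> Pr d P \<Longrightarrow> Pr d (fun_scale c P)"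
  shows "Pr d P"
proof -
  have pow: "(\<lambda>x. (x $ i) ^ k) \<in> polyfun_deg k \<and> Pr k (\<lambda>x. (x $ i) ^ k)" for i :: 'n and k
  proof (induction k)
    case 0
    then show ?case using one one_polyfun_deg by (simp add: one_fun_def)
  next
    case (Suc k)
    have "(\<lambda>x::complex^'n. (x $ i) ^ Suc k) = (\<lambda>x. x $ i) * (\<lambda>x. (x $ i) ^ k)" by (simp add: fun_eq_iff)
    then show ?case
      using mult[OF coord_polyfun_deg _ coord, of "\<lambda>x. (x $ i) ^ k" k i] Suc
        polyfun_deg_mult[OF coord_polyfun_deg, of "\<lambda>x. (x $ i) ^ k" k i] by simp
  qed
  have prod: "(\<lambda>x. \<Prod>i\<in>I. (x $ i) ^ k i) \<in> polyfun_deg (\<Sum>i\<in>I. k i) \<and> Pr (\<Sum>i\<in>I. k i) (\<lambda>x. \<Prod>i\<in>I. (x $ i) ^ k i)"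
    if "finite I" for I :: "'n set" and k
    using that
  proof induction
    case empty
    then show ?case using one one_polyfun_deg by (simp add: one_fun_def)
  next
    case (insert i I)
    have "(\<lambda>x::complex^'n. \<Prod>i\<in>insert i I. (x $ i) ^ k i) = (\<lambda>x. (x $ i) ^ k i) * (\<lambda>x. \<Prod>i\<in>I. (x $ i) ^ k i)"
      using insert by (simp add: fun_eq_iff)
    then show ?case using insert
        mult[of "\<lambda>x. (x $ i) ^ k i" "k i" "\<lambda>x. \<Prod>i\<in>I. (x $ i) ^ k i" "\<Sum>i\<in>I. k i"]
        polyfun_deg_mult[of "\<lambda>x. (x $ i) ^ k i" "k i" "\<lambda>x. \<Prod>i\<in>I. (x $ i) ^ k i" "\<Sum>i\<in>I. k i"]
        pow[where i=i] by auto
  qed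
  obtain p where p: "P = peval p" "\<forall>m\<in>Poly_Mapping.keys p. mdeg m = d"
    using assms(1) by (auto simp: polyfun_deg_def)
  define T where "T m = fun_scale (Poly_Mapping.lookup p m) (\<lambda>x::complex^'n. \<Prod>i\<in>UNIV. (x $ i) ^ Poly_Mapping.lookup m i)" for m
  have T: "T m \<in> polyfun_deg d \<and> Pr d (T m)" if "m \<in> Poly_Mapping.keys p" for m
  proof -
    have "mdeg m = d" using that p by auto
    then show ?thesis
      using prod[of UNIV "Poly_Mapping.lookup m"] unfolding T_def mdeg_def
      by (intro conjI polyfun_deg_scale scale) auto
  qed
  have "sum T (Poly_Mapping.keys p) \<in> polyfun_deg d \<and> Pr d (sum T (Poly_Mapping.keys p))"
    by (rule sum_closed[where Q = "\<lambda>P. P \<in> polyfun_deg d \<and> Pr d P"])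
       (use T zero add in \<open>auto intro: polyfun_deg_add\<close>)
  moreover have "P = sum T (Poly_Mapping.keys p)"
    by (simp add: p(1) fun_eq_iff T_def peval_def sum_fun_apply)
  ultimately show ?thesis by auto
qed

section \<open>Homogeneous components\<close>

definition mpoly_part :: "nat \<Rightarrow> ('n::finite) mpoly \<Rightarrow> 'n mpoly" where
  "mpoly_part d p = Poly_Mapping.mapp (\<lambda>m c. if mdeg m = d then c else 0) p"

lemma lookup_mpoly_part:
  "Poly_Mapping.lookup (mpoly_part d p) m = (if mdeg m = d then Poly_Mapping.lookup p m else 0)"
  by (auto simp: mpoly_part_def lookup_mapp when_def in_keys_iff)

definition hom_part :: "nat \<Rightarrow> (complex ^ 'n \<Rightarrow> complex) \<Rightarrow> complex ^ 'n \<Rightarrow> complex" where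
  "hom_part d P = peval (mpoly_part d (mpoly_of P))"

lemma hom_part_polyfun_deg: "hom_part d P \<in> polyfun_deg d"
proof -
  have "mdeg m = d" if "m \<in> Poly_Mapping.keys (mpoly_part d (mpoly_of P))" for m
    using that by (simp add: in_keys_iff lookup_mpoly_part split: if_splits)
  then show ?thesis by (auto simp: hom_part_def polyfun_deg_def)
qed

lemma hom_part_polyfuns: "hom_part d P \<in> polyfuns"
  by (simp add: hom_part_def)

lemma hom_part_add:
  assumes "P \<in> polyfuns" "Q \<in> polyfuns"
  shows "hom_part d (P + Q) = hom_part d P + hom_part d Q"
proof -
  obtain p q where [simp]: "P = peval p" "Q = peval q" using assms by (auto simp: polyfuns_def)
  have "mpoly_part d (p + q) = mpoly_part d p + mpoly_part d q"
    by (intro poly_mapping_eqI) (simp add: lookup_mpoly_part lookup_add)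
  then show ?thesis by (simp add: hom_part_def flip: peval_plus)
qed

lemma hom_part_of_polyfun_deg:
  assumes "P \<in> polyfun_deg e"
  shows "hom_part d P = (if d = e then P else 0)"
proof -
  obtain p where p: "P = peval p" "\<forall>m\<in>Poly_Mapping.keys p. mdeg m = e"
    using assms by (auto simp: polyfun_deg_def)
  have "mpoly_part d p = (if d = e then p else 0)"
    using p(2) by (intro poly_mapping_eqI) (auto simp: lookup_mpoly_part in_keys_iff)
  then show ?thesis by (simp add: hom_part_def p(1))
qed

lemma hom_part_sum:
  assumes "\<And>i. i \<in> A \<Longrightarrow> F i \<in> polyfuns"
  shows "hom_part d (\<Sum>i\<in>A. F i) = (\<Sum>i\<in>A. hom_part d (F i))"
proof -
  have [simp]: "hom_part d (0 :: complex ^ 'n \<Rightarrow> complex) = 0"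
    using hom_part_of_polyfun_deg[of 0 0 d] by simp
  have "(\<Sum>i\<in>A. F i) \<in> polyfuns \<and> hom_part d (\<Sum>i\<in>A. F i) = (\<Sum>i\<in>A. hom_part d (F i))"
    using assms
  proof (induction A rule: infinite_finite_induct)
    case (insert i A)
    then have "sum F A \<in> polyfuns" "hom_part d (sum F A) = (\<Sum>i\<in>A. hom_part d (F i))" "F i \<in> polyfuns" by auto
    then show ?case using insert.hyps hom_part_add[of "F i" "sum F A" d] polyfuns_add[of "F i" "sum F A"]
      by (simp only: sum.insert simp_thms)
  qed auto
  then show ?thesis by blast
qed

lemma sum_parts:
  assumes "P \<in> polyfuns"
  obtains N where "P = (\<Sum>d\<le>N. hom_part d P)"
proof -
  obtain p where [simp]: "P = peval p" using assms by (auto simp: polyfuns_def)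
  \<comment> \<open>The sum of the degrees of all occurring monomials is a crude bound for each of
    them.\<close>
  define N where "N = (\<Sum>m\<in>Poly_Mapping.keys p. mdeg m)"
  have "mdeg m \<le> N" if "m \<in> Poly_Mapping.keys p" for m
    unfolding N_def using that by (intro member_le_sum) auto
  then have "p = (\<Sum>d\<le>N. mpoly_part d p)"
    by (intro poly_mapping_eqI) (auto simp: lookup_sum lookup_mpoly_part in_keys_iff)
  then have "P = (\<Sum>d\<le>N. hom_part d P)"
    by (simp add: hom_part_def flip: peval_sum)
  then show ?thesis by (rule that)
qed

lemma hom_part_0_eq: 
  assumes "P \<in> polyfuns"
  shows "hom_part 0 P = (\<lambda>x. P 0)"
proof -
  obtain p where [simp]: "P = peval p" using assms by (auto simp: polyfuns_def)
  obtain c where c: "hom_part 0 P = (\<lambda>x. c)" 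
    using hom_part_polyfun_deg[of 0 P] by (auto simp: polyfun_deg_0)
  have "c = hom_part 0 P 0" using c by simp
  also have "\<dots> = P 0" by (simp add: hom_part_def peval_at_0 lookup_mpoly_part mdeg_def)
  finally show ?thesis using c by simp
qed

lemma polyfuns_induct [consumes 1, case_names deg zero add]:
  assumes "P \<in> polyfuns" "\<And>d P. P \<in> polyfun_deg d \<Longrightarrow> Pr P"
    "Pr 0" "\<And>P Q. P \<in> polyfuns \<Longrightarrow> Q \<in> polyfuns \<Longrightarrow> Pr P \<Longrightarrow> Pr Q \<Longrightarrow> Pr (P + Q)"
  shows "Pr P"
proof -
  obtain N where N: "P = (\<Sum>d\<le>N. hom_part d P)" using sum_parts[OF assms(1)] .
  have "(\<Sum>d\<le>N. hom_part d P) \<in> polyfuns \<and> Pr (\<Sum>d\<le>N. hom_part d P)"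
    by (rule sum_closed[where Q = "\<lambda>P. P \<in> polyfuns \<and> Pr P"])
       (use assms in \<open>auto intro: polyfuns_add hom_part_polyfuns hom_part_polyfun_deg\<close>)
  then show ?thesis using N by simp
qed

section \<open>Restriction to lines and absence of zero divisors\<close>

lemma polyfuns_restrict_line:
  assumes "P \<in> polyfuns"
  shows "\<exists>q. \<forall>t. P (x + t *s v) = poly q t"
  using assms
proof (induction P rule: polyfuns_induct)
  case (deg d P)
  then show ?case
  proof (induction rule: polyfun_deg_induct)
    case one show ?case by (intro exI[of _ 1]) simp
  next
    case (coord i) show ?case by (intro exI[of _ "[:x $ i, v $ i:]"]) simp
  next
    case (mult d e P Q)
    then obtain p q where "\<forall>t. P (x + t *s v) = poly p t" "\<forall>t. Q (x + t *s v) = poly q t" by auto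
    then show ?case by (intro exI[of _ "p * q"]) simp
  next
    case (scale d c P)
    then obtain p where "\<forall>t. P (x + t *s v) = poly p t" by auto
    then show ?case by (intro exI[of _ "smult c p"]) simp
  next
    case (add d P Q)
    then obtain p q where "\<forall>t. P (x + t *s v) = poly p t" "\<forall>t. Q (x + t *s v) = poly q t" by auto
    then show ?case by (intro exI[of _ "p + q"]) simp
  next
    case (zero d) show ?case by (intro exI[of _ 0]) simp
  qed
next
  case zero show ?case by (intro exI[of _ 0]) simp
next
  case (add P Q)
  then obtain p q where "\<forall>t. P (x + t *s v) = poly p t" "\<forall>t. Q (x + t *s v) = poly q t" by auto
  then show ?case by (intro exI[of _ "p + q"]) simp
qed

text \<open>Restriction to the line joining a point where \<open>P\<close> is nonzero to a point
  where \<open>Q\<close> is nonzero reduces the claim to polynomials in one variable.\<close>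

lemma polyfuns_no_zero_divisors:
  assumes "P \<in> polyfuns" "Q \<in> polyfuns" "P * Q = 0"
  shows "P = 0 \<or> Q = 0"
proof (rule ccontr)
  assume "\<not> ?thesis"
  then obtain x y where xy: "P x \<noteq> 0" "Q y \<noteq> 0" by (auto simp: fun_eq_iff)
  obtain p where p: "\<And>t. P (x + t *s (y - x)) = poly p t" using polyfuns_restrict_line[OF assms(1)] by metis
  obtain q where q: "\<And>t. Q (x + t *s (y - x)) = poly q t" using polyfuns_restrict_line[OF assms(2)] by metis
  \<comment> \<open>The parameters 0 and 1 correspond to \<open>x\<close> and
    \<open>y\<close>.\<close>
  have "poly p 0 \<noteq> 0" "poly q 1 \<noteq> 0" using xy by (auto simp flip: p q)
  then have "p * q \<noteq> 0" by auto
  moreover have "poly (p * q) t = 0" for t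
    using assms(3) by (simp flip: p q times_fun_apply)
  ultimately show False using poly_all_0_iff_0 by blast
qed

lemma polyfuns_mult_left_cancel:
  assumes "L \<in> polyfuns" "L \<noteq> 0" "P \<in> polyfuns" "Q \<in> polyfuns" "L * P = L * Q"
  shows "P = Q"
  using polyfuns_no_zero_divisors[of L "P - Q"] assms
  by (auto simp: algebra_simps polyfuns_diff)

section \<open>The action on polynomial functions\<close>

lemma polyfun_deg_compose_linear:
  assumes "P \<in> polyfun_deg d"
  shows "(\<lambda>x. P (A *v x)) \<in> polyfun_deg d"
  using assms
proof (induction rule: polyfun_deg_induct)
  case one
  then show ?case using one_polyfun_deg by (simp add: one_fun_def)
next
  case (coord i)
  then show ?case using linear_polyfun_deg[of "\<lambda>j. A $ i $ j"] by (simp add: matrix_vector_mult_def)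
next
  case (mult d e P Q)
  then show ?case using polyfun_deg_mult[of _ d _ e] by (simp add: times_fun_def)
next
  case (zero d)
  then show ?case using polyfun_deg_zero by (simp add: zero_fun_def)
next
  case (add d P Q)
  then show ?case using polyfun_deg_add[of _ d] by (simp add: plus_fun_def)
next
  case (scale d c P)
  then show ?case using polyfun_deg_scale[of "\<lambda>x. P (A *v x)" d c] by (simp add: fun_scale_def)
qed

lemma fun_act_polyfun_deg: "P \<in> polyfun_deg d \<Longrightarrow> fun_act g P \<in> polyfun_deg d"
  unfolding fun_act_def by (rule polyfun_deg_compose_linear)

lemma fun_act_simps [simp]:
  "fun_act g 0 = 0" "fun_act g 1 = 1" "fun_act g (P + Q) = fun_act g P + fun_act g Q"
  "fun_act g (P - Q) = fun_act g P - fun_act g Q"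
  "fun_act g (P * Q) = fun_act g P * fun_act g Q"
  "fun_act g (fun_scale c P) = fun_scale c (fun_act g P)" "fun_act g P 0 = P 0"
  by (auto simp: fun_act_def fun_eq_iff)

lemma fun_act_sum: "fun_act g (\<Sum>i\<in>A. F i) = (\<Sum>i\<in>A. fun_act g (F i))"
  by (auto simp: fun_act_def fun_eq_iff sum_fun_apply)

lemma fun_act_polyfuns: "P \<in> polyfuns \<Longrightarrow> fun_act g P \<in> polyfuns"
  by (rule polyfuns_induct[where Pr = "\<lambda>P. fun_act g P \<in> polyfuns"])
     (auto intro: polyfuns_add fun_act_polyfun_deg polyfun_deg_polyfuns)

text \<open>The action preserves every degree, so it maps the decomposition of \<open>P\<close> to
  that of its image.\<close>

lemma hom_part_fun_act:
  assumes "P \<in> polyfuns"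
  shows "hom_part d (fun_act g P) = fun_act g (hom_part d P)"
proof -
  obtain N where N: "P = (\<Sum>d\<le>N. hom_part d P)" using sum_parts[OF assms] .
  have *: "hom_part d (\<Sum>e\<le>N. fun_act g (hom_part e P)) = fun_act g (hom_part d (\<Sum>e\<le>N. hom_part e P))"
    by (simp add: hom_part_sum hom_part_polyfuns fun_act_polyfuns fun_act_sum
        hom_part_of_polyfun_deg[OF fun_act_polyfun_deg[OF hom_part_polyfun_deg]]
        hom_part_of_polyfun_deg[OF hom_part_polyfun_deg])
  then show ?thesis unfolding fun_act_sum[symmetric] N[symmetric] .
qed

section \<open>Inverse matrices and the action of products\<close>

lemma matrix_inv_unique:
  fixes A B :: "complex ^ 'n ^ 'n"
  assumes "A ** B = mat 1" "B ** A = mat 1"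
  shows "matrix_inv A = B"
proof -
  have "A ** matrix_inv A = mat 1 \<and> matrix_inv A ** A = mat 1"
    unfolding matrix_inv_def by (rule someI[of _ B]) (use assms in auto)
  then show ?thesis
    by (metis assms(2) matrix_mul_assoc matrix_mul_lid matrix_mul_rid)
qed

lemma matrix_inv_simps:
  fixes A :: "complex ^ 'n ^ 'n"
  assumes "invertible A"
  shows "A ** matrix_inv A = mat 1" "matrix_inv A ** A = mat 1"
  using assms matrix_inv_unique unfolding invertible_def by metis+

lemma invertible_matrix_inv: "invertible A \<Longrightarrow> invertible (matrix_inv A)"
  for A :: "complex ^ 'n ^ 'n"
  using matrix_inv_simps unfolding invertible_def by metis

lemma matrix_inv_mult:
  fixes A B :: "complex ^ 'n ^ 'n"
  assumes "invertible A" "invertible B"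
  shows "matrix_inv (A ** B) = matrix_inv B ** matrix_inv A"
  by (rule matrix_inv_unique)
     (metis assms matrix_inv_simps matrix_mul_assoc matrix_mul_rid)+

lemma matrix_inv_matrix_inv: "invertible A \<Longrightarrow> matrix_inv (matrix_inv A) = A"
  for A :: "complex ^ 'n ^ 'n"
  by (rule matrix_inv_unique) (auto simp: matrix_inv_simps)

lemma fun_act_mult:
  "invertible g \<Longrightarrow> invertible h \<Longrightarrow> fun_act (g ** h) P = fun_act g (fun_act h P)"
  by (simp add: fun_act_def matrix_inv_mult matrix_vector_mul_assoc)

lemma fun_act_id [simp]: "fun_act (mat 1) P = P"
  for P :: "complex ^ 'n \<Rightarrow> complex"
proof -
  have "matrix_inv (mat 1 :: complex ^ 'n ^ 'n) = mat 1" by (rule matrix_inv_unique) auto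
  then show ?thesis unfolding fun_act_def by simp
qed

lemma fun_act_inv:
  assumes "invertible g"
  shows "fun_act g (fun_act (matrix_inv g) P) = P" "fun_act (matrix_inv g) (fun_act g P) = P"
  by (simp_all add: assms invertible_matrix_inv matrix_inv_simps flip: fun_act_mult)

section \<open>Invariants and the Hilbert ideal\<close>

definition poly_invariants :: "(complex ^ 'n ^ 'n) set \<Rightarrow> (complex ^ 'n \<Rightarrow> complex) set" where
  "poly_invariants G = {P \<in> polyfuns. \<forall>g\<in>G. fun_act g P = P}"

text \<open>The coefficients \<open>Q\<close> must be polynomial, while a span over the type of all
  functions would admit arbitrary ones. The inductive form lists the finite sums of products
  \<open>f * Q\<close>, with \<open>f 0 = 0\<close> standing for a missing constant term.\<close>

inductive_set hilbert_ideal :: "(complex ^ 'n ^ 'n) set \<Rightarrow> (complex ^ 'n \<Rightarrow> complex) set"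
  for G where
  zero: "0 \<in> hilbert_ideal G"
| step: "P \<in> hilbert_ideal G \<Longrightarrow> f \<in> poly_invariants G \<Longrightarrow> f 0 = 0 \<Longrightarrow> Q \<in> polyfuns \<Longrightarrow>
    P + f * Q \<in> hilbert_ideal G"

lemma invariants_polyfuns: "P \<in> poly_invariants G \<Longrightarrow> P \<in> polyfuns"
  by (simp add: poly_invariants_def)

lemma subspace_invariants: "fun_vs.subspace (poly_invariants G)"
  by (auto simp: fun_vs.subspace_def poly_invariants_def polyfuns_add polyfuns_scale)

lemma invariants_mult: "P \<in> poly_invariants G \<Longrightarrow> Q \<in> poly_invariants G \<Longrightarrow> P * Q \<in> poly_invariants G"
  by (auto simp: poly_invariants_def polyfuns_mult)

lemma const_polyfuns: "(\<lambda>x. c) \<in> polyfuns"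
  by (rule polyfun_deg_polyfuns[of _ 0]) (auto simp: polyfun_deg_0)

lemma const_invariants: "(\<lambda>x. c) \<in> poly_invariants G"
  by (simp add: poly_invariants_def const_polyfuns fun_act_def)

lemma hilbert_ideal_polyfuns: "P \<in> hilbert_ideal G \<Longrightarrow> P \<in> polyfuns"
  by (rule hilbert_ideal.induct[where P = "\<lambda>P. P \<in> polyfuns"])
     (auto intro: polyfuns_add polyfuns_mult invariants_polyfuns)

lemma hilbert_ideal_mult:
  fixes G :: "(complex ^ 'n ^ 'n) set"
  assumes "P \<in> hilbert_ideal G" "A \<in> polyfuns"
  shows "A * P \<in> hilbert_ideal G"
  using assms(1)
proof (rule hilbert_ideal.induct[where P = "\<lambda>P. A * P \<in> hilbert_ideal G"])
  fix P f Q :: "complex ^ 'n \<Rightarrow> complex" assume *: "A * P \<in> hilbert_ideal G" "f \<in> poly_invariants G" "f 0 = 0" "Q \<in> polyfuns"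
  have "A * (P + f * Q) = A * P + f * (A * Q)" by (simp add: algebra_simps)
  then show "A * (P + f * Q) \<in> hilbert_ideal G"
    using hilbert_ideal.step[OF *(1-3), of "A * Q"] * assms(2) by (simp add: polyfuns_mult)
qed (simp add: hilbert_ideal.zero)

lemma hilbert_ideal_add:
  fixes G :: "(complex ^ 'n ^ 'n) set"
  assumes "P \<in> hilbert_ideal G" "A \<in> hilbert_ideal G"
  shows "A + P \<in> hilbert_ideal G"
  using assms(1)
proof (rule hilbert_ideal.induct[where P = "\<lambda>P. A + P \<in> hilbert_ideal G"])
  fix P f Q :: "complex ^ 'n \<Rightarrow> complex" assume "A + P \<in> hilbert_ideal G" "f \<in> poly_invariants G" "f 0 = 0" "Q \<in> polyfuns"
  then show "A + (P + f * Q) \<in> hilbert_ideal G"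
    using hilbert_ideal.step[of "A + P"] by (simp add: add.assoc)
qed (simp add: assms)

lemma hilbert_ideal_scale:
  assumes "P \<in> hilbert_ideal G"
  shows "fun_scale c P \<in> hilbert_ideal G"
proof -
  have "fun_scale c P = (\<lambda>x. c) * P" by (simp add: fun_eq_iff)
  then show ?thesis using hilbert_ideal_mult[OF assms const_polyfuns] by simp
qed

lemma subspace_hilbert_ideal: "fun_vs.subspace (hilbert_ideal G)"
  by (auto simp: fun_vs.subspace_def hilbert_ideal.zero hilbert_ideal_scale hilbert_ideal_add)

lemmas hilbert_ideal_diff = fun_vs.subspace_diff[OF subspace_hilbert_ideal]
lemmas hilbert_ideal_sum = fun_vs.subspace_sum[OF subspace_hilbert_ideal]

lemma hilbert_ideal_gen:
  "f \<in> poly_invariants G \<Longrightarrow> f 0 = 0 \<Longrightarrow> Q \<in> polyfuns \<Longrightarrow> f * Q \<in> hilbert_ideal G"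
  using hilbert_ideal.step[OF hilbert_ideal.zero, of f G Q] by simp

lemma hilbert_ideal_invariant: "f \<in> poly_invariants G \<Longrightarrow> f 0 = 0 \<Longrightarrow> f \<in> hilbert_ideal G"
  using hilbert_ideal_gen[of f G 1] polyfun_deg_polyfuns[OF one_polyfun_deg] by simp

text \<open>Stability of the invariants is left as a hypothesis on \<open>n\<close>, so that the
  lemma serves elements of the group and elements of its normalizer alike.\<close>

lemma hilbert_ideal_fun_act:
  fixes G :: "(complex ^ 'n ^ 'n) set"
  assumes "P \<in> hilbert_ideal G" and inv: "\<And>f. f \<in> poly_invariants G \<Longrightarrow> fun_act n f \<in> poly_invariants G"
  shows "fun_act n P \<in> hilbert_ideal G"
  using assms(1)
proof (rule hilbert_ideal.induct[where P = "\<lambda>P. fun_act n P \<in> hilbert_ideal G"])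
  fix P f Q :: "complex ^ 'n \<Rightarrow> complex" assume "fun_act n P \<in> hilbert_ideal G" "f \<in> poly_invariants G" "f 0 = 0" "Q \<in> polyfuns"
  then show "fun_act n (P + f * Q) \<in> hilbert_ideal G"
    using hilbert_ideal.step[of "fun_act n P" G "fun_act n f" "fun_act n Q"] inv
    by (simp add: fun_act_polyfuns)
qed (simp add: hilbert_ideal.zero)

lemma hilbert_ideal_fun_act_mem: "P \<in> hilbert_ideal G \<Longrightarrow> g \<in> G \<Longrightarrow> fun_act g P \<in> hilbert_ideal G"
  by (rule hilbert_ideal_fun_act) (auto simp: poly_invariants_def)

lemma hom_part_invariants: "f \<in> poly_invariants G \<Longrightarrow> hom_part d f \<in> poly_invariants G"
  by (auto simp: poly_invariants_def hom_part_polyfuns simp flip: hom_part_fun_act)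

definition reynolds :: "(complex ^ 'n ^ 'n) set \<Rightarrow> (complex ^ 'n \<Rightarrow> complex) \<Rightarrow> complex ^ 'n \<Rightarrow> complex" where
  "reynolds G P = fun_scale (1 / of_nat (card G)) (\<Sum>g\<in>G. fun_act g P)"

lemma reynolds_add: "reynolds G (P + Q) = reynolds G P + reynolds G Q"
  by (simp add: reynolds_def sum.distrib fun_vs.scale_right_distrib)

lemma reynolds_mult: "f \<in> poly_invariants G \<Longrightarrow> reynolds G (f * P) = f * reynolds G P"
  by (simp add: reynolds_def poly_invariants_def sum_distrib_left)

lemma reynolds_polyfuns: "P \<in> polyfuns \<Longrightarrow> reynolds G P \<in> polyfuns"
  by (simp add: reynolds_def polyfuns_scale polyfuns_sum fun_act_polyfuns)

locale finite_linear_group =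
  fixes G :: "(complex ^ 'n ^ 'n) set"
  assumes finite: "finite G" and one: "mat 1 \<in> G"
    and mult: "\<And>g h. g \<in> G \<Longrightarrow> h \<in> G \<Longrightarrow> g ** h \<in> G"
    and invertible: "\<And>g. g \<in> G \<Longrightarrow> invertible g"
    and inverse: "\<And>g. g \<in> G \<Longrightarrow> matrix_inv g \<in> G"
begin

lemma card_nonzero: "card G \<noteq> 0"
  using finite one by auto

lemma reynolds_at_0: "reynolds G P 0 = P 0"
  using card_nonzero by (simp add: reynolds_def sum_fun_apply)

lemma reynolds_invariants:
  assumes "P \<in> polyfuns"
  shows "reynolds G P \<in> poly_invariants G"
proof -
  have "fun_act g (reynolds G P) = reynolds G P" if g: "g \<in> G" for g
  proof -
    have "(\<Sum>h\<in>G. fun_act g (fun_act h P)) = (\<Sum>h\<in>G. fun_act (g ** h) P)"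
      using invertible g by (intro sum.cong) (auto simp: fun_act_mult)
    also have "\<dots> = (\<Sum>h\<in>G. fun_act h P)"
      by (rule sum.reindex_bij_witness[of _ "\<lambda>h. matrix_inv g ** h" "\<lambda>h. g ** h"])
         (use g in \<open>auto simp: mult inverse invertible matrix_inv_simps matrix_mul_assoc\<close>)
    finally show ?thesis by (simp add: reynolds_def fun_act_sum)
  qed
  then show ?thesis by (auto simp: poly_invariants_def assms reynolds_polyfuns)
qed

end

section \<open>Reflections and divided differences\<close>

text \<open>Finite order supplies a right inverse, the power just before the identity; for square
  matrices it is two-sided.\<close>

lemma reflection_invertible:
  assumes "is_reflection s"
  shows "invertible s"
proof -
  obtain k where k: "k > 0" "((**) s ^^ k) (mat 1) = mat 1"
    using assms by (auto simp: is_reflection_def)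
  then obtain j where "k = Suc j" by (cases k) auto
  with k have "s ** ((**) s ^^ j) (mat 1) = mat 1" by simp
  then show ?thesis
    unfolding invertible_def using matrix_left_right_inverse by blast
qed

text \<open>The inverse fixes the hyperplane too, so it differs from the identity by a map of rank
  one, a nonzero linear form times a vector \<open>w\<close>. The inverse is the matrix to study
  because \<open>fun_act s\<close> substitutes it.\<close>

lemma reflection_inv_form:
  fixes s :: "complex ^ 'n ^ 'n"
  assumes "is_reflection s"
  obtains w l where "\<And>x. matrix_inv s *v x = x + (\<Sum>i\<in>UNIV. l i * x $ i) *s w"
    "(\<lambda>x::complex^'n. \<Sum>i\<in>UNIV. l i * x $ i) \<noteq> 0"
proof -
  let ?B = "matrix_inv s"
  have inv: "s ** ?B = mat 1" "?B ** s = mat 1"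
    using reflection_invertible[OF assms] matrix_inv_simps by auto
  obtain H where H: "vec.subspace H" "vec.dim H + 1 = CARD('n)" "\<And>x. x \<in> H \<Longrightarrow> s *v x = x"
    using assms by (auto simp: is_reflection_def is_hyperplane_def)
  have BH: "?B *v x = x" if "x \<in> H" for x
    using H(3)[OF that] inv(2) by (metis matrix_vector_mul_assoc matrix_vector_mul_lid)
  have "H \<noteq> UNIV" using H(2) vec_dim_card[where 'n = 'n and 'a = complex] by auto
  then obtain y where y: "y \<notin> H" by blast
  have spanH: "vec.span H = H" using H(1) by (simp add: vec.span_eq_iff)
  have "vec.dim (insert y H) = CARD('n)"
    using y H(2) by (simp add: vec.dim_insert spanH)
  then have full: "vec.span (insert y H) = UNIV"
    using vec.dim_eq_span[of "insert y H" UNIV] vec_dim_card[where 'n = 'n and 'a = complex]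
    by (simp add: vec.span_UNIV)
  \<comment> \<open>Every vector is a multiple of \<open>y\<close> modulo the hyperplane, so
    \<open>?B\<close> minus the identity has its image spanned by this one vector.\<close>
  define w where "w = ?B *v y - y"
  have ex: "\<exists>c. ?B *v x = x + c *s w" for x
  proof -
    have "x \<in> vec.span (insert y H)" using full by simp
    then obtain c where "x - c *s y \<in> H" by (auto simp: vec.span_breakdown_eq spanH)
    then have "?B *v (x - c *s y) = x - c *s y" by (rule BH)
    then have "?B *v x = x + c *s w"
      by (simp add: w_def matrix_vector_mult_diff_distrib vector_scalar_commute algebra_simps
          vec.scale_right_diff_distrib)
    then show ?thesis by blast
  qed
  have "w \<noteq> 0"
  proof
    assume "w = 0"
    then have "?B *v x = x" for x using ex[of x] by auto
    then have "?B = mat 1" by (metis matrix_eq matrix_vector_mul_lid)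
    then have "s = mat 1" using inv by (metis matrix_mul_rid)
    then show False using assms by (simp add: is_reflection_def)
  qed
  then obtain k where k: "w $ k \<noteq> 0" by (metis vec_eq_iff zero_index)
  \<comment> \<open>A coordinate \<open>k\<close> in which \<open>w\<close> is nonzero turns the
    scalar in front of \<open>w\<close> into an explicit linear form in the entries of the
    matrix.\<close>
  define l where "l = (\<lambda>i. (?B $ k $ i - (if i = k then 1 else 0)) / w $ k)"
  have l: "(\<Sum>i\<in>UNIV. l i * x $ i) = ((?B *v x) $ k - x $ k) / w $ k" for x
    unfolding l_def
    by (simp add: matrix_vector_mult_def left_diff_distrib diff_divide_distrib sum_subtractf
        sum_divide_distrib if_distrib[of "\<lambda>c. c * _"] if_distrib[of "\<lambda>c. c / _"] cong: if_cong)
  show ?thesis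
  proof (rule that[of l w])
    show "?B *v x = x + (\<Sum>i\<in>UNIV. l i * x $ i) *s w" for x
    proof -
      obtain c where "?B *v x = x + c *s w" using ex by blast
      then show ?thesis using k by (simp add: l)
    qed
    have "(\<Sum>i\<in>UNIV. l i * y $ i) = 1" using k by (simp add: l w_def)
    then show "(\<lambda>x::complex^'n. \<Sum>i\<in>UNIV. l i * x $ i) \<noteq> 0"
      by (metis zero_fun_apply zero_neq_one)
  qed
qed

text \<open>Degree \<open>d - 1\<close>, with only the zero function for \<open>d = 0\<close>;
  truncated subtraction would keep the constants there.\<close>

fun polyfun_deg_below :: "nat \<Rightarrow> (complex ^ 'n \<Rightarrow> complex) set" where
  "polyfun_deg_below 0 = {0}"
| "polyfun_deg_below (Suc d) = polyfun_deg d"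

lemma subspace_polyfun_deg_below: "fun_vs.subspace (polyfun_deg_below d)"
  by (cases d) (auto simp: subspace_polyfun_deg)

lemma polyfun_deg_below_mult:
  "P \<in> polyfun_deg d \<Longrightarrow> Q \<in> polyfun_deg_below e \<Longrightarrow> P * Q \<in> polyfun_deg_below (d + e)"
  by (cases e) (auto simp: polyfun_deg_mult fun_vs.subspace_0[OF subspace_polyfun_deg_below])

text \<open>On coordinate functions the quotient by \<open>L\<close> is the constant
  \<open>w $ i\<close>. The twisted Leibniz rule
  \<open>s(PQ) - PQ = sP (sQ - Q) + (sP - P) Q\<close> carries divisibility and the degree drop to
  products.\<close>

lemma divided_difference_deg:
  fixes P :: "complex ^ 'n \<Rightarrow> complex"
  assumes form: "\<And>x. matrix_inv s *v x = x + L x *s w" and "P \<in> polyfun_deg d"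
  shows "\<exists>Q \<in> polyfun_deg_below d. fun_act s P - P = L * Q"
  using assms(2)
proof (induction rule: polyfun_deg_induct)
  case one
  have "fun_act s 1 - 1 = L * 0" by simp
  then show ?case by (metis polyfun_deg_below.simps(1) singletonI)
next
  case (coord i)
  have "(\<lambda>x. w $ i) \<in> polyfun_deg_below 1" by (auto simp: polyfun_deg_0)
  moreover have "fun_act s (\<lambda>x. x $ i) - (\<lambda>x. x $ i) = L * (\<lambda>x. w $ i)"
    by (simp add: fun_eq_iff fun_act_def form)
  ultimately show ?case by blast
next
  case (mult d e P Q)
  then obtain P' Q' where *: "P' \<in> polyfun_deg_below d" "fun_act s P - P = L * P'"
    "Q' \<in> polyfun_deg_below e" "fun_act s Q - Q = L * Q'" by blast
  have "fun_act s (P * Q) - P * Q = fun_act s P * (fun_act s Q - Q) + (fun_act s P - P) * Q"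
    by (simp add: algebra_simps)
  also have "\<dots> = L * (fun_act s P * Q' + Q * P')"
    by (simp add: * algebra_simps)
  finally have "fun_act s (P * Q) - P * Q = L * (fun_act s P * Q' + Q * P')" .
  moreover have "fun_act s P * Q' + Q * P' \<in> polyfun_deg_below (d + e)"
    using polyfun_deg_below_mult[of "fun_act s P" d Q' e] polyfun_deg_below_mult[of Q e P' d] * mult.hyps
    by (intro fun_vs.subspace_add[OF subspace_polyfun_deg_below])
       (auto simp: fun_act_polyfun_deg add.commute)
  ultimately show ?case by blast
next
  case (zero d)
  have "0 \<in> polyfun_deg_below d" by (rule fun_vs.subspace_0[OF subspace_polyfun_deg_below])
  moreover have "fun_act s 0 - 0 = L * 0" by simp
  ultimately show ?case by blast
next
  case (add d P Q)
  then obtain P' Q' where *: "P' \<in> polyfun_deg_below d" "fun_act s P - P = L * P'"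
    "Q' \<in> polyfun_deg_below d" "fun_act s Q - Q = L * Q'" by blast
  have "fun_act s (P + Q) - (P + Q) = (fun_act s P - P) + (fun_act s Q - Q)" by simp
  also have "\<dots> = L * (P' + Q')" by (simp add: * algebra_simps)
  finally show ?case using * fun_vs.subspace_add[OF subspace_polyfun_deg_below] by blast
next
  case (scale d c P)
  then obtain P' where *: "P' \<in> polyfun_deg_below d" "fun_act s P - P = L * P'" by blast
  have "fun_act s (fun_scale c P) - fun_scale c P = fun_scale c (fun_act s P - P)"
    by (simp add: fun_vs.scale_right_diff_distrib)
  also have "\<dots> = L * fun_scale c P'" by (simp add: *)
  finally show ?case using * fun_vs.subspace_scale[OF subspace_polyfun_deg_below] by blast
qed

section \<open>Operators linear over the invariants\<close>

definition inv_linear :: "(complex ^ 'n ^ 'n) set \<Rightarrow>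
    ((complex ^ 'n \<Rightarrow> complex) \<Rightarrow> complex ^ 'n \<Rightarrow> complex) \<Rightarrow> bool" where
  "inv_linear G D \<longleftrightarrow> (\<forall>P\<in>polyfuns. D P \<in> polyfuns) \<and>
     (\<forall>P\<in>polyfuns. \<forall>Q\<in>polyfuns. D (P + Q) = D P + D Q) \<and>
     (\<forall>f\<in>poly_invariants G. \<forall>P\<in>polyfuns. D (f * P) = f * D P)"

text \<open>By Chevalley's argument, for a reflection group this is the Hilbert ideal.\<close>

definition undetected :: "(complex ^ 'n ^ 'n) set \<Rightarrow> (complex ^ 'n \<Rightarrow> complex) set" where
  "undetected G = {P \<in> polyfuns. \<forall>D. inv_linear G D \<longrightarrow> D P 0 = 0}"

text \<open>Constants are invariant, so complex linearity is a case of linearity over the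
  invariants.\<close>

lemma inv_linear_scale:
  assumes "inv_linear G D" "P \<in> polyfuns"
  shows "D (fun_scale c P) = fun_scale c (D P)"
proof -
  have *: "fun_scale c P = (\<lambda>x. c) * P" for P :: "complex ^ 'n \<Rightarrow> complex" by (simp add: fun_eq_iff)
  show ?thesis unfolding * using assms const_invariants[of c G] by (auto simp: inv_linear_def)
qed

lemma inv_linear_add:
  "inv_linear G D \<Longrightarrow> P \<in> polyfuns \<Longrightarrow> Q \<in> polyfuns \<Longrightarrow> D (P + Q) = D P + D Q"
  by (simp add: inv_linear_def)

lemma inv_linear_sum:
  assumes D: "inv_linear G D" and "\<And>i. i \<in> A \<Longrightarrow> F i \<in> polyfuns"
  shows "D (\<Sum>i\<in>A. F i) = (\<Sum>i\<in>A. D (F i))"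
proof -
  have "D 0 = 0" using inv_linear_scale[OF D, of 0 0] by simp
  with assms(2) have "(\<Sum>i\<in>A. F i) \<in> polyfuns \<and> D (\<Sum>i\<in>A. F i) = (\<Sum>i\<in>A. D (F i))"
  proof (induction A rule: infinite_finite_induct)
    case (insert i A)
    then have "sum F A \<in> polyfuns" "D (sum F A) = (\<Sum>i\<in>A. D (F i))" "F i \<in> polyfuns" by auto
    moreover from this have "D (F i + sum F A) = D (F i) + D (sum F A)"
      using D unfolding inv_linear_def by blast
    ultimately show ?case using insert.hyps polyfuns_add[of "F i" "sum F A"]
      by (simp only: sum.insert simp_thms)
  qed auto
  then show ?thesis by blast
qed

lemma inv_linear_polyfuns: "inv_linear G D \<Longrightarrow> P \<in> polyfuns \<Longrightarrow> D P \<in> polyfuns"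
  by (simp add: inv_linear_def)

lemma inv_linear_id: "inv_linear G (\<lambda>P. P)"
  by (simp add: inv_linear_def)

lemma inv_linear_comp: "inv_linear G D \<Longrightarrow> inv_linear G E \<Longrightarrow> inv_linear G (\<lambda>P. D (E P))"
  by (simp add: inv_linear_def)

lemma inv_linear_reynolds: "inv_linear G (reynolds G)"
  by (simp add: inv_linear_def reynolds_polyfuns reynolds_add reynolds_mult)

lemma subspace_undetected: "fun_vs.subspace (undetected G)"
proof -
  have "D 0 0 = 0" if "inv_linear G D" for D
    using inv_linear_scale[OF that, of 0 0] by simp
  then show ?thesis
    by (auto simp: fun_vs.subspace_def undetected_def polyfuns_add polyfuns_scale inv_linear_scale
        inv_linear_add)
qed

lemma undetected_inv_linear: "inv_linear G D \<Longrightarrow> P \<in> undetected G \<Longrightarrow> D P \<in> undetected G"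
  using inv_linear_comp inv_linear_polyfuns by (fastforce simp: undetected_def)

text \<open>An invariant-linear operator pulls the factor \<open>f - f 0\<close> out, and this
  factor vanishes at the origin. So modulo \<open>undetected\<close> an invariant acts as its value
  at the origin.\<close>

lemma undetected_mult_invariant:
  assumes "f \<in> poly_invariants G" "P \<in> polyfuns"
  shows "f * P - fun_scale (f 0) P \<in> undetected G"
proof -
  have *: "f * P - fun_scale (f 0) P = (f - (\<lambda>x. f 0)) * P"
    by (simp add: fun_eq_iff algebra_simps)
  have g: "f - (\<lambda>x. f 0) \<in> poly_invariants G"
    using assms const_invariants fun_vs.subspace_diff[OF subspace_invariants] by blast
  have "D ((f - (\<lambda>x. f 0)) * P) 0 = 0" if "inv_linear G D" for D
    using that g assms(2) by (simp add: inv_linear_def)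
  then show ?thesis
    unfolding * undetected_def using g assms(2) by (auto intro: polyfuns_mult invariants_polyfuns)
qed

text \<open>The choice is harmless for nonzero polynomial \<open>L\<close>: without zero divisors
  there is at most one polynomial quotient.\<close>

definition divided_difference ::
  "complex ^ 'n ^ 'n \<Rightarrow> (complex ^ 'n \<Rightarrow> complex) \<Rightarrow> (complex ^ 'n \<Rightarrow> complex) \<Rightarrow> complex ^ 'n \<Rightarrow> complex" where
  "divided_difference s L P = (SOME Q. Q \<in> polyfuns \<and> fun_act s P - P = L * Q)"

text \<open>Uniqueness of the quotient makes it additive, and it is linear over the invariants
  because \<open>s\<close> lies in \<open>G\<close> and fixes them. Divided differences are
  therefore among the operators over which \<open>undetected\<close> quantifies.\<close>

lemma reflection_divided_difference:
  fixes s :: "complex ^ 'n ^ 'n"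
  assumes "is_reflection s" "s \<in> G"
  obtains L D where "L \<in> polyfuns" "inv_linear G D"
    "\<And>P. P \<in> polyfuns \<Longrightarrow> fun_act s P - P = L * D P"
    "\<And>d P. P \<in> polyfun_deg d \<Longrightarrow> D P \<in> polyfun_deg_below d"
proof -
  obtain w l where form: "\<And>x. matrix_inv s *v x = x + (\<Sum>i\<in>UNIV. l i * x $ i) *s w"
    and nz: "(\<lambda>x::complex^'n. \<Sum>i\<in>UNIV. l i * x $ i) \<noteq> 0"
    using reflection_inv_form[OF assms(1)] by blast
  define L where "L = (\<lambda>x::complex^'n. \<Sum>i\<in>UNIV. l i * x $ i)"
  define D where "D = divided_difference s L"
  have L: "L \<in> polyfuns" "L \<noteq> 0"
    using linear_polyfun_deg polyfun_deg_polyfuns nz unfolding L_def by blast+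
  note deg = divided_difference_deg[where L = L, unfolded L_def, OF form, folded L_def]
  have below: "Q \<in> polyfuns" if "Q \<in> polyfun_deg_below d" for d and Q :: "complex ^ 'n \<Rightarrow> complex"
    using that by (cases d) (auto intro: polyfun_deg_polyfuns)
  have ex: "\<exists>Q. Q \<in> polyfuns \<and> fun_act s P - P = L * Q" if "P \<in> polyfuns" for P
    using that
  proof (rule polyfuns_induct[where Pr = "\<lambda>P. \<exists>Q. Q \<in> polyfuns \<and> fun_act s P - P = L * Q"])
    fix d and P :: "complex ^ 'n \<Rightarrow> complex" assume "P \<in> polyfun_deg d"
    then show "\<exists>Q. Q \<in> polyfuns \<and> fun_act s P - P = L * Q" using deg below by blast
  next
    show "\<exists>Q. Q \<in> polyfuns \<and> fun_act s 0 - 0 = L * Q" by (intro exI[of _ 0]) simp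
  next
    fix P Q :: "complex ^ 'n \<Rightarrow> complex"
    assume "\<exists>Q. Q \<in> polyfuns \<and> fun_act s P - P = L * Q" "\<exists>R. R \<in> polyfuns \<and> fun_act s Q - Q = L * R"
    then obtain P' Q' where *: "P' \<in> polyfuns" "fun_act s P - P = L * P'" "Q' \<in> polyfuns" "fun_act s Q - Q = L * Q'"
      by blast
    have "fun_act s (P + Q) - (P + Q) = (fun_act s P - P) + (fun_act s Q - Q)" by simp
    also have "\<dots> = L * (P' + Q')" by (simp add: * algebra_simps)
    finally show "\<exists>R. R \<in> polyfuns \<and> fun_act s (P + Q) - (P + Q) = L * R"
      using * polyfuns_add by blast
  qed
  have D: "D P \<in> polyfuns" "fun_act s P - P = L * D P" if "P \<in> polyfuns" for P
    using someI_ex[OF ex[OF that]] by (auto simp: D_def divided_difference_def)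
  have D_eq: "D P = Q" if "P \<in> polyfuns" "Q \<in> polyfuns" "fun_act s P - P = L * Q" for P Q
    using polyfuns_mult_left_cancel[OF L D(1)[OF that(1)] that(2)] D(2)[OF that(1)] that(3) by simp
  show ?thesis
  proof (rule that[OF L(1)])
    show "inv_linear G D"
      unfolding inv_linear_def
    proof (intro conjI ballI)
      fix P Q :: "complex ^ 'n \<Rightarrow> complex" assume PQ: "P \<in> polyfuns" "Q \<in> polyfuns"
      have "fun_act s (P + Q) - (P + Q) = (fun_act s P - P) + (fun_act s Q - Q)" by simp
      also have "\<dots> = L * (D P + D Q)" using D(2) PQ by (simp add: algebra_simps)
      finally show "D (P + Q) = D P + D Q" using PQ D(1) by (intro D_eq polyfuns_add)
    next
      fix f P :: "complex ^ 'n \<Rightarrow> complex" assume fP: "f \<in> poly_invariants G" "P \<in> polyfuns"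
      then have f: "fun_act s f = f" "f \<in> polyfuns" using assms(2) by (auto simp: poly_invariants_def)
      have "fun_act s (f * P) - f * P = f * (fun_act s P - P)" using f by (simp add: algebra_simps)
      also have "\<dots> = L * (f * D P)" using D(2) fP by (simp add: algebra_simps)
      finally show "D (f * P) = f * D P" using fP f D(1) by (intro D_eq polyfuns_mult)
    qed (use D in auto)
    show "fun_act s P - P = L * D P" if "P \<in> polyfuns" for P using D that by blast
    show "D P \<in> polyfun_deg_below d" if P: "P \<in> polyfun_deg d" for d P
    proof -
      obtain Q where "Q \<in> polyfun_deg_below d" "fun_act s P - P = L * Q" using deg[OF P] by blast
      then show ?thesis using D_eq[of P Q] P below polyfun_deg_polyfuns by metis
    qed
  qed
qed

section \<open>Freeness over the invariants of a reflection group\<close>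

lemma inv_GL: "invertible g \<Longrightarrow> inv\<^bsub>GL\<^esub> g = matrix_inv g"
  by (rule group.inv_equality[OF group_GL]) (auto simp: GL_def matrix_inv_simps invertible_matrix_inv)

locale finite_reflection_group = finite_linear_group +
  fixes R
  assumes reflections: "R \<subseteq> {s. is_reflection s}" and generated: "G = generate GL R"
begin

text \<open>Invariance modulo the Hilbert ideal passes from the generators to the group because the
  ideal is itself stable under the group.\<close>

lemma fun_act_congruent:
  assumes "P \<in> polyfuns" and refl: "\<And>s. s \<in> R \<Longrightarrow> fun_act s P - P \<in> hilbert_ideal G" and "g \<in> G"
  shows "fun_act g P - P \<in> hilbert_ideal G"
proof -
  have "g \<in> generate GL R" using assms(3) generated by simp
  then show ?thesis
  proof (induction rule: generate.induct)
    case one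
    then show ?case by (simp add: GL_def hilbert_ideal.zero flip: zero_fun_def)
  next
    case (incl h)
    then show ?case by (rule refl)
  next
    case (inv h)
    have h: "h \<in> G" using inv generated generate.incl by metis
    then have "invertible h" using invertible by blast
    \<comment> \<open>The congruence for \<open>h\<close> is transported by the inverse of
      \<open>h\<close>, which changes its sign.\<close>
    then have "fun_act (matrix_inv h) P - P = fun_scale (-1) (fun_act (matrix_inv h) (fun_act h P - P))"
      by (simp add: fun_act_inv)
    also have "\<dots> \<in> hilbert_ideal G"
      by (intro hilbert_ideal_scale hilbert_ideal_fun_act_mem refl inv inverse h)
    finally show ?case by (simp only: inv_GL[OF \<open>invertible h\<close>])
  next
    case (eng g h)
    then have gh: "g \<in> G" "h \<in> G" using generated by auto
    then have "fun_act (g ** h) P - P = (fun_act g P - P) + fun_act g (fun_act h P - P)"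
      using invertible by (simp add: fun_act_mult)
    also have "\<dots> \<in> hilbert_ideal G"
      by (intro hilbert_ideal_add hilbert_ideal_fun_act_mem eng.IH gh)
    finally have "fun_act (g ** h) P - P \<in> hilbert_ideal G" .
    moreover have "g \<otimes>\<^bsub>GL\<^esub> h = g ** h" by (simp add: GL_def)
    ultimately show ?case by (simp only:)
  qed
qed

text \<open>Chevalley's induction. Divided differences of \<open>P\<close> are again undetected and
  of smaller degree, hence in the ideal; so \<open>P\<close> is congruent to all its translates and
  to their average, an invariant without constant term. The family \<open>F\<close> of homogeneous
  parts encodes the degree bound \<open>N\<close>.\<close>

lemma undetected_hilbert_ideal_aux:
  assumes "\<And>d. F d \<in> polyfun_deg d" "(\<Sum>d\<le>N. F d) \<in> undetected G"
  shows "(\<Sum>d\<le>N. F d) \<in> hilbert_ideal G"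
  using assms
proof (induction N arbitrary: F)
  case 0
  then obtain c where c: "F 0 = (\<lambda>x. c)" using 0(1)[of 0] by (auto simp: polyfun_deg_0)
  have "F 0 0 = 0" using 0(2) inv_linear_id by (auto simp: undetected_def)
  then have "F 0 = 0" using c by (simp add: fun_eq_iff)
  then show ?case by (simp add: hilbert_ideal.zero flip: zero_fun_def)
next
  case (Suc N)
  define P where "P = (\<Sum>d\<le>Suc N. F d)"
  have F: "F d \<in> polyfuns" for d using Suc(2) polyfun_deg_polyfuns by blast
  have und: "P \<in> undetected G"
    using Suc(3) unfolding P_def .
  then have P: "P \<in> polyfuns" "P \<in> undetected G"
    by (auto simp: undetected_def)
  have refl: "fun_act s P - P \<in> hilbert_ideal G" if s: "s \<in> R" for s
  proof -
    have "is_reflection s" "s \<in> G" using s reflections generated generate.incl by auto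
    then obtain L D where LD: "L \<in> polyfuns" "inv_linear G D"
      "\<And>P. P \<in> polyfuns \<Longrightarrow> fun_act s P - P = L * D P"
      "\<And>d P. P \<in> polyfun_deg d \<Longrightarrow> D P \<in> polyfun_deg_below d"
      using reflection_divided_difference by metis
    \<comment> \<open>Constants have divided difference zero and every other part drops by one
      degree, so \<open>D P\<close> has parts of degree at most \<open>N\<close> only.\<close>
    have "D (F 0) = 0" using LD(4)[OF Suc(2)[of 0]] by simp
    then have "D P = (\<Sum>d\<le>N. D (F (Suc d)))"
      unfolding P_def using inv_linear_sum[OF LD(2), of "{..Suc N}" F] F by (simp add: sum.atMost_Suc_shift del: sum.atMost_Suc)
    moreover have "D P \<in> undetected G" using undetected_inv_linear LD P by blast
    moreover have "D (F (Suc d)) \<in> polyfun_deg d" for d using LD(4)[OF Suc(2)[of "Suc d"]] by simp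
    ultimately have "D P \<in> hilbert_ideal G" using Suc.IH[of "\<lambda>d. D (F (Suc d))"] by simp
    then show ?thesis using LD(1,3) P by (simp add: hilbert_ideal_mult)
  qed
  \<comment> \<open>Averaging the congruences over the group replaces the translates by
    \<open>reynolds G P\<close>.\<close>
  have "fun_scale (1 / of_nat (card G)) (\<Sum>g\<in>G. fun_act g P - P) \<in> hilbert_ideal G"
    using fun_act_congruent[OF P(1) refl] by (intro hilbert_ideal_scale hilbert_ideal_sum)
  also have "fun_scale (1 / of_nat (card G)) (\<Sum>g\<in>G. fun_act g P - P) = reynolds G P - P"
    using card_nonzero by (auto simp: reynolds_def fun_eq_iff sum_fun_apply sum_subtractf field_simps)
  finally have 1: "reynolds G P - P \<in> hilbert_ideal G" .
  \<comment> \<open>The identity operator is invariant-linear, so an undetected polynomial vanishes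
    at the origin, and averaging keeps that value.\<close>
  have "reynolds G P 0 = 0"
    using P(2) inv_linear_id by (auto simp: undetected_def reynolds_at_0)
  then have 2: "reynolds G P \<in> hilbert_ideal G"
    using reynolds_invariants[OF P(1)] by (intro hilbert_ideal_invariant)
  have "P \<in> hilbert_ideal G" using hilbert_ideal_diff[OF 2 1] by simp
  then show ?case unfolding P_def .
qed

lemma undetected_hilbert_ideal: "undetected G \<subseteq> hilbert_ideal G"
proof
  fix P assume P: "P \<in> undetected G"
  then have "P \<in> polyfuns" by (simp add: undetected_def)
  then obtain N where "P = (\<Sum>d\<le>N. hom_part d P)" using sum_parts by metis
  then show "P \<in> hilbert_ideal G"
    using undetected_hilbert_ideal_aux[of "\<lambda>d. hom_part d P" N] hom_part_polyfun_deg P by metis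
qed

end

context finite_linear_group
begin

text \<open>Gaussian elimination: some invariant-linear operator, followed by averaging, turns one
  member of the family into an invariant that does not vanish at the origin.\<close>

lemma invariant_independence:
  assumes "finite A" "\<And>j. j \<in> A \<Longrightarrow> P j \<in> polyfuns" "\<And>j. j \<in> A \<Longrightarrow> f j \<in> poly_invariants G"
    and "\<And>c. (\<Sum>j\<in>A. fun_scale (c j) (P j)) \<in> undetected G \<Longrightarrow> \<forall>j\<in>A. c j = 0"
    and "(\<Sum>j\<in>A. f j * P j) = 0"
  shows "\<forall>j\<in>A. f j = 0"
  using assms
proof (induction A arbitrary: P rule: finite_induct)
  case (insert a A)
  note P = insert.prems(1) and f = insert.prems(2) and indep = insert.prems(3)
  have fS: "f j \<in> polyfuns" if "j \<in> insert a A" for j using f[OF that] invariants_polyfuns by blast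
  have "P a \<notin> undetected G"
  proof
    assume "P a \<in> undetected G"
    moreover have "(\<Sum>j\<in>insert a A. fun_scale (if j = a then 1 else 0) (P j)) = P a"
    proof -
      have "(\<Sum>j\<in>A. fun_scale (if j = a then 1 else 0) (P j)) = 0"
        using insert.hyps by (intro sum.neutral) auto
      then show ?thesis using insert.hyps by simp
    qed
    ultimately have "(\<Sum>j\<in>insert a A. fun_scale (if j = a then 1 else 0) (P j)) \<in> undetected G"
      by (simp only:)
    from indep[OF this] show False by simp
  qed
  then obtain E where E: "inv_linear G E" "E (P a) 0 \<noteq> 0"
    using P by (auto simp: undetected_def)
  define g where "g j = reynolds G (E (P j))" for j
  have D: "inv_linear G (\<lambda>P. reynolds G (E P))"
    using inv_linear_comp[OF inv_linear_reynolds E(1)] .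
  have g: "g j \<in> poly_invariants G" if "j \<in> insert a A" for j
    unfolding g_def by (rule reynolds_invariants[OF inv_linear_polyfuns[OF E(1) P[OF that]]])
  have gS: "g j \<in> polyfuns" if "j \<in> insert a A" for j using g[OF that] invariants_polyfuns by blast
  have ga: "g a 0 \<noteq> 0" using E(2) by (simp add: g_def reynolds_at_0)
  \<comment> \<open>The pivot \<open>g a\<close> is only nonzero at the origin, so elimination
    multiplies crosswise. The averaged operator sends \<open>P' j\<close> to
    \<open>g a * g j - g j * g a = 0\<close>.\<close>
  define P' where "P' j = g a * P j - g j * P a" for j
  have P': "P' j \<in> polyfuns" if "j \<in> A" for j
    unfolding P'_def using that gS P by (intro polyfuns_diff polyfuns_mult) auto
  have rel0: "(\<Sum>j\<in>insert a A. f j * P j) = 0" by (rule insert.prems(4))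
  then have rel: "f a * P a + (\<Sum>j\<in>A. f j * P j) = 0"
    using insert.hyps by simp
  have "reynolds G (E (\<Sum>j\<in>insert a A. f j * P j)) = (\<Sum>j\<in>insert a A. f j * g j)"
    using inv_linear_sum[OF D, of "insert a A" "\<lambda>j. f j * P j"] fS P f D
    by (simp add: polyfuns_mult g_def inv_linear_def)
  moreover have "reynolds G (E 0) = 0"
    using inv_linear_sum[OF D, of "{}"] by simp
  ultimately have "(\<Sum>j\<in>insert a A. f j * g j) = 0" unfolding rel0 by simp
  then have rel_g: "f a * g a + (\<Sum>j\<in>A. f j * g j) = 0" using insert.hyps by simp
  \<comment> \<open>The relation times \<open>g a\<close> and its image under the operator times
    \<open>P a\<close> contain the same term \<open>f a * P a * g a\<close>, which cancels.\<close>
  have "(\<Sum>j\<in>A. f j * P' j) = g a * (\<Sum>j\<in>A. f j * P j) - P a * (\<Sum>j\<in>A. f j * g j)"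
    by (simp add: P'_def sum_distrib_left algebra_simps flip: sum_subtractf)
  moreover have "(\<Sum>j\<in>A. f j * P j) = - (f a * P a)"
    using rel by (simp add: eq_neg_iff_add_eq_0 add.commute)
  moreover have "(\<Sum>j\<in>A. f j * g j) = - (f a * g a)"
    using rel_g by (simp add: eq_neg_iff_add_eq_0 add.commute)
  ultimately have rel': "(\<Sum>j\<in>A. f j * P' j) = 0" by (simp add: mult.assoc mult.left_commute mult.commute)
  have "\<forall>j\<in>A. f j = 0"
  proof (rule insert.IH[OF P' _ _ rel'])
    fix c assume c: "(\<Sum>j\<in>A. fun_scale (c j) (P' j)) \<in> undetected G"
    \<comment> \<open>Replacing each \<open>g j\<close> by its value at the origin, which is allowed
      modulo \<open>undetected\<close>, turns the combination of the \<open>P' j\<close> into a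
      combination of the original \<open>P j\<close> with these constants. From
      \<open>c' j = 0\<close> one returns to \<open>c j = 0\<close> by
      \<open>g a 0 \<noteq> 0\<close>.\<close>
    define c' where "c' j = (if j = a then - (\<Sum>j\<in>A. c j * g j 0) else c j * g a 0)" for j
    have "fun_scale (c j) (g a * P j - fun_scale (g a 0) (P j)) - fun_scale (c j) (g j * P a - fun_scale (g j 0) (P a)) \<in> undetected G"
      if "j \<in> A" for j
      using that g P by (intro fun_vs.subspace_diff fun_vs.subspace_scale subspace_undetected undetected_mult_invariant) auto
    then have "(\<Sum>j\<in>A. fun_scale (c j) (g a * P j - fun_scale (g a 0) (P j)) - fun_scale (c j) (g j * P a - fun_scale (g j 0) (P a))) \<in> undetected G"
      by (intro fun_vs.subspace_sum subspace_undetected)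
    from fun_vs.subspace_diff[OF subspace_undetected c this]
    have "(\<Sum>j\<in>A. fun_scale (c j * g a 0) (P j) - fun_scale (c j * g j 0) (P a)) \<in> undetected G"
      by (simp add: P'_def fun_vs.scale_right_diff_distrib algebra_simps flip: sum_subtractf)
    also have "(\<Sum>j\<in>A. fun_scale (c j * g a 0) (P j) - fun_scale (c j * g j 0) (P a)) = (\<Sum>j\<in>insert a A. fun_scale (c' j) (P j))"
    proof -
      have "(\<Sum>j\<in>A. fun_scale (c' j) (P j)) = (\<Sum>j\<in>A. fun_scale (c j * g a 0) (P j))"
        using insert.hyps by (intro sum.cong) (auto simp: c'_def)
      then show ?thesis using insert.hyps
        by (simp add: sum_subtractf c'_def fun_vs.scale_sum_left)
    qed
    finally have "\<forall>j\<in>insert a A. c' j = 0" by (rule indep)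
    then show "\<forall>j\<in>A. c j = 0" using ga insert.hyps by (auto simp: c'_def split: if_splits)
  qed (use f in auto)
  moreover from this have "f a * P a = 0" using rel by simp
  then have "f a = 0 \<or> P a = 0"
    by (intro polyfuns_no_zero_divisors fS P) auto
  then have "f a = 0"
    using \<open>P a \<notin> undetected G\<close> fun_vs.subspace_0[OF subspace_undetected] by metis
  ultimately show ?case by blast
qed simp

end

section \<open>The pairing and the Hermitian form on polynomial functions\<close>

lemma peval_power: "peval (p ^ k) = (\<lambda>x. peval p x ^ k)"
  by (induction k) (auto simp: peval_mult fun_eq_iff)

lemma peval_prod: "peval (\<Prod>i\<in>A. f i) = (\<lambda>x. \<Prod>i\<in>A. peval (f i) x)"
  by (induction A rule: infinite_finite_induct) (auto simp: peval_mult fun_eq_iff)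

lemma peval_sym_of: "peval (sym_of v) = (\<lambda>x. \<Sum>i\<in>UNIV. v $ i * x $ i)"
  unfolding sym_of_def
  by (auto simp: peval_sum peval_single fun_eq_iff sum_fun_apply lookup_single when_def if_distrib
      cong: if_cong)

text \<open>Read as a polynomial function on the dual space, an element of the symmetric algebra is
  moved by substituting the transpose. With injectivity of \<open>peval\<close>, laws of
  \<open>sym_act\<close> reduce to laws of matrices.\<close>

lemma peval_sym_act: "peval (sym_act g a) x = peval a (transpose g *v x)"
proof -
  have "peval (sym_of (g *v axis i 1)) x = (transpose g *v x) $ i" for i
    by (simp add: peval_sym_of matrix_vector_mult_def axis_def transpose_def if_distrib cong: if_cong)
  then show ?thesis
    by (simp add: sym_act_def peval_sum sum_fun_apply peval_mult peval_prod peval_power peval_single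
        peval_def[of a])
qed

lemma sym_act_eqI: "(\<And>x. peval a (transpose g *v x) = peval b x) \<Longrightarrow> sym_act g a = b"
  using inj_peval by (metis (no_types, lifting) ext injD peval_sym_act)

lemma sym_act_id: "sym_act (mat 1) a = a"
  by (rule sym_act_eqI) (simp add: transpose_mat)

lemma sym_act_compose: "sym_act g (sym_act h a) = sym_act (g ** h) a"
proof (rule sym_act_eqI)
  fix x
  have "transpose (g ** h) *v x = transpose h *v (transpose g *v x)"
    by (simp only: matrix_transpose_mul matrix_vector_mul_assoc)
  then show "peval (sym_act h a) (transpose g *v x) = peval (sym_act (g ** h) a) x"
    by (simp only: peval_sym_act)
qed

lemma sym_act_add: "sym_act g (a + b) = sym_act g a + sym_act g b"
  by (rule sym_act_eqI) (simp add: peval_plus peval_sym_act)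

lemma sym_act_mult: "sym_act g (a * b) = sym_act g a * sym_act g b"
  by (rule sym_act_eqI) (simp add: peval_mult peval_sym_act)

lemma sym_act_zero: "sym_act g 0 = 0"
  by (rule sym_act_eqI) simp

lemma lookup_sym_act_0: "Poly_Mapping.lookup (sym_act g a) 0 = Poly_Mapping.lookup a 0"
  using peval_sym_act[of g a 0] by (simp add: peval_at_0)

lemma diff_op_polyfuns:
  fixes P :: "complex ^ 'n \<Rightarrow> complex"
  assumes "P \<in> polyfuns"
  shows "diff_op a P \<in> polyfuns"
proof -
  obtain p where p: "P = peval p" using assms by (auto simp: polyfuns_def)
  have "diff_op a P = (\<Sum>m\<in>Poly_Mapping.keys a. fun_scale (Poly_Mapping.lookup a m) (peval (pderiv_monom m p)))"
    by (simp add: diff_op_def p diff_monom_peval fun_eq_iff sum_fun_apply)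
  then show ?thesis by (simp add: polyfuns_sum polyfuns_scale)
qed

lemma diff_op_const: "diff_op (Poly_Mapping.single 0 c) P = fun_scale c P"
  using diff_op_scalar[of c 1 P] by (simp add: diff_op_one fun_scale_def)

text \<open>The substituted inverse turns a step along \<open>g v\<close> into a step along
  \<open>v\<close>, so the two difference quotients coincide before any limit is taken.\<close>

lemma dir_deriv_fun_act:
  assumes "invertible g"
  shows "dir_deriv (g *v v) (fun_act g P) = fun_act g (dir_deriv v P)"
proof -
  have "matrix_inv g *v (x + t *s (g *v v)) = matrix_inv g *v x + t *s v" for x t
    by (simp add: matrix_vector_right_distrib vector_scalar_commute matrix_vector_mul_assoc
        matrix_inv_simps assms)
  then show ?thesis by (simp add: dir_deriv_def fun_act_def)
qed

text \<open>Both sides are multiplicative in \<open>a\<close>, so the claim follows from its case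
  for directional derivatives. The relation \<open>rel b c\<close>, closed under the algebra
  operations, organises this.\<close>

lemma diff_op_fun_act:
  fixes P :: "complex ^ 'n \<Rightarrow> complex"
  assumes g: "invertible g" and P: "P \<in> polyfuns"
  shows "diff_op (sym_act g a) (fun_act g P) = fun_act g (diff_op a P)"
proof -
  define rel where "rel b c \<longleftrightarrow>
    (\<forall>P::complex^'n \<Rightarrow> complex. P \<in> polyfuns \<longrightarrow> diff_op b (fun_act g P) = fun_act g (diff_op c P))" for b c
  have mult: "rel (b * b') (c * c')" if "rel b c" "rel b' c'" for b b' c c'
    using that by (simp add: rel_def diff_op_times diff_op_polyfuns fun_act_polyfuns)
  have one: "rel 1 1" by (simp add: rel_def diff_op_one)
  have const: "rel (Poly_Mapping.single 0 c) (Poly_Mapping.single 0 c)" for c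
    by (simp add: rel_def diff_op_const)
  have sym: "rel (sym_of (g *v v)) (sym_of v)" for v
    by (simp add: rel_def diff_op_sym_of fun_act_polyfuns dir_deriv_fun_act g)
  have pow: "rel (b ^ k) (c ^ k)" if "rel b c" for b c k
    by (induction k) (auto simp: one mult that)
  have prod: "rel (\<Prod>i\<in>A. b i) (\<Prod>i\<in>A. c i)" if "\<And>i. rel (b i) (c i)" for A :: "'n set" and b c
    by (induction A rule: infinite_finite_induct) (auto simp: one mult that)
  have sum: "rel (\<Sum>i\<in>A. b i) (\<Sum>i\<in>A. c i)" if "\<And>i. rel (b i) (c i)" for A :: "('n \<Rightarrow>\<^sub>0 nat) set" and b c
  proof (induction A rule: infinite_finite_induct)
    case (insert i A)
    then show ?case using that[of i] by (auto simp: rel_def diff_op_add fun_act_def)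
  qed (auto simp: rel_def diff_op_def fun_act_def)
  \<comment> \<open>Writing \<open>a\<close> as \<open>sym_act (mat 1) a\<close> gives both sides
    the same shape, a sum of products of powers, so that the closure rules apply factor by
    factor.\<close>
  have "rel (sym_act g a) (sym_act (mat 1) a)"
    unfolding sym_act_def
    using sym[of "mat 1 *v axis i 1" for i] by (intro sum mult const prod pow) simp
  then show ?thesis using P by (simp add: rel_def sym_act_id)
qed

lemma pairing_equivariant:
  "invertible g \<Longrightarrow> P \<in> polyfuns \<Longrightarrow> pairing (sym_act g a) (fun_act g P) = pairing a P"
  by (simp add: pairing_def diff_op_fun_act)

section \<open>Coefficient conjugation and unitary matrices\<close>

definition conj_mpoly :: "('n::finite) mpoly \<Rightarrow> 'n mpoly" where
  "conj_mpoly p = Poly_Mapping.map cnj p"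

lemma lookup_conj_mpoly [simp]: "Poly_Mapping.lookup (conj_mpoly p) m = cnj (Poly_Mapping.lookup p m)"
  by (simp add: conj_mpoly_def Poly_Mapping.map.rep_eq when_def)

lemma conj_mpoly_conj_mpoly [simp]: "conj_mpoly (conj_mpoly p) = p"
  by (intro poly_mapping_eqI) simp

lemma conj_mpoly_add: "conj_mpoly (p + q) = conj_mpoly p + conj_mpoly q"
  by (intro poly_mapping_eqI) (simp add: lookup_add)

lemma conj_mpoly_zero [simp]: "conj_mpoly 0 = 0"
  by (intro poly_mapping_eqI) simp

lemma keys_conj_mpoly [simp]: "Poly_Mapping.keys (conj_mpoly p) = Poly_Mapping.keys p"
  by (auto simp: in_keys_iff)

lemma peval_conj_mpoly: "peval (conj_mpoly p) x = cnj (peval p (\<chi> i. cnj (x $ i)))"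
  by (simp add: peval_def)

lemma conj_mpoly_mult: "conj_mpoly (p * q) = conj_mpoly p * conj_mpoly q"
proof -
  have "peval (conj_mpoly (p * q)) = peval (conj_mpoly p * conj_mpoly q)"
    by (simp add: peval_mult peval_conj_mpoly fun_eq_iff)
  then show ?thesis by (simp add: peval_eq_iff)
qed

text \<open>The entries of the conjugate transpose times \<open>g\<close> are the Hermitian products
  of the columns of \<open>g\<close>.\<close>

lemma unitary_matrix_inv:
  fixes g :: "complex ^ 'n ^ 'n"
  assumes "is_unitary g"
  shows "invertible g" "matrix_inv g = (\<chi> i j. cnj (g $ j $ i))"
proof -
  let ?A = "\<chi> i j. cnj (g $ j $ i)"
  have col: "(g *v axis j 1) $ i = g $ i $ j" for i j
    by (simp add: matrix_vector_mult_def axis_def if_distrib cong: if_cong)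
  have "(?A ** g) $ k $ j = mat 1 $ k $ j" for k j
  proof -
    have "(?A ** g) $ k $ j = hermitian_form (g *v axis j 1) (g *v axis k 1)"
      by (simp add: matrix_matrix_mult_def hermitian_form_def col mult.commute)
    also have "\<dots> = hermitian_form (axis j 1) (axis k 1)"
      using assms by (simp add: is_unitary_def)
    also have "\<dots> = (\<Sum>i\<in>UNIV. if i = j then (if k = j then 1 else 0) else 0)"
      unfolding hermitian_form_def by (intro sum.cong) (auto simp: axis_def)
    also have "\<dots> = mat 1 $ k $ j" by (simp add: mat_def)
    finally show ?thesis .
  qed
  then have 1: "?A ** g = mat 1" by (simp add: vec_eq_iff)
  then have 2: "g ** ?A = mat 1" using matrix_left_right_inverse by blast
  show "invertible g" using 1 2 unfolding invertible_def by blast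
  show "matrix_inv g = ?A" using 1 2 by (intro matrix_inv_unique)
qed

text \<open>For unitary \<open>g\<close> the conjugate of the transpose is the inverse. Conjugating
  coefficients thus intertwines the action on the symmetric algebra with the contragredient action
  on polynomial functions.\<close>

lemma peval_conj_sym_act:
  fixes g :: "complex ^ 'n ^ 'n"
  assumes "is_unitary g"
  shows "peval (conj_mpoly (sym_act g a)) = fun_act g (peval (conj_mpoly a))"
proof -
  have "transpose g *v (\<chi> i. cnj (x $ i)) = (\<chi> i. cnj ((matrix_inv g *v x) $ i))" for x
    by (simp add: vec_eq_iff matrix_vector_mult_def transpose_def unitary_matrix_inv[OF assms])
  then show ?thesis
    by (simp add: fun_eq_iff fun_act_def peval_conj_mpoly peval_sym_act)
qed

section \<open>The Hermitian form on polynomial functions\<close>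

definition dual_mpoly :: "(complex ^ 'n \<Rightarrow> complex) \<Rightarrow> ('n::finite) mpoly" where
  "dual_mpoly P = conj_mpoly (mpoly_of P)"

text \<open>This is the Fischer inner product, in which monomials are orthogonal with squared norm
  \<open>mfact m\<close>.\<close>

definition herm :: "(complex ^ 'n \<Rightarrow> complex) \<Rightarrow> (complex ^ 'n \<Rightarrow> complex) \<Rightarrow> complex" where
  "herm P Q = pairing (dual_mpoly Q) P"

text \<open>A superset \<open>K\<close> of the keys is allowed so that the two orders of the
  arguments can be compared over one index set.\<close>

lemma herm_peval:
  assumes "finite K" "Poly_Mapping.keys q \<subseteq> K"
  shows "herm (peval p) (peval q) =
    (\<Sum>m\<in>K. cnj (Poly_Mapping.lookup q m) * (mfact m * Poly_Mapping.lookup p m))"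
  unfolding herm_def dual_mpoly_def mpoly_of_peval pairing_peval
  using keys_sum_superset[of K "conj_mpoly q" "\<lambda>m c. c * (mfact m * Poly_Mapping.lookup p m)"] assms
  by simp

lemma herm_sym:
  assumes "P \<in> polyfuns" "Q \<in> polyfuns"
  shows "herm Q P = cnj (herm P Q)"
proof -
  obtain p q where [simp]: "P = peval p" "Q = peval q" using assms by (auto simp: polyfuns_def)
  let ?K = "Poly_Mapping.keys p \<union> Poly_Mapping.keys q"
  have "cnj (mfact m) = mfact m" for m :: "'a \<Rightarrow>\<^sub>0 nat" by (simp add: mfact_def)
  then show ?thesis
    by (simp add: herm_peval[of ?K q p] herm_peval[of ?K p q] mult_ac)
qed

lemma herm_add_left:
  assumes "P \<in> polyfuns" "P' \<in> polyfuns" "Q \<in> polyfuns"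
  shows "herm (P + P') Q = herm P Q + herm P' Q"
proof -
  obtain p p' q where [simp]: "P = peval p" "P' = peval p'" "Q = peval q" using assms by (auto simp: polyfuns_def)
  show ?thesis
    by (simp add: herm_peval[OF finite_keys order_refl] lookup_add algebra_simps sum.distrib flip: peval_plus)
qed

lemma herm_scale_left:
  assumes "P \<in> polyfuns" "Q \<in> polyfuns"
  shows "herm (fun_scale c P) Q = c * herm P Q"
proof -
  obtain p q where [simp]: "P = peval p" "Q = peval q" using assms by (auto simp: polyfuns_def)
  show ?thesis
    by (simp add: herm_peval[OF finite_keys order_refl] sum_distrib_left algebra_simps flip: peval_fun_scale)
qed

lemma herm_add_right:
  "P \<in> polyfuns \<Longrightarrow> Q \<in> polyfuns \<Longrightarrow> Q' \<in> polyfuns \<Longrightarrow> herm P (Q + Q') = herm P Q + herm P Q'"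
  using herm_sym[of "Q + Q'" P] herm_sym[of Q P] herm_sym[of Q' P]
  by (simp add: herm_add_left polyfuns_add)

lemma herm_scale_right:
  "P \<in> polyfuns \<Longrightarrow> Q \<in> polyfuns \<Longrightarrow> herm P (fun_scale c Q) = cnj c * herm P Q"
  using herm_sym[of "fun_scale c Q" P] herm_sym[of Q P]
  by (simp add: herm_scale_left polyfuns_scale)

lemma herm_zero_right [simp]: "P \<in> polyfuns \<Longrightarrow> herm P 0 = 0"
  using herm_scale_right[of P 0 0] by simp

lemma herm_diff_left:
  assumes "P \<in> polyfuns" "P' \<in> polyfuns" "Q \<in> polyfuns"
  shows "herm (P - P') Q = herm P Q - herm P' Q"
  using herm_add_left[of "P - P'" P' Q] assms by (simp add: polyfuns_diff)

lemma herm_pos_def: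
  assumes "P \<in> polyfuns" "herm P P = 0"
  shows "P = 0"
proof -
  obtain p where p [simp]: "P = peval p" using assms by (auto simp: polyfuns_def)
  \<comment> \<open>The value on the diagonal is a sum of these nonnegative reals, so each of them
    must vanish.\<close>
  define r where "r m = (\<Prod>i\<in>UNIV. fact (Poly_Mapping.lookup m i)) * (cmod (Poly_Mapping.lookup p m))\<^sup>2"
    for m :: "'a \<Rightarrow>\<^sub>0 nat"
  have "herm P P = (\<Sum>m\<in>Poly_Mapping.keys p. of_real (r m))"
    unfolding p herm_peval[OF finite_keys order_refl]
  proof (intro sum.cong refl)
    fix m
    have "cnj (Poly_Mapping.lookup p m) * Poly_Mapping.lookup p m = of_real ((cmod (Poly_Mapping.lookup p m))\<^sup>2)"
      by (metis complex_norm_square mult.commute)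
    then show "cnj (Poly_Mapping.lookup p m) * (mfact m * Poly_Mapping.lookup p m) = of_real (r m)"
      by (simp add: r_def mfact_def mult.left_commute)
  qed
  then have "(\<Sum>m\<in>Poly_Mapping.keys p. r m) = 0"
    using assms(2) by (metis of_real_eq_0_iff of_real_sum)
  then have "r m = 0" if "m \<in> Poly_Mapping.keys p" for m
    using that by (subst (asm) sum_nonneg_eq_0_iff) (auto simp: r_def intro!: mult_nonneg_nonneg prod_nonneg)
  then have "Poly_Mapping.keys p = {}"
    by (fastforce simp: r_def in_keys_iff)
  then show ?thesis by simp
qed

lemma herm_different_degree:
  assumes "P \<in> polyfun_deg d" "Q \<in> polyfun_deg e" "d \<noteq> e"
  shows "herm P Q = 0"
proof -
  from assms obtain p q where *: "P = peval p" "Q = peval q"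
    "\<forall>m\<in>Poly_Mapping.keys p. mdeg m = d" "\<forall>m\<in>Poly_Mapping.keys q. mdeg m = e"
    by (auto simp: polyfun_deg_def)
  have "Poly_Mapping.lookup p m = 0" if "m \<in> Poly_Mapping.keys q" for m
  proof -
    have "m \<notin> Poly_Mapping.keys p" using *(3,4) assms(3) that by metis
    then show ?thesis by (simp add: in_keys_iff)
  qed
  then show ?thesis by (simp add: * herm_peval[OF finite_keys order_refl])
qed

text \<open>Different degrees are orthogonal. Orthogonality of a homogeneous polynomial to a graded
  subspace thus becomes a question inside one finite-dimensional degree.\<close>

lemma herm_part:
  assumes "P \<in> polyfun_deg d" "Q \<in> polyfuns"
  shows "herm P Q = herm P (hom_part d Q)"
  using assms(2)
proof (rule polyfuns_induct[where Pr = "\<lambda>Q. herm P Q = herm P (hom_part d Q)"])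
  fix e and Q :: "complex ^ 'a \<Rightarrow> complex" assume "Q \<in> polyfun_deg e"
  then show "herm P Q = herm P (hom_part d Q)"
    using assms(1) herm_different_degree[of P d Q e] polyfun_deg_polyfuns[OF assms(1)]
    by (auto simp: hom_part_of_polyfun_deg)
next
  have P: "P \<in> polyfuns" using assms(1) polyfun_deg_polyfuns by blast
  then show "herm P 0 = herm P (hom_part d 0)"
    by (simp add: hom_part_of_polyfun_deg[OF polyfun_deg_zero[of d]])
  fix Q Q' :: "complex ^ 'a \<Rightarrow> complex"
  assume "Q \<in> polyfuns" "Q' \<in> polyfuns" "herm P Q = herm P (hom_part d Q)" "herm P Q' = herm P (hom_part d Q')"
  then show "herm P (Q + Q') = herm P (hom_part d (Q + Q'))"
    using P by (simp add: herm_add_right hom_part_add hom_part_polyfuns)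
qed

section \<open>Orthogonal projection in finite dimension\<close>

lemma orthogonal_span:
  assumes "P \<in> polyfuns" "B \<subseteq> polyfuns" "\<And>b. b \<in> B \<Longrightarrow> herm P b = 0" "Q \<in> fun_vs.span B"
  shows "herm P Q = 0"
proof -
  have "fun_vs.span B \<subseteq> {Q \<in> polyfuns. herm P Q = 0}"
    by (rule fun_vs.span_minimal)
       (use assms in \<open>auto simp: fun_vs.subspace_def polyfuns_add polyfuns_scale herm_add_right herm_scale_right\<close>)
  then show ?thesis using assms(4) by blast
qed

lemma span_polyfuns: "B \<subseteq> polyfuns \<Longrightarrow> fun_vs.span B \<subseteq> polyfuns"
  by (rule fun_vs.span_minimal[OF _ subspace_polyfuns])

text \<open>A Gram-Schmidt step: the new vector \<open>b\<close> is first made orthogonal to the old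
  ones by the induction hypothesis, then the projection is corrected along the result
  \<open>b'\<close>. A finite spanning set suffices as input.\<close>

lemma orthogonal_projection:
  assumes "finite B" "B \<subseteq> polyfuns" "P \<in> polyfuns"
  shows "\<exists>U\<in>fun_vs.span B. \<forall>b\<in>B. herm (P - U) b = 0"
  using assms
proof (induction B arbitrary: P rule: finite_induct)
  case empty
  show ?case by (intro bexI[of _ 0] ballI) (use fun_vs.span_zero in blast)+
next
  case (insert b B)
  then have b: "b \<in> polyfuns" and B: "B \<subseteq> polyfuns" by auto
  obtain U where U: "U \<in> fun_vs.span B" "\<forall>b\<in>B. herm (P - U) b = 0"
    using insert.IH[OF B insert.prems(2)] by blast
  obtain V where V: "V \<in> fun_vs.span B" "\<forall>c\<in>B. herm (b - V) c = 0"
    using insert.IH[OF B b] by blast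
  have S: "U \<in> polyfuns" "V \<in> polyfuns" using U V span_polyfuns[OF B] by auto
  define b' where "b' = b - V"
  \<comment> \<open>If \<open>b'\<close> is zero, \<open>b\<close> was already in the span; division
    by zero then yields \<open>c = 0\<close> and no correction.\<close>
  define c where "c = herm (P - U) b' / herm b' b'"
  define U' where "U' = U + fun_scale c b'"
  have b': "b' \<in> polyfuns" using b S by (simp add: b'_def polyfuns_diff)
  have PU: "P - U \<in> polyfuns" using insert.prems S by (simp add: polyfuns_diff)
  have U': "herm (P - U') Q = herm (P - U) Q - c * herm b' Q" if "Q \<in> polyfuns" for Q
  proof -
    have eq: "P - U' = (P - U) - fun_scale c b'" by (simp add: U'_def)
    show ?thesis unfolding eq using that b' PU by (simp add: herm_diff_left polyfuns_scale herm_scale_left)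
  qed
  have "herm (P - U') x = 0" if "x \<in> B" for x
    using U' U V that B by (auto simp: b'_def)
  moreover have PU': "P - U' \<in> polyfuns"
    using PU b' by (simp add: U'_def polyfuns_diff polyfuns_scale flip: diff_diff_eq)
  ultimately have "herm (P - U') V = 0" using orthogonal_span[OF _ B _ V(1)] by blast
  moreover have "herm (P - U') b' = 0"
    using U'[OF b'] herm_pos_def[OF b'] PU by (cases "herm b' b' = 0") (auto simp: c_def)
  moreover have "b = b' + V" by (simp add: b'_def)
  ultimately have "herm (P - U') b = 0"
    using herm_add_right[OF PU' b' S(2)] by simp
  moreover have "U' \<in> fun_vs.span (insert b B)"
  proof -
    have "U \<in> fun_vs.span (insert b B)" "V \<in> fun_vs.span (insert b B)"
      using U(1) V(1) fun_vs.span_mono[of B "insert b B"] by auto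
    moreover have "b \<in> fun_vs.span (insert b B)" by (simp add: fun_vs.span_base)
    ultimately show ?thesis unfolding U'_def b'_def
      by (intro fun_vs.span_add fun_vs.span_scale fun_vs.span_diff)
  qed
  ultimately show ?case using \<open>\<And>x. x \<in> B \<Longrightarrow> herm (P - U') x = 0\<close> by blast
qed

text \<open>Exponent vectors of total degree \<open>d\<close> have entries bounded by
  \<open>d\<close>, so there are finitely many monomials.\<close>

lemma polyfun_deg_finite_span:
  obtains M where "finite M" "polyfun_deg d \<subseteq> fun_vs.span M"
proof
  let ?E = "{m :: 'a::finite \<Rightarrow>\<^sub>0 nat. mdeg m = d}"
  let ?M = "(\<lambda>m. peval (Poly_Mapping.single m 1)) ` ?E"
  have "Poly_Mapping.lookup m i \<le> d" if "mdeg m = d" for m :: "'a \<Rightarrow>\<^sub>0 nat" and i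
    using that member_le_sum[of i UNIV "Poly_Mapping.lookup m"] by (simp add: mdeg_def)
  then have "Poly_Mapping.lookup ` ?E \<subseteq> (\<Pi>\<^sub>E i\<in>UNIV. {..d})" by auto
  moreover have "finite (\<Pi>\<^sub>E i\<in>(UNIV::'a set). {..d})" by (intro finite_PiE) auto
  ultimately have "finite (Poly_Mapping.lookup ` ?E)" using finite_subset by blast
  then have "finite ?E" 
    by (rule finite_imageD) (simp add: inj_on_def lookup_inject)
  then show "finite ?M" by simp
  show "polyfun_deg d \<subseteq> fun_vs.span ?M"
  proof
    fix P :: "complex ^ 'a \<Rightarrow> complex" assume "P \<in> polyfun_deg d"
    then obtain p where p: "P = peval p" "\<forall>m\<in>Poly_Mapping.keys p. mdeg m = d"
      by (auto simp: polyfun_deg_def)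
    have "P = (\<Sum>m\<in>Poly_Mapping.keys p. fun_scale (Poly_Mapping.lookup p m) (peval (Poly_Mapping.single m 1)))"
      by (simp add: p(1) fun_eq_iff sum_fun_apply peval_single peval_def[of p])
    moreover have "(\<Sum>m\<in>Poly_Mapping.keys p. fun_scale (Poly_Mapping.lookup p m) (peval (Poly_Mapping.single m 1)))
      \<in> fun_vs.span ?M"
      by (intro fun_vs.span_sum fun_vs.span_scale fun_vs.span_base) (use p(2) in blast)
    ultimately show "P \<in> fun_vs.span ?M" by (simp only:)
  qed
qed

lemma subspace_finite_basis:
  assumes "fun_vs.subspace V" "finite M" "V \<subseteq> fun_vs.span M"
  obtains B where "finite B" "B \<subseteq> V" "V = fun_vs.span B"
proof -
  obtain B where B: "B \<subseteq> V" "fun_vs.independent B" "V \<subseteq> fun_vs.span B"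
    using fun_vs.maximal_independent_subset[of V] by blast
  have "finite B"
    using fun_vs.independent_span_bound[OF assms(2) B(2) order_trans[OF B(1) assms(3)]] by blast
  moreover have "V = fun_vs.span B"
    by (rule antisym[OF B(3) fun_vs.span_minimal[OF B(1) assms(1)]])
  ultimately show ?thesis by (rule that[OF _ B(1)])
qed

section \<open>Harmonic polynomials as the orthogonal complement of the Hilbert ideal\<close>

lemma hom_part_zero [simp]: "hom_part d 0 = 0"
  by (simp add: hom_part_of_polyfun_deg[OF polyfun_deg_zero[of d]])

lemma hom_part_mult:
  assumes "P \<in> polyfuns" "Q \<in> polyfuns"
  shows "hom_part d (P * Q) = (\<Sum>i\<le>d. hom_part i P * hom_part (d - i) Q)"
  using assms(1)
proof (rule polyfuns_induct[where Pr = "\<lambda>P. hom_part d (P * Q) = (\<Sum>i\<le>d. hom_part i P * hom_part (d - i) Q)"])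
  fix e and P :: "complex ^ 'a \<Rightarrow> complex" assume P: "P \<in> polyfun_deg e"
  show "hom_part d (P * Q) = (\<Sum>i\<le>d. hom_part i P * hom_part (d - i) Q)"
    using assms(2)
  proof (rule polyfuns_induct[where Pr = "\<lambda>Q. hom_part d (P * Q) = (\<Sum>i\<le>d. hom_part i P * hom_part (d - i) Q)"])
    fix k and Q :: "complex ^ 'a \<Rightarrow> complex" assume Q: "Q \<in> polyfun_deg k"
    have "hom_part i P * hom_part (d - i) Q = (if i = e then (if d - e = k then P * Q else 0) else 0)" for i
      using hom_part_of_polyfun_deg[OF P] hom_part_of_polyfun_deg[OF Q] by auto
    moreover have "hom_part d (P * Q) = (if d = e + k then P * Q else 0)"
      by (rule hom_part_of_polyfun_deg[OF polyfun_deg_mult[OF P Q]])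
    ultimately show "hom_part d (P * Q) = (\<Sum>i\<le>d. hom_part i P * hom_part (d - i) Q)"
      by auto
  next
    show "hom_part d (P * 0) = (\<Sum>i\<le>d. hom_part i P * hom_part (d - i) 0)"
      by simp
  next
    fix Q Q' :: "complex ^ 'a \<Rightarrow> complex"
    assume "Q \<in> polyfuns" "Q' \<in> polyfuns" "hom_part d (P * Q) = (\<Sum>i\<le>d. hom_part i P * hom_part (d - i) Q)"
      "hom_part d (P * Q') = (\<Sum>i\<le>d. hom_part i P * hom_part (d - i) Q')"
    then show "hom_part d (P * (Q + Q')) = (\<Sum>i\<le>d. hom_part i P * hom_part (d - i) (Q + Q'))"
      using polyfun_deg_polyfuns[OF P]
      by (simp add: distrib_left hom_part_add polyfuns_mult sum.distrib)
  qed
next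
  show "hom_part d (0 * Q) = (\<Sum>i\<le>d. hom_part i 0 * hom_part (d - i) Q)"
    by simp
next
  fix P P' :: "complex ^ 'a \<Rightarrow> complex"
  assume "P \<in> polyfuns" "P' \<in> polyfuns" "hom_part d (P * Q) = (\<Sum>i\<le>d. hom_part i P * hom_part (d - i) Q)"
    "hom_part d (P' * Q) = (\<Sum>i\<le>d. hom_part i P' * hom_part (d - i) Q)"
  then show "hom_part d ((P + P') * Q) = (\<Sum>i\<le>d. hom_part i (P + P') * hom_part (d - i) Q)"
    using assms(2) by (simp add: distrib_right hom_part_add polyfuns_mult sum.distrib)
qed

lemma hom_part_at_0:
  assumes "P \<in> polyfuns" "P 0 = 0"
  shows "hom_part d P 0 = 0"
proof -
  obtain p where "P = peval p" using assms by (auto simp: polyfuns_def)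
  then show ?thesis using assms(2) by (simp add: hom_part_def peval_at_0 lookup_mpoly_part)
qed

text \<open>The homogeneous parts of an invariant vanishing at the origin are again such invariants,
  so the ideal is graded.\<close>

lemma hom_part_hilbert_ideal:
  fixes G :: "(complex ^ 'n ^ 'n) set"
  assumes "P \<in> hilbert_ideal G"
  shows "hom_part d P \<in> hilbert_ideal G"
  using assms
proof (rule hilbert_ideal.induct[where P = "\<lambda>P. P \<in> hilbert_ideal G \<and> hom_part d P \<in> hilbert_ideal G", THEN conjunct2])
  fix P f Q :: "complex ^ 'n \<Rightarrow> complex"
  assume *: "P \<in> hilbert_ideal G \<and> hom_part d P \<in> hilbert_ideal G" "f \<in> poly_invariants G" "f 0 = 0" "Q \<in> polyfuns"
  then have f: "f \<in> polyfuns" using invariants_polyfuns by blast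
  have "hom_part i f * hom_part (d - i) Q \<in> hilbert_ideal G" for i
    using * f by (intro hilbert_ideal_gen hom_part_invariants hom_part_at_0 hom_part_polyfuns)
  then have "hom_part d (f * Q) \<in> hilbert_ideal G"
    unfolding hom_part_mult[OF f *(4)] by (rule hilbert_ideal_sum)
  then show "P + f * Q \<in> hilbert_ideal G \<and> hom_part d (P + f * Q) \<in> hilbert_ideal G"
    using * f hilbert_ideal_polyfuns[of P G]
    by (simp add: hom_part_add polyfuns_mult hilbert_ideal_add hilbert_ideal.step)
qed (simp add: hilbert_ideal.zero)

lemma module_mpoly: "module ((*) :: 'n::finite mpoly \<Rightarrow> _)"
  by unfold_locales (auto simp: algebra_simps)

text \<open>Both conjugates are demanded, so that the notion passes to the inverse of
  \<open>n\<close> by symmetry.\<close>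

definition normalizes :: "complex ^ 'n ^ 'n \<Rightarrow> (complex ^ 'n ^ 'n) set \<Rightarrow> bool" where
  "normalizes n G \<longleftrightarrow> invertible n \<and> (\<forall>g\<in>G. matrix_inv n ** g ** n \<in> G \<and> n ** g ** matrix_inv n \<in> G)"

lemma normalizes_matrix_inv: "normalizes n G \<Longrightarrow> normalizes (matrix_inv n) G"
  by (auto simp: normalizes_def invertible_matrix_inv matrix_inv_matrix_inv)

lemma conjugate_swap:
  fixes n g :: "complex ^ 'n ^ 'n"
  assumes "invertible n"
  shows "g ** n = n ** (matrix_inv n ** g ** n)"
  by (simp add: matrix_mul_assoc matrix_inv_simps assms)

lemma dual_mpoly_invariants_iff:
  fixes P :: "complex ^ 'n \<Rightarrow> complex"
  assumes "\<And>g. g \<in> G \<Longrightarrow> is_unitary g" "P \<in> polyfuns"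
  shows "dual_mpoly P \<in> sym_invariants G \<longleftrightarrow> P \<in> poly_invariants G"
proof -
  have "sym_act g (dual_mpoly P) = dual_mpoly P \<longleftrightarrow> fun_act g P = P" if "g \<in> G" for g
  proof -
    have "sym_act g (dual_mpoly P) = dual_mpoly P \<longleftrightarrow>
        conj_mpoly (sym_act g (dual_mpoly P)) = conj_mpoly (dual_mpoly P)"
      by (metis conj_mpoly_conj_mpoly)
    also have "\<dots> \<longleftrightarrow> peval (conj_mpoly (sym_act g (dual_mpoly P))) = peval (conj_mpoly (dual_mpoly P))"
      by (simp add: peval_eq_iff)
    also have "\<dots> \<longleftrightarrow> fun_act g P = P"
      using assms that by (simp add: peval_conj_sym_act) (simp add: dual_mpoly_def)
    finally show ?thesis .
  qed
  then show ?thesis using assms(2) by (auto simp: sym_invariants_def poly_invariants_def)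
qed

lemma lookup_dual_mpoly_0: "P \<in> polyfuns \<Longrightarrow> Poly_Mapping.lookup (dual_mpoly P) 0 = cnj (P 0)"
  by (auto simp: polyfuns_def dual_mpoly_def peval_at_0)

lemma dual_mpoly_add:
  "P \<in> polyfuns \<Longrightarrow> Q \<in> polyfuns \<Longrightarrow> dual_mpoly (P + Q) = dual_mpoly P + dual_mpoly Q"
  by (auto simp: polyfuns_def dual_mpoly_def conj_mpoly_add simp flip: peval_plus)

lemma dual_mpoly_mult:
  "P \<in> polyfuns \<Longrightarrow> Q \<in> polyfuns \<Longrightarrow> dual_mpoly (P * Q) = dual_mpoly P * dual_mpoly Q"
  by (auto simp: polyfuns_def dual_mpoly_def conj_mpoly_mult simp flip: peval_mult)

lemma dual_mpoly_zero: "dual_mpoly 0 = 0"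
  unfolding dual_mpoly_def by (metis conj_mpoly_zero mpoly_of_peval peval_zero)

lemma dual_mpoly_surj: "\<exists>P\<in>polyfuns. a = dual_mpoly P"
  by (intro bexI[of _ "peval (conj_mpoly a)"]) (auto simp: dual_mpoly_def)

locale finite_unitary_group = finite_linear_group G for G :: "(complex ^ 'n ^ 'n) set" +
  assumes unitary: "\<And>g. g \<in> G \<Longrightarrow> is_unitary g"
begin

text \<open>\<open>dual_mpoly\<close> is additive, multiplicative and onto, and for unitary
  \<open>G\<close> it matches the generators of the two ideals. Harmonicity thereby becomes
  orthogonality to the Hilbert ideal.\<close>

lemma harmonic_ideal_dual: "harmonic_ideal G = dual_mpoly ` hilbert_ideal G"
proof (intro equalityI subsetI)
  fix a assume "a \<in> harmonic_ideal G"
  then have "a \<in> module.span (*) {a \<in> sym_invariants G. Poly_Mapping.lookup a 0 = 0}"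
    by (simp add: harmonic_ideal_def)
  then show "a \<in> dual_mpoly ` hilbert_ideal G"
  proof (induction rule: module.span_induct_alt[OF module_mpoly, consumes 1])
    case 1
    show ?case using hilbert_ideal.zero dual_mpoly_zero by (metis image_eqI)
  next
    case (2 c x y)
    obtain Q where Q: "Q \<in> hilbert_ideal G" "y = dual_mpoly Q" using 2 by blast
    obtain f where f: "f \<in> polyfuns" "x = dual_mpoly f" using dual_mpoly_surj by blast
    obtain C where C: "C \<in> polyfuns" "c = dual_mpoly C" using dual_mpoly_surj by blast
    have "f \<in> poly_invariants G" "f 0 = 0"
      using 2(1) f dual_mpoly_invariants_iff[OF unitary f(1)] by (auto simp: lookup_dual_mpoly_0)
    then have "Q + f * C \<in> hilbert_ideal G" using Q C by (intro hilbert_ideal.step)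
    moreover have "c * x + y = dual_mpoly (Q + f * C)"
      using Q C f hilbert_ideal_polyfuns[OF Q(1)]
      by (simp add: dual_mpoly_add dual_mpoly_mult polyfuns_mult algebra_simps)
    ultimately show ?case by blast
  qed
next
  fix a assume "a \<in> dual_mpoly ` hilbert_ideal G"
  then obtain P where P: "P \<in> hilbert_ideal G" "a = dual_mpoly P" by blast
  interpret M: module "(*) :: 'n mpoly \<Rightarrow> _" by (rule module_mpoly)
  from P(1) have "P \<in> polyfuns \<and> dual_mpoly P \<in> harmonic_ideal G"
  proof (rule hilbert_ideal.induct[where P = "\<lambda>P. P \<in> polyfuns \<and> dual_mpoly P \<in> harmonic_ideal G"])
    fix P f Q :: "complex ^ 'n \<Rightarrow> complex"
    assume *: "P \<in> polyfuns \<and> dual_mpoly P \<in> harmonic_ideal G" "f \<in> poly_invariants G" "f 0 = 0" "Q \<in> polyfuns"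
    then have f: "f \<in> polyfuns" using invariants_polyfuns by blast
    have "dual_mpoly f \<in> {a \<in> sym_invariants G. Poly_Mapping.lookup a 0 = 0}"
      using * f dual_mpoly_invariants_iff[OF unitary f] by (simp add: lookup_dual_mpoly_0)
    then have "dual_mpoly Q * dual_mpoly f \<in> harmonic_ideal G"
      unfolding harmonic_ideal_def by (intro M.span_scale M.span_base)
    then have "dual_mpoly P + dual_mpoly Q * dual_mpoly f \<in> harmonic_ideal G"
      using * unfolding harmonic_ideal_def by (intro M.span_add) auto
    then show "P + f * Q \<in> polyfuns \<and> dual_mpoly (P + f * Q) \<in> harmonic_ideal G"
      using * f by (simp add: polyfuns_add polyfuns_mult dual_mpoly_add dual_mpoly_mult mult.commute)
  qed (simp add: dual_mpoly_zero harmonic_ideal_def M.span_zero)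
  then show "a \<in> harmonic_ideal G" using P by simp
qed

lemma harmonics_herm: "harmonics G = {P \<in> polyfuns. \<forall>Q\<in>hilbert_ideal G. herm P Q = 0}"
  by (auto simp: harmonics_def harmonic_ideal_dual herm_def)

lemma harmonics_polyfuns: "P \<in> harmonics G \<Longrightarrow> P \<in> polyfuns"
  by (simp add: harmonics_def)

lemma subspace_harmonics: "fun_vs.subspace (harmonics G)"
proof -
  have "herm 0 Q = 0" if "Q \<in> hilbert_ideal G" for Q
    using herm_scale_left[of 0 Q 0] hilbert_ideal_polyfuns[OF that] by simp
  then show ?thesis unfolding harmonics_herm
    by (auto simp: fun_vs.subspace_def polyfuns_add polyfuns_scale herm_add_left herm_scale_left
        hilbert_ideal_polyfuns)
qed

lemma harmonics_hilbert_ideal: "P \<in> harmonics G \<Longrightarrow> P \<in> hilbert_ideal G \<Longrightarrow> P = 0"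
  using herm_pos_def by (auto simp: harmonics_herm)

text \<open>The projection is made onto the degree \<open>d\<close> part of the ideal, which is
  finite-dimensional. Orthogonality to the whole ideal follows since the ideal is graded and other
  degrees are orthogonal anyway.\<close>

lemma harmonic_decomposition_deg:
  assumes P: "P \<in> polyfun_deg d"
  shows "\<exists>U\<in>hilbert_ideal G \<inter> polyfun_deg d. P - U \<in> harmonics G"
proof -
  obtain M :: "(complex ^ 'n \<Rightarrow> complex) set" where M: "finite M" "polyfun_deg d \<subseteq> fun_vs.span M"
    by (rule polyfun_deg_finite_span)
  have "fun_vs.subspace (hilbert_ideal G \<inter> polyfun_deg d)"
    by (intro fun_vs.subspace_inter subspace_hilbert_ideal subspace_polyfun_deg)
  moreover have "hilbert_ideal G \<inter> polyfun_deg d \<subseteq> fun_vs.span M" using M by blast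
  ultimately obtain B where B: "finite B" "B \<subseteq> hilbert_ideal G \<inter> polyfun_deg d"
    "hilbert_ideal G \<inter> polyfun_deg d = fun_vs.span B"
    using subspace_finite_basis[OF _ M(1)] by blast
  have BS: "B \<subseteq> polyfuns" using B hilbert_ideal_polyfuns by blast
  have PS: "P \<in> polyfuns" using P polyfun_deg_polyfuns by blast
  obtain U where U: "U \<in> fun_vs.span B" "\<forall>b\<in>B. herm (P - U) b = 0"
    using orthogonal_projection[OF B(1) BS PS] by blast
  have Ud: "U \<in> hilbert_ideal G \<inter> polyfun_deg d" using U B by blast
  have PU: "P - U \<in> polyfun_deg d" using P Ud polyfun_deg_diff by blast
  have "herm (P - U) Q = 0" if Q: "Q \<in> hilbert_ideal G" for Q
  proof -
    have "hom_part d Q \<in> fun_vs.span B"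
      using hom_part_hilbert_ideal[OF Q] hom_part_polyfun_deg B(3) by blast
    then have "herm (P - U) (hom_part d Q) = 0"
      using orthogonal_span[OF _ BS] U(2) polyfun_deg_polyfuns[OF PU] by blast
    then show ?thesis using herm_part[OF PU hilbert_ideal_polyfuns[OF Q]] by simp
  qed
  then have "P - U \<in> harmonics G"
    unfolding harmonics_herm using polyfun_deg_polyfuns[OF PU] by blast
  then show ?thesis using Ud by blast
qed

lemma harmonic_decomposition:
  assumes P: "P \<in> polyfuns"
  shows "\<exists>U\<in>hilbert_ideal G. P - U \<in> harmonics G"
  using assms
proof (rule polyfuns_induct[where Pr = "\<lambda>P. \<exists>U\<in>hilbert_ideal G. P - U \<in> harmonics G"])
  fix d and P :: "complex ^ 'n \<Rightarrow> complex" assume "P \<in> polyfun_deg d"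
  then show "\<exists>U\<in>hilbert_ideal G. P - U \<in> harmonics G" using harmonic_decomposition_deg by blast
next
  show "\<exists>U\<in>hilbert_ideal G. 0 - U \<in> harmonics G"
    using hilbert_ideal.zero fun_vs.subspace_0[OF subspace_harmonics] by (intro bexI[of _ 0]) simp_all
next
  fix P Q :: "complex ^ 'n \<Rightarrow> complex"
  assume "\<exists>U\<in>hilbert_ideal G. P - U \<in> harmonics G" "\<exists>U\<in>hilbert_ideal G. Q - U \<in> harmonics G"
  then obtain U V where UV: "U \<in> hilbert_ideal G" "P - U \<in> harmonics G" "V \<in> hilbert_ideal G" "Q - V \<in> harmonics G"
    by blast
  have "P + Q - (U + V) = (P - U) + (Q - V)" by simp
  then show "\<exists>W\<in>hilbert_ideal G. P + Q - W \<in> harmonics G"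
    using UV hilbert_ideal_add fun_vs.subspace_add[OF subspace_harmonics] by metis
qed

section \<open>Projection onto the harmonics along the Hilbert ideal\<close>

definition harm_proj :: "(complex ^ 'n \<Rightarrow> complex) \<Rightarrow> complex ^ 'n \<Rightarrow> complex" where
  "harm_proj P = (THE H. H \<in> harmonics G \<and> P - H \<in> hilbert_ideal G)"

lemma harm_proj_unique:
  assumes "H \<in> harmonics G" "P - H \<in> hilbert_ideal G"
  shows "harm_proj P = H"
  unfolding harm_proj_def
proof (rule the_equality)
  fix K assume K: "K \<in> harmonics G \<and> P - K \<in> hilbert_ideal G"
  have "(P - H) - (P - K) = K - H" by simp
  then have "K - H \<in> hilbert_ideal G" using hilbert_ideal_diff[OF assms(2)] K by metis
  moreover have "K - H \<in> harmonics G" using K assms fun_vs.subspace_diff[OF subspace_harmonics] by blast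
  ultimately have "K - H = 0" using harmonics_hilbert_ideal by blast
  then show "K = H" by simp
qed (use assms in blast)

lemma harm_proj:
  assumes "P \<in> polyfuns"
  shows "harm_proj P \<in> harmonics G" "P - harm_proj P \<in> hilbert_ideal G"
proof -
  obtain U where U: "U \<in> hilbert_ideal G" "P - U \<in> harmonics G"
    using harmonic_decomposition[OF assms] by blast
  then have "harm_proj P = P - U" by (intro harm_proj_unique) auto
  then show "harm_proj P \<in> harmonics G" "P - harm_proj P \<in> hilbert_ideal G" using U by auto
qed

lemma harm_proj_harmonics: "P \<in> harmonics G \<Longrightarrow> harm_proj P = P"
  by (rule harm_proj_unique) (auto simp: hilbert_ideal.zero)

lemma harm_proj_eq_0_iff:
  assumes "P \<in> polyfuns"
  shows "harm_proj P = 0 \<longleftrightarrow> P \<in> hilbert_ideal G"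
proof
  assume "harm_proj P = 0"
  then show "P \<in> hilbert_ideal G" using harm_proj(2)[OF assms] by simp
next
  assume "P \<in> hilbert_ideal G"
  then show "harm_proj P = 0" using fun_vs.subspace_0[OF subspace_harmonics] by (intro harm_proj_unique) auto
qed

lemma harm_proj_add:
  assumes "P \<in> polyfuns" "Q \<in> polyfuns"
  shows "harm_proj (P + Q) = harm_proj P + harm_proj Q"
proof (rule harm_proj_unique)
  have "P + Q - (harm_proj P + harm_proj Q) = (P - harm_proj P) + (Q - harm_proj Q)" by simp
  then show "P + Q - (harm_proj P + harm_proj Q) \<in> hilbert_ideal G"
    using harm_proj assms hilbert_ideal_add by metis
qed (use harm_proj assms fun_vs.subspace_add[OF subspace_harmonics] in blast)

lemma harm_proj_scale:
  assumes "P \<in> polyfuns"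
  shows "harm_proj (fun_scale c P) = fun_scale c (harm_proj P)"
proof (rule harm_proj_unique)
  have "fun_scale c P - fun_scale c (harm_proj P) = fun_scale c (P - harm_proj P)"
    by (simp add: fun_vs.scale_right_diff_distrib)
  then show "fun_scale c P - fun_scale c (harm_proj P) \<in> hilbert_ideal G"
    using harm_proj(2)[OF assms] hilbert_ideal_scale by metis
qed (use harm_proj assms fun_vs.subspace_scale[OF subspace_harmonics] in blast)

lemma harm_proj_polyfun_deg:
  assumes "P \<in> polyfun_deg d"
  shows "harm_proj P \<in> polyfun_deg d"
proof -
  obtain U where U: "U \<in> hilbert_ideal G" "U \<in> polyfun_deg d" "P - U \<in> harmonics G"
    using harmonic_decomposition_deg[OF assms] by blast
  then have "harm_proj P = P - U" by (intro harm_proj_unique) auto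
  then show ?thesis using U assms polyfun_deg_diff by metis
qed

text \<open>Moving \<open>g\<close> past \<open>n\<close> replaces it by its conjugate
  \<open>matrix_inv n ** g ** n\<close>, which is in \<open>G\<close> and fixes
  \<open>f\<close>.\<close>

lemma invariants_normalizer:
  assumes n: "normalizes n G" and f: "f \<in> poly_invariants G"
  shows "fun_act n f \<in> poly_invariants G"
proof -
  have "fun_act g (fun_act n f) = fun_act n f" if g: "g \<in> G" for g
  proof -
    have inv: "invertible n" "invertible g" and c: "matrix_inv n ** g ** n \<in> G"
      using n g invertible by (auto simp: normalizes_def)
    have "fun_act g (fun_act n f) = fun_act (n ** (matrix_inv n ** g ** n)) f"
      using inv conjugate_swap[of n g] by (simp flip: fun_act_mult)
    also have "\<dots> = fun_act n (fun_act (matrix_inv n ** g ** n) f)"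
      by (rule fun_act_mult[OF inv(1) invertible[OF c]])
    also have "\<dots> = fun_act n f" using f c by (simp add: poly_invariants_def)
    finally show ?thesis .
  qed
  then show ?thesis using f by (auto simp: poly_invariants_def fun_act_polyfuns)
qed

lemma hilbert_ideal_normalizer:
  "normalizes n G \<Longrightarrow> P \<in> hilbert_ideal G \<Longrightarrow> fun_act n P \<in> hilbert_ideal G"
  by (rule hilbert_ideal_fun_act) (auto intro: invariants_normalizer)

lemma harmonic_ideal_normalizer:
  assumes n: "normalizes n G" and a: "a \<in> harmonic_ideal G"
  shows "sym_act n a \<in> harmonic_ideal G"
proof -
  interpret M: module "(*) :: 'n mpoly \<Rightarrow> _" by (rule module_mpoly)
  have gen: "sym_act n x \<in> {a \<in> sym_invariants G. Poly_Mapping.lookup a 0 = 0}"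
    if x: "x \<in> {a \<in> sym_invariants G. Poly_Mapping.lookup a 0 = 0}" for x
  proof -
    have "sym_act g (sym_act n x) = sym_act n x" if g: "g \<in> G" for g
    proof -
      have c: "invertible n" "matrix_inv n ** g ** n \<in> G" using n g by (auto simp: normalizes_def)
      have "sym_act g (sym_act n x) = sym_act n (sym_act (matrix_inv n ** g ** n) x)"
        using conjugate_swap[OF c(1), of g] by (simp add: sym_act_compose)
      then show ?thesis using x c(2) by (simp add: sym_invariants_def)
    qed
    then show ?thesis using x by (simp add: sym_invariants_def lookup_sym_act_0)
  qed
  from a have "a \<in> M.span {a \<in> sym_invariants G. Poly_Mapping.lookup a 0 = 0}"
    by (simp add: harmonic_ideal_def)
  then show ?thesis
  proof (induction rule: M.span_induct_alt)
    case base
    show ?case by (simp add: sym_act_zero harmonic_ideal_def M.span_zero)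
  next
    case (step c x y)
    have "sym_act n c * sym_act n x \<in> harmonic_ideal G"
      unfolding harmonic_ideal_def using gen[OF step(1)] by (intro M.span_scale M.span_base)
    then show ?case
      using step(2) unfolding harmonic_ideal_def sym_act_add sym_act_mult by (rule M.span_add)
  qed
qed

text \<open>Since \<open>n\<close> may fail to be unitary, orthogonality cannot be transported. The
  pairing is invariant under every invertible matrix, and the inverse of \<open>n\<close> preserves
  the harmonic ideal.\<close>

lemma harmonics_normalizer:
  assumes n: "normalizes n G" and P: "P \<in> harmonics G"
  shows "fun_act n P \<in> harmonics G"
proof -
  have inv: "invertible n" using n by (simp add: normalizes_def)
  have "pairing a (fun_act n P) = 0" if a: "a \<in> harmonic_ideal G" for a
  proof -
    have "a = sym_act n (sym_act (matrix_inv n) a)"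
      using inv by (simp add: sym_act_compose matrix_inv_simps sym_act_id)
    then have "pairing a (fun_act n P) = pairing (sym_act (matrix_inv n) a) P"
      using pairing_equivariant[OF inv harmonics_polyfuns[OF P]] by metis
    also have "\<dots> = 0"
      using P harmonic_ideal_normalizer[OF normalizes_matrix_inv[OF n] a] by (simp add: harmonics_def)
    finally show ?thesis .
  qed
  then show ?thesis using P by (simp add: harmonics_def fun_act_polyfuns)
qed

lemma harm_proj_normalizer:
  assumes n: "normalizes n G" and P: "P \<in> polyfuns"
  shows "harm_proj (fun_act n P) = fun_act n (harm_proj P)"
  using harm_proj[OF P] harmonics_normalizer[OF n] hilbert_ideal_normalizer[OF n]
  by (intro harm_proj_unique) (simp_all flip: fun_act_simps)

lemma normalizes_self: "g \<in> G \<Longrightarrow> normalizes g G"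
  by (simp add: normalizes_def mult inverse invertible)

end

section \<open>Linear extensions and tensor products\<close>

text \<open>Tensor representatives are elements of a free vector space on the keys; this is the
  linear map determined by its values on that basis.\<close>

definition lin_ext :: "('k \<Rightarrow> 'b \<Rightarrow> complex) \<Rightarrow> ('k \<Rightarrow>\<^sub>0 complex) \<Rightarrow> 'b \<Rightarrow> complex" where
  "lin_ext \<phi> u = (\<Sum>k\<in>Poly_Mapping.keys u. fun_scale (Poly_Mapping.lookup u k) (\<phi> k))"

lemma lin_ext_add: "lin_ext \<phi> (u + w) = lin_ext \<phi> u + lin_ext \<phi> w"
  unfolding lin_ext_def by (rule keys_sum_add) (auto simp: fun_vs.scale_left_distrib)

lemma lin_ext_single: "lin_ext \<phi> (Poly_Mapping.single k c) = fun_scale c (\<phi> k)"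
  by (simp add: lin_ext_def)

lemma lin_ext_zero [simp]: "lin_ext \<phi> 0 = 0"
  by (simp add: lin_ext_def)

lemma lin_ext_diff: "lin_ext \<phi> (u - w) = lin_ext \<phi> u - lin_ext \<phi> w"
  using lin_ext_add[of \<phi> "u - w" w] by simp

lemma lin_ext_scale: "lin_ext \<phi> (rep_scale c u) = fun_scale c (lin_ext \<phi> u)"
  by (rule poly_mapping_add_induct[where Q = "\<lambda>u. lin_ext \<phi> (rep_scale c u) = fun_scale c (lin_ext \<phi> u)"])
     (simp_all add: rep_scale_single rep_scale_add lin_ext_add lin_ext_single fun_vs.scale_right_distrib)

lemma lin_ext_sum: "lin_ext \<phi> (\<Sum>i\<in>I. F i) = (\<Sum>i\<in>I. lin_ext \<phi> (F i))"
proof (induction I rule: infinite_finite_induct)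
  case (insert i I)
  then show ?case by (simp only: sum.insert simp_thms lin_ext_add)
qed simp_all

lemma rep_as_sum:
  "u = (\<Sum>k\<in>Poly_Mapping.keys u. rep_scale (Poly_Mapping.lookup u k) (Poly_Mapping.single k 1))"
  by (intro poly_mapping_eqI) (auto simp: lookup_sum lookup_single when_def in_keys_iff if_distrib cong: if_cong)

lemma lin_ext_image:
  "lin_ext \<phi> ` {u. Poly_Mapping.keys u \<subseteq> K} = fun_vs.span (\<phi> ` K)"
proof (intro equalityI subsetI)
  fix F assume "F \<in> lin_ext \<phi> ` {u. Poly_Mapping.keys u \<subseteq> K}"
  then obtain u where u: "F = lin_ext \<phi> u" "Poly_Mapping.keys u \<subseteq> K" by blast
  show "F \<in> fun_vs.span (\<phi> ` K)"
    unfolding u(1) lin_ext_def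
    by (intro fun_vs.span_sum fun_vs.span_scale fun_vs.span_base) (use u(2) in blast)
next
  fix F assume "F \<in> fun_vs.span (\<phi> ` K)"
  then show "F \<in> lin_ext \<phi> ` {u. Poly_Mapping.keys u \<subseteq> K}"
  proof (rule subsetD[OF fun_vs.span_minimal, rotated 2])
    have "\<phi> k \<in> lin_ext \<phi> ` {u. Poly_Mapping.keys u \<subseteq> K}" if "k \<in> K" for k
      using that lin_ext_single[of \<phi> k 1] by (intro image_eqI[of _ _ "Poly_Mapping.single k 1"]) auto
    then show "\<phi> ` K \<subseteq> lin_ext \<phi> ` {u. Poly_Mapping.keys u \<subseteq> K}" by blast
    show "fun_vs.subspace (lin_ext \<phi> ` {u. Poly_Mapping.keys u \<subseteq> K})"
      unfolding fun_vs.subspace_def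
    proof (intro conjI ballI allI)
      show "0 \<in> lin_ext \<phi> ` {u. Poly_Mapping.keys u \<subseteq> K}" by (intro image_eqI[of _ _ 0]) auto
    next
      fix F G assume "F \<in> lin_ext \<phi> ` {u. Poly_Mapping.keys u \<subseteq> K}" "G \<in> lin_ext \<phi> ` {u. Poly_Mapping.keys u \<subseteq> K}"
      then obtain u w where "F = lin_ext \<phi> u" "Poly_Mapping.keys u \<subseteq> K" "G = lin_ext \<phi> w" "Poly_Mapping.keys w \<subseteq> K"
        by blast
      then show "F + G \<in> lin_ext \<phi> ` {u. Poly_Mapping.keys u \<subseteq> K}"
        using Poly_Mapping.keys_add[of u w] by (intro image_eqI[of _ _ "u + w"]) (auto simp: lin_ext_add)
    next
      fix c F assume "F \<in> lin_ext \<phi> ` {u. Poly_Mapping.keys u \<subseteq> K}"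
      then obtain u where "F = lin_ext \<phi> u" "Poly_Mapping.keys u \<subseteq> K" by blast
      then show "fun_scale c F \<in> lin_ext \<phi> ` {u. Poly_Mapping.keys u \<subseteq> K}"
        using keys_rep_scale[of c u] by (intro image_eqI[of _ _ "rep_scale c u"]) (auto simp: lin_ext_scale)
    qed
  qed
qed

lemma bilinearity_relations_cases:
  assumes "r \<in> bilinearity_relations A B"
  obtains P P' Q where "P \<in> A" "P' \<in> A" "Q \<in> B" "r = pure_tensor (P + P') Q - pure_tensor P Q - pure_tensor P' Q"
  | P Q Q' where "P \<in> A" "Q \<in> B" "Q' \<in> B" "r = pure_tensor P (Q + Q') - pure_tensor P Q - pure_tensor P Q'"
  | c P Q where "P \<in> A" "Q \<in> B" "r = pure_tensor (fun_scale c P) Q - rep_scale c (pure_tensor P Q)"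
  | c P Q where "P \<in> A" "Q \<in> B" "r = pure_tensor P (fun_scale c Q) - rep_scale c (pure_tensor P Q)"
  using assms unfolding bilinearity_relations_def plus_fun_def fun_scale_def by blast

lemma bilinearity_relationsI:
  "P \<in> A \<Longrightarrow> P' \<in> A \<Longrightarrow> Q \<in> B \<Longrightarrow>
     pure_tensor (P + P') Q - pure_tensor P Q - pure_tensor P' Q \<in> bilinearity_relations A B"
  "P \<in> A \<Longrightarrow> Q \<in> B \<Longrightarrow> Q' \<in> B \<Longrightarrow>
     pure_tensor P (Q + Q') - pure_tensor P Q - pure_tensor P Q' \<in> bilinearity_relations A B"
  "P \<in> A \<Longrightarrow> Q \<in> B \<Longrightarrow>
     pure_tensor (fun_scale c P) Q - rep_scale c (pure_tensor P Q) \<in> bilinearity_relations A B"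
  "P \<in> A \<Longrightarrow> Q \<in> B \<Longrightarrow>
     pure_tensor P (fun_scale c Q) - rep_scale c (pure_tensor P Q) \<in> bilinearity_relations A B"
  unfolding bilinearity_relations_def plus_fun_def fun_scale_def by blast+

text \<open>The easy half of the universal property: a bilinear \<open>\<phi>\<close> kills each
  generating relation, hence their span.\<close>

lemma lin_ext_bilinearity_relations:
  assumes \<phi>: "\<And>P P' Q. \<phi> (P + P', Q) = \<phi> (P, Q) + \<phi> (P', Q)" "\<And>P Q Q'. \<phi> (P, Q + Q') = \<phi> (P, Q) + \<phi> (P, Q')"
    "\<And>c P Q. \<phi> (fun_scale c P, Q) = fun_scale c (\<phi> (P, Q))" "\<And>c P Q. \<phi> (P, fun_scale c Q) = fun_scale c (\<phi> (P, Q))"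
    and u: "u \<in> rep_vs.span (bilinearity_relations A B)"
  shows "lin_ext \<phi> u = 0"
proof -
  have "rep_vs.span (bilinearity_relations A B) \<subseteq> {u. lin_ext \<phi> u = 0}"
  proof (rule rep_vs.span_minimal)
    show "bilinearity_relations A B \<subseteq> {u. lin_ext \<phi> u = 0}"
    proof
      fix r assume "r \<in> bilinearity_relations A B"
      then show "r \<in> {u. lin_ext \<phi> u = 0}"
        by (cases rule: bilinearity_relations_cases)
           (simp_all add: lin_ext_diff lin_ext_single lin_ext_scale \<phi>)
    qed
  qed (simp add: rep_vs.subspace_def lin_ext_add lin_ext_scale)
  then show ?thesis using u by blast
qed

lemma pure_tensor_sum_left:
  assumes A: "fun_vs.subspace A" and B: "fun_vs.subspace B" and "Q \<in> B" "\<And>i. i \<in> I \<Longrightarrow> P i \<in> A"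
  shows "pure_tensor (\<Sum>i\<in>I. fun_scale (c i) (P i)) Q - (\<Sum>i\<in>I. rep_scale (c i) (pure_tensor (P i) Q))
    \<in> rep_vs.span (bilinearity_relations A B)"
proof -
  let ?W = "rep_vs.span (bilinearity_relations A B)"
  \<comment> \<open>The scaling relation with scalar 0 is this tensor itself.\<close>
  have zero: "pure_tensor 0 Q \<in> ?W"
    using rep_vs.span_base[OF bilinearity_relationsI(3)[OF fun_vs.subspace_0[OF A] assms(3), of 0]] by simp
  show ?thesis using assms(4)
  proof (induction I rule: infinite_finite_induct)
    case (insert i I)
    let ?S = "\<Sum>i\<in>I. fun_scale (c i) (P i)" and ?T = "\<Sum>i\<in>I. rep_scale (c i) (pure_tensor (P i) Q)"
    have IH: "pure_tensor ?S Q - ?T \<in> ?W" using insert.IH insert.prems by blast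
    have "P i \<in> A" using insert.prems by blast
    moreover have "?S \<in> A"
      using insert.prems by (intro fun_vs.subspace_sum[OF A] fun_vs.subspace_scale[OF A]) blast
    ultimately have 1: "pure_tensor (fun_scale (c i) (P i) + ?S) Q - pure_tensor (fun_scale (c i) (P i)) Q - pure_tensor ?S Q \<in> ?W"
      "pure_tensor (fun_scale (c i) (P i)) Q - rep_scale (c i) (pure_tensor (P i) Q) \<in> ?W"
      using assms(3) fun_vs.subspace_scale[OF A] by (intro rep_vs.span_base bilinearity_relationsI; blast)+
    have "pure_tensor (fun_scale (c i) (P i) + ?S) Q - (rep_scale (c i) (pure_tensor (P i) Q) + ?T) =
       (pure_tensor (fun_scale (c i) (P i) + ?S) Q - pure_tensor (fun_scale (c i) (P i)) Q - pure_tensor ?S Q) +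
       (pure_tensor (fun_scale (c i) (P i)) Q - rep_scale (c i) (pure_tensor (P i) Q)) + (pure_tensor ?S Q - ?T)"
      by simp
    also have "\<dots> \<in> ?W" using 1 IH by (intro rep_vs.span_add)
    finally show ?case by (simp only: sum.insert[OF insert.hyps])
  qed (use zero in simp_all)
qed

lemma pure_tensor_sum_right:
  assumes A: "fun_vs.subspace A" and B: "fun_vs.subspace B" and "P \<in> A" "\<And>i. i \<in> I \<Longrightarrow> Q i \<in> B"
  shows "pure_tensor P (\<Sum>i\<in>I. fun_scale (c i) (Q i)) - (\<Sum>i\<in>I. rep_scale (c i) (pure_tensor P (Q i)))
    \<in> rep_vs.span (bilinearity_relations A B)"
proof -
  let ?W = "rep_vs.span (bilinearity_relations A B)"
  have zero: "pure_tensor P 0 \<in> ?W"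
    using rep_vs.span_base[OF bilinearity_relationsI(4)[OF assms(3) fun_vs.subspace_0[OF B], of 0]] by simp
  show ?thesis using assms(4)
  proof (induction I rule: infinite_finite_induct)
    case (insert i I)
    let ?S = "\<Sum>i\<in>I. fun_scale (c i) (Q i)" and ?T = "\<Sum>i\<in>I. rep_scale (c i) (pure_tensor P (Q i))"
    have IH: "pure_tensor P ?S - ?T \<in> ?W" using insert.IH insert.prems by blast
    have "Q i \<in> B" using insert.prems by blast
    moreover have "?S \<in> B"
      using insert.prems by (intro fun_vs.subspace_sum[OF B] fun_vs.subspace_scale[OF B]) blast
    ultimately have 1: "pure_tensor P (fun_scale (c i) (Q i) + ?S) - pure_tensor P (fun_scale (c i) (Q i)) - pure_tensor P ?S \<in> ?W"
      "pure_tensor P (fun_scale (c i) (Q i)) - rep_scale (c i) (pure_tensor P (Q i)) \<in> ?W"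
      using assms(3) fun_vs.subspace_scale[OF B] by (intro rep_vs.span_base bilinearity_relationsI; blast)+
    have "pure_tensor P (fun_scale (c i) (Q i) + ?S) - (rep_scale (c i) (pure_tensor P (Q i)) + ?T) =
       (pure_tensor P (fun_scale (c i) (Q i) + ?S) - pure_tensor P (fun_scale (c i) (Q i)) - pure_tensor P ?S) +
       (pure_tensor P (fun_scale (c i) (Q i)) - rep_scale (c i) (pure_tensor P (Q i))) + (pure_tensor P ?S - ?T)"
      by simp
    also have "\<dots> \<in> ?W" using 1 IH by (intro rep_vs.span_add)
    finally show ?case by (simp only: sum.insert[OF insert.hyps])
  qed (use zero in simp_all)
qed

section \<open>Linear functionals and vanishing of tensors\<close>

abbreviation fun_functional :: "(('a \<Rightarrow> complex) \<Rightarrow> complex) \<Rightarrow> bool" where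
  "fun_functional \<equiv> Vector_Spaces.linear fun_scale (*)"

lemma functional_facts:
  assumes "fun_functional l"
  shows "l (P + Q) = l P + l Q" "l (fun_scale c P) = c * l P" "l (\<Sum>i\<in>I. F i) = (\<Sum>i\<in>I. l (F i))"
proof -
  interpret Vector_Spaces.linear fun_scale "(*) :: complex \<Rightarrow> _" l by (rule assms)
  show "l (P + Q) = l P + l Q" "l (fun_scale c P) = c * l P" by (rule add scale)+
  show "l (\<Sum>i\<in>I. F i) = (\<Sum>i\<in>I. l (F i))" by (rule sum)
qed

text \<open>The basis \<open>E\<close> is selected from \<open>F\<close> itself, so it inherits
  membership in any subspace containing \<open>F\<close>. Linear extension gives the coordinate
  functionals, defined on all functions.\<close>

lemma dual_family:
  fixes F :: "('a \<Rightarrow> complex) set"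
  assumes "finite F"
  obtains E l where "finite E" "E \<subseteq> F" "fun_vs.independent E" "\<And>b. fun_functional (l b)"
    "\<And>b b'. b \<in> E \<Longrightarrow> b' \<in> E \<Longrightarrow> l b b' = (if b = b' then 1 else 0)"
    "\<And>P. P \<in> F \<Longrightarrow> P = (\<Sum>b\<in>E. fun_scale (l b P) b)"
proof -
  obtain E where E: "E \<subseteq> F" "fun_vs.independent E" "F \<subseteq> fun_vs.span E"
    using fun_vs.maximal_independent_subset[of F] by blast
  have fin: "finite E" using E(1) assms finite_subset by blast
  interpret cvs: vector_space "(*) :: complex \<Rightarrow> _" by unfold_locales (auto simp: algebra_simps)
  interpret pair: vector_space_pair "fun_scale :: complex \<Rightarrow> ('a \<Rightarrow> complex) \<Rightarrow> _" "(*) :: complex \<Rightarrow> complex \<Rightarrow> complex" ..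
  have "\<exists>l. fun_functional l \<and> (\<forall>b'\<in>E. l b' = (if b = b' then 1 else 0))" for b
    using pair.linear_independent_extend[OF E(2), of "\<lambda>b'. if b = b' then 1 else 0"] by blast
  then obtain l where l: "\<And>b. fun_functional (l b)" "\<And>b b'. b' \<in> E \<Longrightarrow> l b b' = (if b = b' then 1 else 0)"
    by metis
  have expand: "P = (\<Sum>b\<in>E. fun_scale (l b P) b)" if P: "P \<in> F" for P
  proof -
    obtain c where c: "P = (\<Sum>b\<in>E. fun_scale (c b) b)"
      using P E(3) fun_vs.span_finite[OF fin] by blast
    have "l b P = c b" if "b \<in> E" for b
    proof -
      have "l b P = (\<Sum>b'\<in>E. c b' * l b b')" unfolding c by (simp add: functional_facts[OF l(1)])
      also have "\<dots> = (\<Sum>b'\<in>E. if b' = b then c b' else 0)" using l(2) by (intro sum.cong) auto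
      also have "\<dots> = c b" using fin that by simp
      finally show ?thesis .
    qed
    then have "(\<Sum>b\<in>E. fun_scale (l b P) b) = (\<Sum>b\<in>E. fun_scale (c b) b)" by (intro sum.cong) auto
    then show ?thesis using c by metis
  qed
  show ?thesis by (rule that[OF fin E(1,2) l(1)]) (use l(2) expand in blast)+
qed

text \<open>Contractions of the first factor detect zero. With first factors expanded in a basis
  \<open>E\<close>, \<open>u\<close> is congruent to a sum of \<open>b \<otimes> Q\<^sub>b\<close>,
  where \<open>Q\<^sub>b\<close> is the contraction of \<open>u\<close> with the coordinate
  functional of \<open>b\<close> and hence zero.\<close>

lemma tensor_kernel:
  fixes u :: "('a, 'b) tensor_rep"
  assumes A: "fun_vs.subspace A" and B: "fun_vs.subspace B" and u: "u \<in> tensor_reps A B"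
    and l: "\<And>l. fun_functional l \<Longrightarrow> lin_ext (\<lambda>(P, Q). fun_scale (l P) Q) u = 0"
  shows "u \<in> rep_vs.span (bilinearity_relations A B)"
proof -
  let ?W = "rep_vs.span (bilinearity_relations A B)"
  let ?K = "Poly_Mapping.keys u" and ?u = "Poly_Mapping.lookup u"
  have K: "fst k \<in> A" "snd k \<in> B" if "k \<in> ?K" for k
    using u that by (auto simp: tensor_reps_def)
  have "finite (fst ` ?K)" by simp
  then obtain E l where "finite E" "E \<subseteq> fst ` ?K" "fun_vs.independent E"
    "\<And>b. fun_functional (l b)" "\<And>b b'. b \<in> E \<Longrightarrow> b' \<in> E \<Longrightarrow> l b b' = (if b = b' then 1 else 0)"
    "\<And>P. P \<in> fst ` ?K \<Longrightarrow> P = (\<Sum>b\<in>E. fun_scale (l b P) b)"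
    by (rule dual_family) blast
  note E = this(1,2,4,6)
  have EA: "b \<in> A" if "b \<in> E" for b using E(2) K that by auto
  have 1: "Poly_Mapping.single k 1 - (\<Sum>b\<in>E. rep_scale (l b (fst k)) (pure_tensor b (snd k))) \<in> ?W" if "k \<in> ?K" for k
  proof -
    have "fst k = (\<Sum>b\<in>E. fun_scale (l b (fst k)) b)" using E(4) that by blast
    then have "Poly_Mapping.single k 1 = pure_tensor (\<Sum>b\<in>E. fun_scale (l b (fst k)) b) (snd k)"
      by (metis prod.collapse)
    then show ?thesis using pure_tensor_sum_left[OF A B K(2)[OF that], where I = E and P = "\<lambda>b. b" and c = "\<lambda>b. l b (fst k)"] EA by simp
  qed
  have "(\<Sum>k\<in>?K. rep_scale (?u k) (Poly_Mapping.single k 1 - (\<Sum>b\<in>E. rep_scale (l b (fst k)) (pure_tensor b (snd k))))) \<in> ?W"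
    using 1 by (intro rep_vs.span_sum rep_vs.span_scale)
  then have "u - (\<Sum>k\<in>?K. rep_scale (?u k) (\<Sum>b\<in>E. rep_scale (l b (fst k)) (pure_tensor b (snd k)))) \<in> ?W"
    using rep_as_sum[of u] by (simp add: rep_vs.scale_right_diff_distrib sum_subtractf)
  also have "(\<Sum>k\<in>?K. rep_scale (?u k) (\<Sum>b\<in>E. rep_scale (l b (fst k)) (pure_tensor b (snd k)))) =
      (\<Sum>b\<in>E. \<Sum>k\<in>?K. rep_scale (?u k * l b (fst k)) (pure_tensor b (snd k)))"
    by (subst sum.swap) (simp add: rep_vs.scale_sum_right)
  finally have 2: "u - (\<Sum>b\<in>E. \<Sum>k\<in>?K. rep_scale (?u k * l b (fst k)) (pure_tensor b (snd k))) \<in> ?W" .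
  have "(\<Sum>k\<in>?K. rep_scale (?u k * l b (fst k)) (pure_tensor b (snd k))) \<in> ?W" if b: "b \<in> E" for b
  proof -
    have "(\<Sum>k\<in>?K. fun_scale (?u k * l b (fst k)) (snd k)) = lin_ext (\<lambda>(P, Q). fun_scale (l b P) Q) u"
      by (simp add: lin_ext_def case_prod_beta)
    then have zero: "(\<Sum>k\<in>?K. fun_scale (?u k * l b (fst k)) (snd k)) = 0" using l E(3) by simp
    have "pure_tensor b (\<Sum>k\<in>?K. fun_scale (?u k * l b (fst k)) (snd k)) - (\<Sum>k\<in>?K. rep_scale (?u k * l b (fst k)) (pure_tensor b (snd k))) \<in> ?W"
      by (rule pure_tensor_sum_right[OF A B EA[OF b] K(2)])
    moreover have "pure_tensor b (0 :: 'b \<Rightarrow> complex) \<in> ?W"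
      using pure_tensor_sum_right[OF A B EA[OF b], where I = "{}"] by simp
    ultimately show ?thesis unfolding zero using rep_vs.span_diff by fastforce
  qed
  then have "(\<Sum>b\<in>E. \<Sum>k\<in>?K. rep_scale (?u k * l b (fst k)) (pure_tensor b (snd k))) \<in> ?W"
    by (rule rep_vs.span_sum)
  from rep_vs.span_add[OF 2 this] show ?thesis by simp
qed

section \<open>The isomorphism\<close>

lemma tensor_reps_diff: "u \<in> tensor_reps A B \<Longrightarrow> w \<in> tensor_reps A B \<Longrightarrow> u - w \<in> tensor_reps A B"
  using keys_diff[of u w] by (auto simp: tensor_reps_def)

lemma tensor_reps_add: "u \<in> tensor_reps A B \<Longrightarrow> w \<in> tensor_reps A B \<Longrightarrow> u + w \<in> tensor_reps A B"
  using Poly_Mapping.keys_add[of u w] by (auto simp: tensor_reps_def)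

lemma tensor_reps_scale: "u \<in> tensor_reps A B \<Longrightarrow> rep_scale c u \<in> tensor_reps A B"
  using keys_rep_scale[of c u] by (auto simp: tensor_reps_def)

text \<open>All the handling of equivalence classes is done here: a linear map \<open>\<Phi>\<close>
  on representatives whose kernel is exactly the relations induces the required map on the
  quotient.\<close>

lemma graded_module_iso_exists:
  fixes A B :: "(complex ^ 'n \<Rightarrow> complex) set"
  assumes add: "\<And>u w. u \<in> tensor_reps A B \<Longrightarrow> w \<in> tensor_reps A B \<Longrightarrow> \<Phi> (u + w) = \<Phi> u + \<Phi> w"
    and scale: "\<And>c u. u \<in> tensor_reps A B \<Longrightarrow> \<Phi> (rep_scale c u) = fun_scale c (\<Phi> u)"
    and ker: "\<And>u. u \<in> tensor_reps A B \<Longrightarrow> \<Phi> u = 0 \<longleftrightarrow> u \<in> rep_vs.span (bilinearity_relations A B)"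
    and image: "\<Phi> ` tensor_reps A B = C"
    and act: "\<And>n u. n \<in> N \<Longrightarrow> u \<in> tensor_reps A B \<Longrightarrow>
      rep_act n u \<in> tensor_reps A B \<and> \<Phi> (rep_act n u) = fun_act n (\<Phi> u)"
    and deg: "\<And>d. \<Phi> ` {u. Poly_Mapping.keys u \<subseteq>
       (\<Union>i\<le>d. (A \<inter> polyfun_deg i) \<times> (B \<inter> polyfun_deg (d - i)))} = C \<inter> polyfun_deg d"
  shows "\<exists>\<xi>. graded_module_iso N A B C \<xi>"
proof -
  let ?T = "tensor_reps A B"
  define cl where "cl u = tensor_equiv A B `` {u}" for u
  have "(u, w) \<in> tensor_equiv A B \<longleftrightarrow> u \<in> ?T \<and> w \<in> ?T \<and> \<Phi> u = \<Phi> w" for u w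
  proof -
    have "\<Phi> (u - w) = \<Phi> u - \<Phi> w" if "u \<in> ?T" "w \<in> ?T"
      using add[OF tensor_reps_diff[OF that] that(2)] by (simp add: eq_diff_eq)
    then show ?thesis
      using ker[of "u - w"] tensor_reps_diff[of u A B w] by (auto simp: tensor_equiv_def)
  qed
  \<comment> \<open>Classes are the fibres of \<open>\<Phi>\<close>, so independence of
    representatives becomes equality of values.\<close>
  then have cl: "cl u = {w \<in> ?T. \<Phi> w = \<Phi> u}" if "u \<in> ?T" for u
    using that by (auto simp: cl_def)
  have prod: "tensor_prod A B = cl ` ?T"
    by (auto simp: tensor_prod_def quotient_def cl_def)
  define \<xi> where "\<xi> X = \<Phi> (SOME u. u \<in> X)" for X
  have xi: "\<xi> (cl u) = \<Phi> u" if "u \<in> ?T" for u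
  proof -
    have "u \<in> cl u" using that cl by blast
    then have "(SOME w. w \<in> cl u) \<in> cl u" by (rule someI)
    then show ?thesis using cl[OF that] by (simp add: \<xi>_def)
  qed
  have add_cl: "tensor_add A B (cl u) (cl w) = cl (u + w)" if uw: "u \<in> ?T" "w \<in> ?T" for u w
  proof -
    have "cl (u' + w') = cl (u + w)" if "u' \<in> cl u" "w' \<in> cl w" for u' w'
      using that uw by (simp add: cl tensor_reps_add add)
    moreover have "u \<in> cl u" "w \<in> cl w" using uw cl by blast+
    ultimately show ?thesis unfolding tensor_add_def cl_def[of "_ + _", symmetric] by blast
  qed
  have scale_cl: "tensor_scale A B c (cl u) = cl (rep_scale c u)" if u: "u \<in> ?T" for c u
  proof -
    have "cl (rep_scale c u') = cl (rep_scale c u)" if "u' \<in> cl u" for u'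
      using that u by (simp add: cl tensor_reps_scale scale)
    moreover have "u \<in> cl u" using u cl by blast
    ultimately show ?thesis unfolding tensor_scale_def cl_def[of "rep_scale _ _", symmetric] by blast
  qed
  have act_cl: "tensor_act A B n (cl u) = cl (rep_act n u)" if u: "u \<in> ?T" and n: "n \<in> N" for n u
  proof -
    have "cl (rep_act n u') = cl (rep_act n u)" if "u' \<in> cl u" for u'
      using that u act[OF n] by (simp add: cl)
    moreover have "u \<in> cl u" using u cl by blast
    ultimately show ?thesis unfolding tensor_act_def cl_def[of "rep_act _ _", symmetric] by blast
  qed
  have "inj_on \<xi> (tensor_prod A B)"
    unfolding prod
  proof (intro inj_onI, elim imageE)
    fix X Y u w assume "\<xi> X = \<xi> Y" and *: "X = cl u" "Y = cl w" "u \<in> ?T" "w \<in> ?T"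
    then have "\<Phi> u = \<Phi> w" using xi by metis
    then show "X = Y" using * by (simp add: cl)
  qed
  moreover have "\<xi> ` tensor_prod A B = C"
    unfolding prod image_image image[symmetric] by (rule image_cong[OF refl xi])
  ultimately have "bij_betw \<xi> (tensor_prod A B) C" unfolding bij_betw_def by (rule conjI)
  moreover have "\<xi> (tensor_add A B X Y) = (\<lambda>x. \<xi> X x + \<xi> Y x)"
    if XY: "X \<in> tensor_prod A B" "Y \<in> tensor_prod A B" for X Y
  proof -
    obtain u w where "u \<in> ?T" "w \<in> ?T" "X = cl u" "Y = cl w" using XY unfolding prod by blast
    then have "\<xi> (tensor_add A B X Y) = \<xi> X + \<xi> Y"
      by (simp add: add_cl xi tensor_reps_add add)
    then show ?thesis by (simp add: plus_fun_def)
  qed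
  moreover have "\<xi> (tensor_scale A B c X) = (\<lambda>x. c * \<xi> X x)" if X: "X \<in> tensor_prod A B" for c X
  proof -
    obtain u where "u \<in> ?T" "X = cl u" using X unfolding prod by blast
    then have "\<xi> (tensor_scale A B c X) = fun_scale c (\<xi> X)"
      by (simp add: scale_cl xi tensor_reps_scale scale)
    then show ?thesis by (simp add: fun_scale_def)
  qed
  moreover have "tensor_act A B n X \<in> tensor_prod A B \<and> \<xi> (tensor_act A B n X) = fun_act n (\<xi> X)"
    if n: "n \<in> N" and X: "X \<in> tensor_prod A B" for n X
  proof -
    obtain u where "u \<in> ?T" "X = cl u" using X unfolding prod by blast
    then show ?thesis using act[OF n, of u] prod by (simp add: act_cl[OF _ n] xi)
  qed
  moreover have "\<xi> ` tensor_deg A B d = C \<inter> polyfun_deg d" for d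
  proof -
    let ?K = "\<Union>i\<le>d. (A \<inter> polyfun_deg i) \<times> (B \<inter> polyfun_deg (d - i))"
    have "tensor_deg A B d = cl ` {u. Poly_Mapping.keys u \<subseteq> ?K}"
      unfolding tensor_deg_def cl_def by blast
    moreover have "{u. Poly_Mapping.keys u \<subseteq> ?K} \<subseteq> ?T"
      unfolding tensor_reps_def by blast
    ultimately have "\<xi> ` tensor_deg A B d = (\<lambda>u. \<xi> (cl u)) ` {u. Poly_Mapping.keys u \<subseteq> ?K}"
      and "\<And>u. Poly_Mapping.keys u \<subseteq> ?K \<Longrightarrow> \<xi> (cl u) = \<Phi> u"
      using xi by (simp_all only: image_image) blast
    then have "\<xi> ` tensor_deg A B d = \<Phi> ` {u. Poly_Mapping.keys u \<subseteq> ?K}" by simp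
    then show ?thesis by (simp add: deg)
  qed
  ultimately have "graded_module_iso N A B C \<xi>" unfolding graded_module_iso_def by blast
  then show ?thesis by blast
qed

abbreviation pair_mult :: "('a \<Rightarrow> complex) \<times> ('a \<Rightarrow> complex) \<Rightarrow> 'a \<Rightarrow> complex" where
  "pair_mult \<equiv> \<lambda>(P, Q). P * Q"

abbreviation deg_pairs ::
  "(complex ^ 'n \<Rightarrow> complex) set \<Rightarrow> (complex ^ 'n \<Rightarrow> complex) set \<Rightarrow> nat \<Rightarrow>
   ((complex ^ 'n \<Rightarrow> complex) \<times> (complex ^ 'n \<Rightarrow> complex)) set" where
  "deg_pairs A B d \<equiv> (\<Union>i\<le>d. (A \<inter> polyfun_deg i) \<times> (B \<inter> polyfun_deg (d - i)))"

lemma mult_span: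
  assumes "X \<in> fun_vs.span S" "\<And>Y. Y \<in> S \<Longrightarrow> f * Y \<in> fun_vs.span T"
  shows "f * X \<in> fun_vs.span T"
proof -
  have "fun_vs.span S \<subseteq> {X. f * X \<in> fun_vs.span T}"
    by (rule fun_vs.span_minimal)
       (use assms(2) in \<open>auto simp: fun_vs.subspace_def distrib_left fun_vs.span_zero
         intro: fun_vs.span_add fun_vs.span_scale\<close>)
  then show ?thesis using assms(1) by blast
qed

lemma one_invariants: "1 \<in> poly_invariants G"
  using const_invariants[of 1 G] by (simp add: one_fun_def)

context finite_unitary_group
begin

text \<open>Modulo harmonics only the ideal matters, and there each product \<open>f * Q\<close> has
  a factor \<open>Q\<close> of smaller degree, already expressed through harmonics and invariants;
  multiplying by \<open>f\<close> alters only the invariant factors.\<close>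

lemma polyfun_deg_harmonics_invariants:
  "polyfun_deg d \<subseteq> fun_vs.span (pair_mult ` deg_pairs (harmonics G) (poly_invariants G) d)"
proof (induction d rule: less_induct)
  case (less d)
  let ?S = "\<lambda>d. fun_vs.span (pair_mult ` deg_pairs (harmonics G) (poly_invariants G) d)"
  have mult: "f * X \<in> ?S d"
    if f: "f \<in> poly_invariants G" "f \<in> polyfun_deg i" and i: "i \<le> d" and X: "X \<in> ?S (d - i)" for f i X
    using X
  proof (rule mult_span)
    fix Y assume "Y \<in> pair_mult ` deg_pairs (harmonics G) (poly_invariants G) (d - i)"
    then obtain j P g where j: "j \<le> d - i" "P \<in> harmonics G" "P \<in> polyfun_deg j" "g \<in> poly_invariants G"
      "g \<in> polyfun_deg (d - i - j)" "Y = P * g" by auto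
    have "f * g \<in> polyfun_deg (i + (d - i - j))" using f j by (intro polyfun_deg_mult)
    moreover have "i + (d - i - j) = d - j" using i j by simp
    ultimately have "(P, f * g) \<in> deg_pairs (harmonics G) (poly_invariants G) d"
      using f j i by (intro UN_I[of j]) (auto simp: invariants_mult)
    then have "pair_mult (P, f * g) \<in> ?S d" by (intro fun_vs.span_base imageI)
    moreover have "f * Y = pair_mult (P, f * g)" using j(6) by (simp add: mult.left_commute)
    ultimately show "f * Y \<in> ?S d" by metis
  qed
  have ideal: "hom_part d U \<in> ?S d" if "U \<in> hilbert_ideal G" for U
    using that
  proof (rule hilbert_ideal.induct[where P = "\<lambda>U. U \<in> polyfuns \<and> hom_part d U \<in> ?S d", THEN conjunct2])
    show "0 \<in> polyfuns \<and> hom_part d 0 \<in> ?S d" by (simp only: hom_part_zero fun_vs.span_zero polyfuns_zero simp_thms)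
  next
    fix P f Q :: "complex ^ 'n \<Rightarrow> complex"
    assume *: "P \<in> polyfuns \<and> hom_part d P \<in> ?S d" "f \<in> poly_invariants G" "f 0 = 0" "Q \<in> polyfuns"
    then have f: "f \<in> polyfuns" using invariants_polyfuns by blast
    have "hom_part i f * hom_part (d - i) Q \<in> ?S d" if "i \<le> d" for i
    proof (cases "i = 0")
      case True
      \<comment> \<open>Without a constant term in \<open>f\<close>, components of \<open>Q\<close>
        in degree \<open>d\<close> itself never occur.\<close>
      have "hom_part 0 f = 0" using hom_part_0_eq[OF f] *(3) by (simp add: fun_eq_iff)
      then show ?thesis using True fun_vs.span_zero by simp
    next
      case False
      then have "d - i < d" using that by simp
      then have "hom_part (d - i) Q \<in> ?S (d - i)"
        by (rule subsetD[OF less.IH hom_part_polyfun_deg])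
      then show ?thesis by (rule mult[OF hom_part_invariants[OF *(2)] hom_part_polyfun_deg that])
    qed
    then have "hom_part d (f * Q) \<in> ?S d"
      unfolding hom_part_mult[OF f *(4)] by (intro fun_vs.span_sum) simp
    then have "hom_part d (P + f * Q) \<in> ?S d"
      using * f by (simp only: hom_part_add polyfuns_mult fun_vs.span_add simp_thms)
    then show "P + f * Q \<in> polyfuns \<and> hom_part d (P + f * Q) \<in> ?S d"
      using * f polyfuns_add polyfuns_mult by blast
  qed
  show ?case
  proof
    fix P :: "complex ^ 'n \<Rightarrow> complex" assume P: "P \<in> polyfun_deg d"
    obtain U where U: "U \<in> hilbert_ideal G" "U \<in> polyfun_deg d" "P - U \<in> harmonics G"
      using harmonic_decomposition_deg[OF P] by blast
    have "U \<in> ?S d" using ideal[OF U(1)] hom_part_of_polyfun_deg[OF U(2), of d] by simp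
    moreover have "P - U \<in> ?S d"
    proof -
      have "(P - U, 1) \<in> deg_pairs (harmonics G) (poly_invariants G) d"
        using U polyfun_deg_diff[OF P U(2)] one_invariants one_polyfun_deg by (intro UN_I[of d]) auto
      then have "pair_mult (P - U, 1) \<in> ?S d" by (intro fun_vs.span_base imageI)
      then show ?thesis by simp
    qed
    ultimately have "(P - U) + U \<in> ?S d" by (rule fun_vs.span_add[rotated])
    then show "P \<in> ?S d" by simp
  qed
qed

end

text \<open>Unprefixed facts concern \<open>G\<close>, those with prefix \<open>sub\<close> concern
  \<open>G'\<close>; the generating reflections \<open>R\<close> belong to
  \<open>G'\<close>.\<close>

locale unitary_reflection_pair =
  finite_unitary_group G + sub: finite_unitary_group G' + sub: finite_reflection_group G' R
  for G G' R :: "(complex ^ 'n ^ 'n) set" +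
  assumes sub_subset: "G' \<subseteq> G"
begin

text \<open>Freeness in the form used later: a product relation with harmonic first factors and
  invariant second factors is already a tensor relation, in that every contraction of it
  vanishes.\<close>

lemma functional_relation:
  assumes l: "fun_functional l" and u: "u \<in> tensor_reps (harmonics G') (poly_invariants G')"
    and rel: "lin_ext pair_mult u = 0"
  shows "lin_ext (\<lambda>(P, Q). fun_scale (l P) Q) u = 0"
proof -
  let ?K = "Poly_Mapping.keys u" and ?u = "Poly_Mapping.lookup u"
  have K: "fst k \<in> harmonics G'" "snd k \<in> poly_invariants G'" if "k \<in> ?K" for k
    using u that by (auto simp: tensor_reps_def)
  have "finite (fst ` ?K)" by simp
  then obtain E m where E: "finite E" "E \<subseteq> fst ` ?K" "fun_vs.independent E"
    "\<And>b. fun_functional (m b)" "\<And>b b'. b \<in> E \<Longrightarrow> b' \<in> E \<Longrightarrow> m b b' = (if b = b' then 1 else 0)"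
    "\<And>P. P \<in> fst ` ?K \<Longrightarrow> P = (\<Sum>b\<in>E. fun_scale (m b P) b)"
    by (rule dual_family) blast
  have EH: "b \<in> harmonics G'" if "b \<in> E" for b using E(2) K that by auto
  define r where "r b = (\<Sum>k\<in>?K. fun_scale (?u k * m b (fst k)) (snd k))" for b
  have r: "r b \<in> poly_invariants G'" for b
    unfolding r_def by (intro fun_vs.subspace_sum fun_vs.subspace_scale subspace_invariants K)
  \<comment> \<open>Collecting by basis elements turns the given relation into one with invariant
    coefficients \<open>r b\<close>.\<close>
  have "(\<Sum>b\<in>E. r b * b) = (\<Sum>b\<in>E. b * r b)" by (simp only: mult.commute)
  also have "\<dots> = (\<Sum>k\<in>?K. \<Sum>b\<in>E. fun_scale (?u k * m b (fst k)) (b * snd k))"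
    unfolding r_def by (subst sum.swap) (simp add: sum_distrib_left)
  also have "\<dots> = (\<Sum>k\<in>?K. fun_scale (?u k) ((\<Sum>b\<in>E. fun_scale (m b (fst k)) b) * snd k))"
    by (simp add: sum_distrib_right fun_vs.scale_sum_right)
  also have "\<dots> = (\<Sum>k\<in>?K. fun_scale (?u k) (fst k * snd k))"
  proof (intro sum.cong refl)
    fix k assume "k \<in> ?K"
    then have "(\<Sum>b\<in>E. fun_scale (m b (fst k)) b) = fst k" by (intro E(6)[symmetric] imageI)
    then show "fun_scale (?u k) ((\<Sum>b\<in>E. fun_scale (m b (fst k)) b) * snd k) = fun_scale (?u k) (fst k * snd k)"
      by (simp only:)
  qed
  also have "\<dots> = 0" using rel by (simp add: lin_ext_def case_prod_beta)
  finally have "(\<Sum>b\<in>E. r b * b) = 0" .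
  then have r0: "\<forall>b\<in>E. r b = 0"
  \<comment> \<open>The basis is independent even modulo \<open>undetected G'\<close>: that set lies
    in the Hilbert ideal of \<open>G'\<close>, which meets the harmonics only in zero.\<close>
  proof (rule sub.invariant_independence[OF E(1), rotated 3])
    fix c assume c: "(\<Sum>b\<in>E. fun_scale (c b) b) \<in> undetected G'"
    then have "(\<Sum>b\<in>E. fun_scale (c b) b) \<in> hilbert_ideal G'" using sub.undetected_hilbert_ideal by blast
    moreover have "(\<Sum>b\<in>E. fun_scale (c b) b) \<in> harmonics G'"
      by (intro fun_vs.subspace_sum fun_vs.subspace_scale sub.subspace_harmonics EH)
    ultimately have 0: "(\<Sum>b\<in>E. fun_scale (c b) b) = 0" using sub.harmonics_hilbert_ideal by blast
    show "\<forall>b\<in>E. c b = 0"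
    proof
      fix b assume b: "b \<in> E"
      have "m b (\<Sum>b\<in>E. fun_scale (c b) b) = (\<Sum>b'\<in>E. c b' * m b b')"
        by (simp add: functional_facts[OF E(4)])
      also have "\<dots> = (\<Sum>b'\<in>E. if b' = b then c b' else 0)"
        using E(5)[OF b] by (intro sum.cong) auto
      also have "\<dots> = c b" using b E(1) by simp
      finally show "c b = 0" using functional_facts(2)[OF E(4), of b 0 0] 0 by simp
    qed
  qed (use r EH sub.harmonics_polyfuns in auto)
  have lP: "l (fst k) = (\<Sum>b\<in>E. m b (fst k) * l b)" if "k \<in> ?K" for k
  proof -
    have "l (\<Sum>b\<in>E. fun_scale (m b (fst k)) b) = (\<Sum>b\<in>E. m b (fst k) * l b)"
      by (simp add: functional_facts[OF l])
    moreover have "(\<Sum>b\<in>E. fun_scale (m b (fst k)) b) = fst k" using that by (intro E(6)[symmetric] imageI)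
    ultimately show ?thesis by (simp only:)
  qed
  have "lin_ext (\<lambda>(P, Q). fun_scale (l P) Q) u = (\<Sum>k\<in>?K. fun_scale (?u k * l (fst k)) (snd k))"
    by (simp add: lin_ext_def case_prod_beta)
  also have "\<dots> = (\<Sum>k\<in>?K. \<Sum>b\<in>E. fun_scale (l b) (fun_scale (?u k * m b (fst k)) (snd k)))"
    by (intro sum.cong refl)
       (simp add: lP sum_distrib_left fun_vs.scale_sum_left mult_ac)
  also have "\<dots> = (\<Sum>b\<in>E. fun_scale (l b) (r b))"
    by (subst sum.swap) (simp add: r_def fun_vs.scale_sum_right)
  also have "\<dots> = 0" using r0 by (intro sum.neutral) simp
  finally show ?thesis .
qed

lemma invariants_mono: "poly_invariants G \<subseteq> poly_invariants G'"
  using sub_subset by (auto simp: poly_invariants_def)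

lemma harmonics_fixed_eq: "harmonics_fixed G G' = harmonics G \<inter> poly_invariants G'"
  using harmonics_polyfuns by (auto simp: harmonics_fixed_def poly_invariants_def)

lemma subspace_harmonics_fixed: "fun_vs.subspace (harmonics_fixed G G')"
  unfolding harmonics_fixed_eq by (intro fun_vs.subspace_inter subspace_harmonics subspace_invariants)

text \<open>Elements of \<open>G'\<close> lie in \<open>G\<close> and so commute with the
  projection, which therefore preserves \<open>G'\<close>-invariance.\<close>

lemma harm_proj_invariants:
  assumes "f \<in> poly_invariants G'"
  shows "harm_proj f \<in> harmonics_fixed G G'"
proof -
  have f: "f \<in> polyfuns" using assms invariants_polyfuns by blast
  have "fun_act g (harm_proj f) = harm_proj f" if "g \<in> G'" for g
    using harm_proj_normalizer[OF normalizes_self f, of g] that sub_subset assms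
    by (auto simp: poly_invariants_def)
  then show ?thesis using harm_proj(1)[OF f] by (simp add: harmonics_fixed_def)
qed

lemma polyfuns_span: "polyfuns \<subseteq> fun_vs.span (pair_mult ` (harmonics G' \<times> poly_invariants G'))"
proof
  fix P :: "complex ^ 'n \<Rightarrow> complex" assume P: "P \<in> polyfuns"
  then obtain N where N: "P = (\<Sum>d\<le>N. hom_part d P)" using sum_parts by metis
  have "hom_part d P \<in> fun_vs.span (pair_mult ` (harmonics G' \<times> poly_invariants G'))" for d
  proof -
    have "hom_part d P \<in> fun_vs.span (pair_mult ` deg_pairs (harmonics G') (poly_invariants G') d)"
      using sub.polyfun_deg_harmonics_invariants hom_part_polyfun_deg by blast
    then show ?thesis by (rule rev_subsetD[OF _ fun_vs.span_mono]) (intro image_mono; blast)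
  qed
  then have "(\<Sum>d\<le>N. hom_part d P) \<in> fun_vs.span (pair_mult ` (harmonics G' \<times> poly_invariants G'))"
    by (rule fun_vs.span_sum)
  then show "P \<in> fun_vs.span (pair_mult ` (harmonics G' \<times> poly_invariants G'))" using N by metis
qed

text \<open>Expanding \<open>Q\<close> over \<open>G'\<close>, a generator \<open>f * Q\<close>
  becomes a sum of \<open>P * (f * g)\<close>, and \<open>f * g\<close> is both
  \<open>G'\<close>-invariant and in the ideal.\<close>

lemma hilbert_ideal_span:
  assumes "U \<in> hilbert_ideal G"
  shows "U \<in> fun_vs.span (pair_mult ` (harmonics G' \<times> (poly_invariants G' \<inter> hilbert_ideal G)))" (is "_ \<in> ?S")
  using assms
proof (rule hilbert_ideal.induct[where P = "\<lambda>U. U \<in> ?S"])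
  show "0 \<in> ?S" by (rule fun_vs.span_zero)
next
  fix P f Q :: "complex ^ 'n \<Rightarrow> complex"
  assume *: "P \<in> ?S" "f \<in> poly_invariants G" "f 0 = 0" "Q \<in> polyfuns"
  have "Q \<in> fun_vs.span (pair_mult ` (harmonics G' \<times> poly_invariants G'))" using polyfuns_span *(4) by blast
  then have "f * Q \<in> ?S"
  proof (rule mult_span)
    fix Y assume "Y \<in> pair_mult ` (harmonics G' \<times> poly_invariants G')"
    then obtain P g where Y: "P \<in> harmonics G'" "g \<in> poly_invariants G'" "Y = P * g" by auto
    have "f * g \<in> poly_invariants G'" using Y *(2) invariants_mono by (intro invariants_mult) auto
    moreover have "f * g \<in> hilbert_ideal G"
      using *(2,3) invariants_polyfuns[OF Y(2)] by (rule hilbert_ideal_gen)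
    ultimately have "pair_mult (P, f * g) \<in> ?S" using Y(1) by (intro fun_vs.span_base imageI) blast
    moreover have "f * Y = pair_mult (P, f * g)" using Y(3) by (simp add: mult.left_commute)
    ultimately show "f * Y \<in> ?S" by metis
  qed
  with *(1) show "P + f * Q \<in> ?S" by (rule fun_vs.span_add)
qed

text \<open>Each contraction of \<open>u\<close> is \<open>G\<close>-harmonic; by freeness it equals
  a contraction of a tensor with second factors in the ideal. So it lies in both spaces and
  vanishes.\<close>

lemma lin_ext_mult_kernel:
  assumes u: "u \<in> tensor_reps (harmonics G') (harmonics_fixed G G')"
    and I: "lin_ext pair_mult u \<in> hilbert_ideal G"
  shows "u \<in> rep_vs.span (bilinearity_relations (harmonics G') (harmonics_fixed G G'))"
proof (rule tensor_kernel[OF sub.subspace_harmonics subspace_harmonics_fixed u])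
  fix l :: "(complex ^ 'n \<Rightarrow> complex) \<Rightarrow> complex" assume l: "fun_functional l"
  obtain w where w: "w \<in> tensor_reps (harmonics G') (poly_invariants G' \<inter> hilbert_ideal G)"
    "lin_ext pair_mult u = lin_ext pair_mult w"
    using hilbert_ideal_span[OF I] unfolding lin_ext_image[symmetric] tensor_reps_def by blast
  have "u - w \<in> tensor_reps (harmonics G') (poly_invariants G')"
    by (rule tensor_reps_diff) (use u w in \<open>auto simp: tensor_reps_def harmonics_fixed_eq\<close>)
  moreover have "lin_ext pair_mult (u - w) = 0" using w(2) by (simp add: lin_ext_diff)
  ultimately have "lin_ext (\<lambda>(P, Q). fun_scale (l P) Q) (u - w) = 0" by (rule functional_relation[OF l])
  then have eq: "lin_ext (\<lambda>(P, Q). fun_scale (l P) Q) u = lin_ext (\<lambda>(P, Q). fun_scale (l P) Q) w"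
    by (simp add: lin_ext_diff)
  have "lin_ext (\<lambda>(P, Q). fun_scale (l P) Q) w \<in> hilbert_ideal G"
    unfolding lin_ext_def
    by (intro hilbert_ideal_sum hilbert_ideal_scale)
       (use w(1) in \<open>auto simp: tensor_reps_def intro!: hilbert_ideal_scale\<close>)
  moreover have "lin_ext (\<lambda>(P, Q). fun_scale (l P) Q) u \<in> harmonics G"
    unfolding lin_ext_def
    by (intro fun_vs.subspace_sum fun_vs.subspace_scale subspace_harmonics)
       (use u in \<open>auto simp: tensor_reps_def harmonics_fixed_eq intro!: fun_vs.subspace_scale subspace_harmonics\<close>)
  ultimately show "lin_ext (\<lambda>(P, Q). fun_scale (l P) Q) u = 0"
    using eq harmonics_hilbert_ideal by metis
qed

text \<open>In a product \<open>P * f\<close> with \<open>f\<close> invariant under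
  \<open>G'\<close>, replacing \<open>f\<close> by its harmonic part changes the product by an
  element of the ideal and keeps degree and invariance.\<close>

lemma polyfun_deg_mod_hilbert_ideal:
  assumes P: "P \<in> polyfun_deg d"
  shows "\<exists>u. Poly_Mapping.keys u \<subseteq> deg_pairs (harmonics G') (harmonics_fixed G G') d \<and>
    P - lin_ext pair_mult u \<in> hilbert_ideal G"
proof -
  let ?T = "fun_vs.span (pair_mult ` deg_pairs (harmonics G') (harmonics_fixed G G') d)"
  have "fun_vs.span (pair_mult ` deg_pairs (harmonics G') (poly_invariants G') d) \<subseteq> {X. \<exists>Y\<in>?T. X - Y \<in> hilbert_ideal G}"
  proof (rule fun_vs.span_minimal)
    show "pair_mult ` deg_pairs (harmonics G') (poly_invariants G') d \<subseteq> {X. \<exists>Y\<in>?T. X - Y \<in> hilbert_ideal G}"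
    proof
      fix X assume "X \<in> pair_mult ` deg_pairs (harmonics G') (poly_invariants G') d"
      then obtain i P f where X: "i \<le> d" "P \<in> harmonics G'" "P \<in> polyfun_deg i" "f \<in> poly_invariants G'"
        "f \<in> polyfun_deg (d - i)" "X = P * f" by auto
      have "(P, harm_proj f) \<in> deg_pairs (harmonics G') (harmonics_fixed G G') d"
        using X harm_proj_invariants harm_proj_polyfun_deg by (intro UN_I[of i]) auto
      then have "pair_mult (P, harm_proj f) \<in> ?T" by (intro fun_vs.span_base imageI)
      moreover have "X - pair_mult (P, harm_proj f) = P * (f - harm_proj f)"
        using X(6) by (simp add: algebra_simps)
      then have "X - pair_mult (P, harm_proj f) \<in> hilbert_ideal G"
        by (simp only: hilbert_ideal_mult harm_proj(2) invariants_polyfuns[OF X(4)] sub.harmonics_polyfuns[OF X(2)])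
      ultimately show "X \<in> {X. \<exists>Y\<in>?T. X - Y \<in> hilbert_ideal G}" by (intro CollectI bexI)
    qed
    show "fun_vs.subspace {X. \<exists>Y\<in>?T. X - Y \<in> hilbert_ideal G}"
      unfolding fun_vs.subspace_def
    proof (intro conjI ballI allI CollectI)
      show "\<exists>Y\<in>?T. 0 - Y \<in> hilbert_ideal G"
        by (rule bexI[OF _ fun_vs.span_zero]) (simp add: hilbert_ideal.zero)
    next
      fix X X' assume "X \<in> {X. \<exists>Y\<in>?T. X - Y \<in> hilbert_ideal G}" "X' \<in> {X. \<exists>Y\<in>?T. X - Y \<in> hilbert_ideal G}"
      then obtain Y Y' where *: "Y \<in> ?T" "X - Y \<in> hilbert_ideal G" "Y' \<in> ?T" "X' - Y' \<in> hilbert_ideal G"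
        by blast
      have "X + X' - (Y + Y') = (X - Y) + (X' - Y')" by simp
      then have "X + X' - (Y + Y') \<in> hilbert_ideal G" using * hilbert_ideal_add by metis
      then show "\<exists>Y\<in>?T. X + X' - Y \<in> hilbert_ideal G" using * fun_vs.span_add by blast
    next
      fix c X assume "X \<in> {X. \<exists>Y\<in>?T. X - Y \<in> hilbert_ideal G}"
      then obtain Y where *: "Y \<in> ?T" "X - Y \<in> hilbert_ideal G" by blast
      have "fun_scale c X - fun_scale c Y = fun_scale c (X - Y)" by (simp add: fun_vs.scale_right_diff_distrib)
      then have "fun_scale c X - fun_scale c Y \<in> hilbert_ideal G" using * hilbert_ideal_scale by metis
      then show "\<exists>Y\<in>?T. fun_scale c X - Y \<in> hilbert_ideal G" using * fun_vs.span_scale by blast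
    qed
  qed
  then obtain Y where "Y \<in> ?T" "P - Y \<in> hilbert_ideal G"
    using sub.polyfun_deg_harmonics_invariants P by blast
  then show ?thesis unfolding lin_ext_image[symmetric] by blast
qed

lemma lin_ext_mult_polyfuns:
  assumes "u \<in> tensor_reps (harmonics G') (harmonics_fixed G G')"
  shows "lin_ext pair_mult u \<in> polyfuns"
  unfolding lin_ext_def
  by (intro polyfuns_sum polyfuns_scale)
     (use assms in \<open>auto simp: tensor_reps_def harmonics_fixed_def harmonics_polyfuns
        sub.harmonics_polyfuns intro!: polyfuns_mult\<close>)

theorem harmonics_tensor_iso:
  assumes N: "\<And>n. n \<in> N \<Longrightarrow> normalizes n G \<and> normalizes n G'"
  shows "\<exists>\<xi>. graded_module_iso N (harmonics G') (harmonics_fixed G G') (harmonics G) \<xi>"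
proof (rule graded_module_iso_exists[where \<Phi> = "\<lambda>u. harm_proj (lin_ext pair_mult u)"])
  let ?T = "tensor_reps (harmonics G') (harmonics_fixed G G')"
  note S = lin_ext_mult_polyfuns
  fix u w :: "(complex ^ 'n, complex ^ 'n) tensor_rep" and c and n :: "complex ^ 'n ^ 'n"
  assume u: "u \<in> ?T"
  show "harm_proj (lin_ext pair_mult (rep_scale c u)) = fun_scale c (harm_proj (lin_ext pair_mult u))"
    by (simp add: lin_ext_scale harm_proj_scale S u)
  show "harm_proj (lin_ext pair_mult (u + w)) = harm_proj (lin_ext pair_mult u) + harm_proj (lin_ext pair_mult w)"
    if "w \<in> ?T"
    by (simp add: lin_ext_add harm_proj_add S u that)
  show "harm_proj (lin_ext pair_mult u) = 0 \<longleftrightarrow>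
      u \<in> rep_vs.span (bilinearity_relations (harmonics G') (harmonics_fixed G G'))"
  proof
    assume "harm_proj (lin_ext pair_mult u) = 0"
    then show "u \<in> rep_vs.span (bilinearity_relations (harmonics G') (harmonics_fixed G G'))"
      using lin_ext_mult_kernel[OF u] harm_proj_eq_0_iff[OF S[OF u]] by blast
  next
    assume "u \<in> rep_vs.span (bilinearity_relations (harmonics G') (harmonics_fixed G G'))"
    then have "lin_ext pair_mult u = 0"
      by (rule lin_ext_bilinearity_relations[rotated 4]) (simp_all add: algebra_simps)
    then show "harm_proj (lin_ext pair_mult u) = 0"
      using harm_proj_eq_0_iff hilbert_ideal.zero by (metis S[OF u])
  qed
  assume n: "n \<in> N"
  have H': "fun_act n P \<in> harmonics G'" if "P \<in> harmonics G'" for P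
    using sub.harmonics_normalizer N[OF n] that by blast
  have F: "fun_act n P \<in> harmonics_fixed G G'" if "P \<in> harmonics_fixed G G'" for P
    using that N[OF n] harmonics_normalizer sub.invariants_normalizer unfolding harmonics_fixed_eq by blast
  let ?a = "\<lambda>k. rep_scale (Poly_Mapping.lookup u k) (pure_tensor (fun_act n (fst k)) (fun_act n (snd k)))"
  have act: "rep_act n u = (\<Sum>k\<in>Poly_Mapping.keys u. ?a k)"
    by (simp add: rep_act_def case_prod_beta)
  have "Poly_Mapping.keys (?a k) \<subseteq> harmonics G' \<times> harmonics_fixed G G'" if "k \<in> Poly_Mapping.keys u" for k
  proof -
    have "fst k \<in> harmonics G'" "snd k \<in> harmonics_fixed G G'"
      using u that by (auto simp: tensor_reps_def)
    then show ?thesis by (auto simp: rep_scale_single H' F)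
  qed
  then have "rep_act n u \<in> ?T"
    unfolding act tensor_reps_def using Poly_Mapping.keys_sum[of ?a "Poly_Mapping.keys u"] by blast
  moreover have "lin_ext pair_mult (rep_act n u) = fun_act n (lin_ext pair_mult u)"
    unfolding act lin_ext_sum
    by (simp add: lin_ext_scale lin_ext_single lin_ext_def[of _ u] fun_act_sum case_prod_beta)
  ultimately show "rep_act n u \<in> ?T \<and>
      harm_proj (lin_ext pair_mult (rep_act n u)) = fun_act n (harm_proj (lin_ext pair_mult u))"
    using harm_proj_normalizer S[OF u] N[OF n] by simp
next
  let ?\<Phi> = "\<lambda>u. harm_proj (lin_ext pair_mult u)"
  let ?A = "harmonics G'" and ?B = "harmonics_fixed G G'"
  have sub: "{u. Poly_Mapping.keys u \<subseteq> deg_pairs ?A ?B d} \<subseteq> tensor_reps ?A ?B" for d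
    unfolding tensor_reps_def by blast
  \<comment> \<open>Congruence modulo the ideal means equal harmonic projections, so degreewise
    surjectivity modulo the ideal is surjectivity of \<open>?\<Phi>\<close>.\<close>
  have lift: "\<exists>u. Poly_Mapping.keys u \<subseteq> deg_pairs ?A ?B d \<and> ?\<Phi> u = harm_proj P"
    if P: "P \<in> polyfun_deg d" for P d
  proof -
    obtain u where u: "Poly_Mapping.keys u \<subseteq> deg_pairs ?A ?B d" "P - lin_ext pair_mult u \<in> hilbert_ideal G"
      using polyfun_deg_mod_hilbert_ideal[OF P] by blast
    have "u \<in> tensor_reps ?A ?B" using u(1) sub by blast
    then have uS: "lin_ext pair_mult u \<in> polyfuns" by (rule lin_ext_mult_polyfuns)
    have "P - harm_proj (lin_ext pair_mult u) =
        (P - lin_ext pair_mult u) + (lin_ext pair_mult u - harm_proj (lin_ext pair_mult u))" by simp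
    also have "\<dots> \<in> hilbert_ideal G" by (intro hilbert_ideal_add harm_proj(2) uS u(2))
    finally have "harm_proj P = ?\<Phi> u" by (rule harm_proj_unique[OF harm_proj(1)[OF uS]])
    then show ?thesis by (intro exI[of _ u] conjI u(1)) (rule sym)
  qed
  show deg: "?\<Phi> ` {u. Poly_Mapping.keys u \<subseteq> deg_pairs ?A ?B d} = harmonics G \<inter> polyfun_deg d" for d
  proof (intro equalityI subsetI)
    fix P assume "P \<in> ?\<Phi> ` {u. Poly_Mapping.keys u \<subseteq> deg_pairs ?A ?B d}"
    then obtain u where u: "Poly_Mapping.keys u \<subseteq> deg_pairs ?A ?B d" "P = ?\<Phi> u" by blast
    have "pair_mult k \<in> polyfun_deg d" if "k \<in> Poly_Mapping.keys u" for k
    proof -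
      have "k \<in> deg_pairs ?A ?B d" using u(1) that by blast
      then obtain i Q Q' where "i \<le> d" "k = (Q, Q')" "Q \<in> polyfun_deg i" "Q' \<in> polyfun_deg (d - i)"
        by auto
      then show ?thesis using polyfun_deg_mult[of Q i Q' "d - i"] by simp
    qed
    then have "lin_ext pair_mult u \<in> polyfun_deg d"
      unfolding lin_ext_def by (intro polyfun_deg_sum polyfun_deg_scale)
    then show "P \<in> harmonics G \<inter> polyfun_deg d"
      unfolding u(2) using harm_proj(1) polyfun_deg_polyfuns harm_proj_polyfun_deg by blast
  next
    fix P assume "P \<in> harmonics G \<inter> polyfun_deg d"
    then show "P \<in> ?\<Phi> ` {u. Poly_Mapping.keys u \<subseteq> deg_pairs ?A ?B d}"
      using lift[of P d] harm_proj_harmonics[of P] by (auto simp: image_iff)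
  qed
  show "?\<Phi> ` tensor_reps ?A ?B = harmonics G"
  proof (intro equalityI subsetI)
    fix P assume "P \<in> ?\<Phi> ` tensor_reps ?A ?B"
    then show "P \<in> harmonics G" using harm_proj(1) lin_ext_mult_polyfuns by blast
  next
    fix P assume P: "P \<in> harmonics G"
    have "\<exists>u\<in>tensor_reps ?A ?B. ?\<Phi> u = harm_proj P"
      using harmonics_polyfuns[OF P]
    proof (rule polyfuns_induct[where Pr = "\<lambda>P. \<exists>u\<in>tensor_reps ?A ?B. ?\<Phi> u = harm_proj P"])
      fix d and P :: "complex ^ 'n \<Rightarrow> complex" assume "P \<in> polyfun_deg d"
      then show "\<exists>u\<in>tensor_reps ?A ?B. ?\<Phi> u = harm_proj P" using lift sub by blast
    next
      show "\<exists>u\<in>tensor_reps ?A ?B. ?\<Phi> u = harm_proj 0"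
        by (intro bexI[of _ 0]) (simp_all add: tensor_reps_def)
    next
      fix P Q :: "complex ^ 'n \<Rightarrow> complex"
      assume PQ: "P \<in> polyfuns" "Q \<in> polyfuns"
        and "\<exists>u\<in>tensor_reps ?A ?B. ?\<Phi> u = harm_proj P" "\<exists>u\<in>tensor_reps ?A ?B. ?\<Phi> u = harm_proj Q"
      then obtain u w where uw: "u \<in> tensor_reps ?A ?B" "w \<in> tensor_reps ?A ?B"
        "?\<Phi> u = harm_proj P" "?\<Phi> w = harm_proj Q" by blast
      then have "?\<Phi> (u + w) = harm_proj (P + Q)"
        using PQ by (simp add: lin_ext_add harm_proj_add lin_ext_mult_polyfuns)
      then show "\<exists>u\<in>tensor_reps ?A ?B. ?\<Phi> u = harm_proj (P + Q)"
        using tensor_reps_add uw by blast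
    qed
    then show "P \<in> ?\<Phi> ` tensor_reps ?A ?B" using harm_proj_harmonics[OF P] by (auto simp: image_iff)
  qed
qed

end

section \<open>From the group-theoretic hypotheses to the locales\<close>

lemma finite_linear_group_subgroup:
  assumes "subgroup G GL" "finite G"
  shows "finite_linear_group G"
proof
  show "mat 1 \<in> G" using subgroup.one_closed[OF assms(1)] by (simp add: GL_def)
  show "g ** h \<in> G" if "g \<in> G" "h \<in> G" for g h
    using subgroup.m_closed[OF assms(1) that] by (simp add: GL_def)
  show inv: "invertible g" if "g \<in> G" for g
    using subgroup.subset[OF assms(1)] that by (auto simp: GL_def)
  show "matrix_inv g \<in> G" if "g \<in> G" for g
    using subgroup.m_inv_closed[OF assms(1) that] inv_GL[OF inv[OF that]] by simp
qed (rule assms(2))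

text \<open>The library normalizer is a stabilizer and yields that conjugation by \<open>n\<close>
  maps \<open>G\<close> onto itself; its surjectivity provides the other conjugate.\<close>

lemma (in finite_linear_group) normalizer_normalizes:
  assumes "n \<in> normalizer GL G"
  shows "normalizes n G"
proof -
  have sub: "G \<subseteq> carrier GL" using invertible by (auto simp: GL_def)
  have n: "invertible n" and eq: "n <#\<^bsub>GL\<^esub> G #>\<^bsub>GL\<^esub> inv\<^bsub>GL\<^esub> n = G"
    using assms sub by (auto simp: normalizer_def stabilizer_def GL_def)
  have "n <#\<^bsub>GL\<^esub> G #>\<^bsub>GL\<^esub> inv\<^bsub>GL\<^esub> n = (\<lambda>g. n ** g ** matrix_inv n) ` G"
    unfolding inv_GL[OF n] by (auto simp: l_coset_def r_coset_def GL_def)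
  then have img: "(\<lambda>g. n ** g ** matrix_inv n) ` G = G" using eq by simp
  have "matrix_inv n ** g ** n \<in> G" if g: "g \<in> G" for g
  proof -
    obtain h where h: "h \<in> G" "g = n ** h ** matrix_inv n" using img g by blast
    have "matrix_inv n ** g ** n = h"
      unfolding h(2) by (metis matrix_inv_simps[OF n] matrix_mul_assoc matrix_mul_lid matrix_mul_rid)
    then show ?thesis using h(1) by simp
  qed
  then show ?thesis unfolding normalizes_def using n img by blast
qed

lemma unitary_mult: "is_unitary g \<Longrightarrow> is_unitary h \<Longrightarrow> is_unitary (g ** h)"
  by (simp add: is_unitary_def flip: matrix_vector_mul_assoc)

lemma unitary_inverse:
  assumes "is_unitary g"
  shows "is_unitary (matrix_inv g)"
proof -
  have "g *v (matrix_inv g *v x) = x" for x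
    using unitary_matrix_inv(1)[OF assms] by (simp add: matrix_vector_mul_assoc matrix_inv_simps)
  then show ?thesis using assms unfolding is_unitary_def by metis
qed

lemma generate_unitary:
  assumes "R \<subseteq> {A. is_unitary A}" "g \<in> generate GL R"
  shows "is_unitary g"
  using assms(2)
proof (induction rule: generate.induct)
  case one
  show ?case by (simp add: GL_def is_unitary_def)
next
  case (incl h)
  then show ?case using assms(1) by blast
next
  case (inv h)
  then have "is_unitary h" using assms(1) by blast
  then show ?case using inv_GL[OF unitary_matrix_inv(1)] unitary_inverse by metis
next
  case (eng g h)
  then show ?case by (simp add: GL_def unitary_mult)
qed

theorem theorem2p1:
  fixes G G' :: "(complex ^ 'n ^ 'n) set"
  assumes "finite_unitary_reflection_group G"
    and "reflection_subgroup G' G"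
  shows "\<exists>\<xi>. graded_module_iso (normalizer GL G \<inter> normalizer GL G')
           (harmonics G') (harmonics_fixed G G') (harmonics G) \<xi>"
proof -
  obtain Q where G: "finite G" "Q \<subseteq> {A. is_reflection A \<and> is_unitary A}" "G = generate GL Q"
    using assms(1) by (auto simp: finite_unitary_reflection_group_def)
  obtain R where G': "R \<subseteq> {A \<in> G. is_reflection A}" "G' = generate GL R"
    using assms(2) by (auto simp: reflection_subgroup_def)
  have carrier: "Q \<subseteq> carrier GL" "R \<subseteq> carrier GL"
    using G(2) G'(1) reflection_invertible by (auto simp: GL_def)
  have subG: "subgroup G GL" "subgroup G' GL"
    unfolding G(3) G'(2) by (intro group.generate_is_subgroup group_GL carrier)+
  have "G' \<subseteq> G"
    unfolding G'(2) using group.generate_subgroup_incl[OF group_GL _ subG(1), of R] G'(1) by blast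
  \<comment> \<open>Unitarity passes from the generators to \<open>G\<close>, and \<open>G'\<close>
    inherits it as a subset, whichever reflections of \<open>G\<close> generate it.\<close>
  have unit: "is_unitary g" if "g \<in> G" for g
    using generate_unitary[of Q g] G that by blast
  interpret G: finite_linear_group G by (rule finite_linear_group_subgroup[OF subG(1) G(1)])
  interpret G': finite_linear_group G'
    by (rule finite_linear_group_subgroup[OF subG(2) finite_subset[OF \<open>G' \<subseteq> G\<close> G(1)]])
  interpret unitary_reflection_pair G G' R
    by unfold_locales (use unit \<open>G' \<subseteq> G\<close> G' in auto)
  show ?thesis
    by (rule harmonics_tensor_iso) (use G.normalizer_normalizes G'.normalizer_normalizes in blast)
qed

end
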